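(* Let $r,k\in\mathbb N$, $p\in\mathcal P^{\log}$ and $\omega\in A_{p(\cdot)}$. Then there is a positive constant $c$ depending only on $r,k,p,\omega$ such that for every $f\in L^{p(\cdot)}_{2\pi,\omega}$ and every $t\in(0,1/2)$ the Marchaud type inequality $$K_r(f,t,p(\cdot),\omega)\le c\,t^r\int_t^1\frac{K_{r+k}(f,u,p(\cdot),\omega)}{u^{r+1}}\,du$$ holds.
   Context: Let $\mathsf T=[-\pi,\pi]$; $|B|$ denotes the Lebesgue measure of $B$; $\mathbb N=\{1,2,\dots\}$. $\mathcal P$ is the set of measurable $p:\mathsf T\to[1,\infty)$ with $\operatorname{ess\,sup}_{\mathsf T}p<\infty$. $\mathcal P^{\log}$ is the set of $p\in\mathcal P$ such that $q=1/p$ satisfies, for some constant $c>0$, $|q(x)-q(y)|\le c/\ln(e+1/|x-y|)$ for all $x\ne y$ in $\mathsf T$. A weight $\omega$ is a $2\pi$-periodic Lebesgue measurable function with values in $[0,\infty]$ that is positive a.e. $L^{p(\cdot)}_{2\pi,\omega}$ is the space of $2\pi$-periodic measurable real functions $f$ with $\|f\|_{p(\cdot),\omega}=\inf\{\alpha>0:\int_{\mathsf T}|f(x)/\alpha|^{p(x)}\omega(x)\,dx\le1\}<\infty$. $p'(x)=p(x)/(p(x)-1)$ if $p(x)>1$ and $p'(x)=\infty$ if $p(x)=1$. $A_{p(\cdot)}$ is the class of weights $\omega$ with $$\sup_{B}\frac{\|\omega\|_{L^1(B)}}{|B|^{p_B}}\left\|\frac1\omega\right\|_{B,p'(\cdot)/p(\cdot)}<\infty,\qquad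 \frac1{p_B}=\frac1{|B|}\int_B\frac{dx}{p(x)},$$ the supremum being over intervals $B\subseteq\mathsf T$ of positive length. Here $\|g\|_{B,q(\cdot)}=\inf\{\alpha>0:\int_B\varphi_{q(x)}(|g(x)|/\alpha)\,dx\le1\}$ with $\varphi_q(t)=t^q$ for $0<q<\infty$, and $\varphi_\infty(t)=0$ for $t\le1$, $\varphi_\infty(t)=\infty$ for $t>1$; $p'(x)/p(x)=1/(p(x)-1)$, equal to $\infty$ where $p(x)=1$. $W^r_{p(\cdot),\omega}$ is the set of $f\in L^{p(\cdot)}_{2\pi,\omega}$ such that $f^{(r-1)}$ is absolutely continuous and $f^{(r)}\in L^{p(\cdot)}_{2\pi,\omega}$. $K_r(f,\delta,p(\cdot),\omega)=\inf_{g\in W^r_{p(\cdot),\omega}}\{\|f-g\|_{p(\cdot),\omega}+\delta^r\|g^{(r)}\|_{p(\cdot),\omega}\}$. *)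

theory Defs
  imports "HOL-Analysis.Analysis" "HOL-Probability.Essential_Supremum" "HOL-Library.Periodic_Fun"
begin

definition torus :: "real set" where
  "torus = {-pi..pi}"

text \<open>An exponent is a function on \<^term>\<open>torus\<close>; its values off \<^term>\<open>torus\<close> are never used.\<close>

definition exponents :: "(real \<Rightarrow> real) set" where
  "exponents = {p. p \<in> borel_measurable (lebesgue_on torus) \<and> (\<forall>x\<in>torus. 1 \<le> p x) \<and>
      esssup (lebesgue_on torus) (\<lambda>x. ereal (p x)) < \<infinity>}"

definition log_exponents :: "(real \<Rightarrow> real) set" where
  "log_exponents = {p \<in> exponents. \<exists>c>0. \<forall>x\<in>torus. \<forall>y\<in>torus. x \<noteq> y \<longrightarrow>
      \<bar>1 / p x - 1 / p y\<bar> \<le> c / ln (exp 1 + 1 / \<bar>x - y\<bar>)}"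

definition is_weight :: "(real \<Rightarrow> ennreal) \<Rightarrow> bool" where
  "is_weight \<omega> \<longleftrightarrow> periodic_fun_simple \<omega> (2 * pi) \<and> \<omega> \<in> borel_measurable lebesgue \<and>
      (AE x in lebesgue. 0 < \<omega> x)"

text \<open>The norm takes the value \<^term>\<open>\<infinity>::ennreal\<close> when no \<^term>\<open>\<alpha>\<close> is admissible.
  Functions are kept as functions, not identified when they agree almost everywhere.\<close>

definition lp_norm :: "(real \<Rightarrow> real) \<Rightarrow> (real \<Rightarrow> ennreal) \<Rightarrow> (real \<Rightarrow> real) \<Rightarrow> ennreal" where
  "lp_norm p \<omega> f = Inf {ennreal \<alpha> |\<alpha>. 0 < \<alpha> \<and>
      (\<integral>\<^sup>+x\<in>torus. ennreal (\<bar>f x / \<alpha>\<bar> powr p x) * \<omega> x \<partial>lebesgue) \<le> 1}"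

definition lp_space :: "(real \<Rightarrow> real) \<Rightarrow> (real \<Rightarrow> ennreal) \<Rightarrow> (real \<Rightarrow> real) set" where
  "lp_space p \<omega> = {f. periodic_fun_simple f (2 * pi) \<and> f \<in> borel_measurable lebesgue \<and>
      lp_norm p \<omega> f < \<infinity>}"

definition mod_fun :: "ennreal \<Rightarrow> ennreal \<Rightarrow> ennreal" where
  "mod_fun q t =
    (if q = \<infinity> then (if t \<le> 1 then 0 else \<infinity>)
     else if t = \<infinity> then \<infinity> else ennreal (enn2real t powr enn2real q))"

definition local_norm :: "real set \<Rightarrow> (real \<Rightarrow> ennreal) \<Rightarrow> (real \<Rightarrow> ennreal) \<Rightarrow> ennreal" where
  "local_norm B q g = Inf {ennreal \<alpha> |\<alpha>. 0 < \<alpha> \<and>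
      (\<integral>\<^sup>+x\<in>B. mod_fun (q x) (g x / ennreal \<alpha>) \<partial>lebesgue) \<le> 1}"

definition conj_exponent :: "real \<Rightarrow> ennreal" where
  "conj_exponent s = (if 1 < s then ennreal (s / (s - 1)) else \<infinity>)"

definition mean_exponent :: "(real \<Rightarrow> real) \<Rightarrow> real set \<Rightarrow> real" where
  "mean_exponent p B = inverse (1 / measure lebesgue B * (LINT x:B|lebesgue. 1 / p x))"

text \<open>Arithmetic in \<^typ>\<open>ennreal\<close>: \<open>1 / 0 = \<infinity>\<close>, \<open>1 / \<infinity> = 0\<close>, \<open>\<infinity> / s = \<infinity>\<close> for
  \<open>0 < s < \<infinity>\<close>, and \<open>\<infinity> * 0 = 0\<close>. The last convention only affects the degenerate weight that is
  infinite almost everywhere: any other weight that is not integrable over \<^term>\<open>torus\<close>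
  already makes the supremum infinite.\<close>

definition muckenhoupt :: "(real \<Rightarrow> real) \<Rightarrow> (real \<Rightarrow> ennreal) set" where
  "muckenhoupt p = {\<omega>. is_weight \<omega> \<and>
      (SUP B\<in>{B. is_interval B \<and> B \<subseteq> torus \<and> 0 < measure lebesgue B}.
        (\<integral>\<^sup>+x\<in>B. \<omega> x \<partial>lebesgue) / ennreal (measure lebesgue B powr mean_exponent p B)
        * local_norm B (\<lambda>x. conj_exponent (p x) / ennreal (p x)) (\<lambda>x. 1 / \<omega> x)) < \<infinity>}"

definition abs_continuous_on :: "real \<Rightarrow> real \<Rightarrow> (real \<Rightarrow> real) \<Rightarrow> bool" where
  "abs_continuous_on a b f \<longleftrightarrow>
    (\<forall>\<epsilon>>0. \<exists>\<delta>>0. \<forall>(n::nat) u v.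
      (\<forall>i<n. a \<le> u i \<and> u i \<le> v i \<and> v i \<le> b) \<longrightarrow>
      (\<forall>i<n. \<forall>j<n. i \<noteq> j \<longrightarrow> {u i<..<v i} \<inter> {u j<..<v j} = {}) \<longrightarrow>
      (\<Sum>i<n. v i - u i) < \<delta> \<longrightarrow>
      (\<Sum>i<n. \<bar>f (v i) - f (u i)\<bar>) < \<epsilon>)"

text \<open>In the definition below the derivatives of order less than \<open>r\<close> exist everywhere on the
  real line, while the one of order \<open>r\<close> exists almost everywhere. At points of
  non-differentiability \<^const>\<open>deriv\<close> has one fixed value, so it preserves periodicity.
  By periodicity, absolute continuity on one period is the same as absolute continuity
  on every compact interval.\<close>

definition sobolev :: "nat \<Rightarrow> (real \<Rightarrow> real) \<Rightarrow> (real \<Rightarrow> ennreal) \<Rightarrow> (real \<Rightarrow> real) set" where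
  "sobolev r p \<omega> = {f \<in> lp_space p \<omega>.
      (\<forall>j<r - 1. \<forall>x. (deriv ^^ j) f differentiable at x) \<and>
      abs_continuous_on (-pi) pi ((deriv ^^ (r - 1)) f) \<and>
      (deriv ^^ r) f \<in> lp_space p \<omega>}"

definition K_functional ::
    "nat \<Rightarrow> (real \<Rightarrow> real) \<Rightarrow> real \<Rightarrow> (real \<Rightarrow> real) \<Rightarrow> (real \<Rightarrow> ennreal) \<Rightarrow> ennreal" where
  "K_functional r f \<delta> p \<omega> = (INF g\<in>sobolev r p \<omega>.
      lp_norm p \<omega> (\<lambda>x. f x - g x) + ennreal (\<delta> ^ r) * lp_norm p \<omega> ((deriv ^^ r) g))"

end

theory Submission
  imports Defs
begin

text \<open>
  The inequality is obtained by telescoping over dyadic scales. Let \<open>K u\<close> be the functional of order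
  \<open>r + k\<close> of \<open>f\<close> at \<open>u\<close>, and let \<open>g j\<close> nearly attain it at \<open>u j = 2 ^ j * t\<close>, for \<open>j \<le> J\<close> with \<open>u J\<close> between
  \<open>1/4\<close> and \<open>1/2\<close>. Then the functional of order \<open>r\<close> at \<open>t\<close> is at most the norm of \<open>f - g 0\<close> plus
  \<open>t ^ r\<close> times the norm of the \<open>r\<close>-th derivative of \<open>g 0\<close>. Two inequalities suffice to bound the latter
  by a multiple of the sum of \<open>K (u j) / u j ^ r\<close>, which the integral dominates because \<open>K\<close> is increasing:
  \<^item> interpolation, for \<open>0 < u \<le> 1\<close>: the norm of the \<open>r\<close>-th derivative of \<open>g\<close> is at most a constant times
    \<open>1 / u ^ r\<close> times the sum of the norm of \<open>g\<close> and \<open>u ^ (r + k)\<close> times the norm of its derivative of order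
    \<open>r + k\<close>; it is applied to \<open>g j - g (j + 1)\<close> at the scale \<open>u j\<close>
    (\<open>interpolation_inequality\<close>);
  \<^item> a Poincare inequality, which bounds the norm of the \<open>r\<close>-th derivative of a periodic \<open>g\<close> by that of the
    derivative of order \<open>r + k\<close>; it is applied to \<open>g J\<close> (\<open>poincare_inequality\<close>).

  Both are consequences of elementary pointwise estimates on an interval of length \<open>d\<close>, in which
  derivatives are bounded by averages over that interval (\<open>derivative_bound_on_interval\<close>,
  \<open>periodic_derivative_bound\<close>). The weight and the variable exponent enter only through the fact that
  averaging over the cells of an equidistant partition of the torus is bounded on the weighted space,
  uniformly in the number of cells (\<open>cell_average_norm_le\<close>).

  For a constant exponent that fact is Hoelder's inequality combined with the Muckenhoupt condition on
  each cell. For a variable exponent let \<open>f\<close> have modular at most \<open>1\<close>. Where the average of \<open>\<bar>f\<bar>\<close> is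
  at most \<open>1\<close>, the total mass of the weight is a sufficient bound; if that mass is infinite, \<open>f\<close> vanishes
  almost everywhere. Where the average is larger, both the average over the cell and the integral lie
  between powers of the length of the cell, up to constants, and log-Hoelder continuity allows the
  exponent to be replaced by its mean over the cell, as in the Muckenhoupt condition
  (\<open>local_modular_bound\<close>).

  The highest derivative of a function of a Sobolev class exists only almost everywhere. It enters the
  estimates through its integral over an interval, which bounds the increments of the derivative below
  it (\<open>abs_continuous_increment_le\<close>). This follows from the Jordan decomposition of an absolutely
  continuous function, the Radon-Nikodym theorem for the Stieltjes measures of its monotone parts, and
  Lebesgue's differentiation theorem.
\<close>

section \<open>Absolutely continuous functions\<close>

definition small_variation :: "real \<Rightarrow> real \<Rightarrow> (real \<Rightarrow> real) \<Rightarrow> real \<Rightarrow> real \<Rightarrow> bool" where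
  "small_variation a b f \<delta> \<epsilon> \<longleftrightarrow> (\<forall>(n::nat) u v.
      (\<forall>i<n. a \<le> u i \<and> u i \<le> v i \<and> v i \<le> b) \<longrightarrow>
      (\<forall>i<n. \<forall>j<n. i \<noteq> j \<longrightarrow> {u i<..<v i} \<inter> {u j<..<v j} = {}) \<longrightarrow>
      (\<Sum>i<n. v i - u i) < \<delta> \<longrightarrow>
      (\<Sum>i<n. \<bar>f (v i) - f (u i)\<bar>) < \<epsilon>)"

lemma abs_continuous_onE:
  assumes "abs_continuous_on a b f" and "0 < e"
  obtains d where "0 < d" and "small_variation a b f d e"
  using assms unfolding abs_continuous_on_def small_variation_def by blast

lemma small_variation_finite_family:
  assumes small: "small_variation a b f \<delta> \<epsilon>"
    and "finite I"
    and bounds: "\<And>i. i \<in> I \<Longrightarrow> a \<le> u i \<and> u i \<le> v i \<and> v i \<le> (b::real)"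
    and disj: "\<And>i j. i \<in> I \<Longrightarrow> j \<in> I \<Longrightarrow> i \<noteq> j \<Longrightarrow> {u i<..<v i} \<inter> {u j<..<v j} = {}"
    and len: "(\<Sum>i\<in>I. v i - u i) < \<delta>"
  shows "(\<Sum>i\<in>I. \<bar>f (v i) - f (u i)\<bar>) < \<epsilon>"
proof -
  obtain h where h: "bij_betw h {..<card I} I"
    using ex_bij_betw_nat_finite[OF \<open>finite I\<close>] by (auto simp: lessThan_atLeast0)
  have hI: "h i \<in> I" if "i < card I" for i
    using h that by (auto simp: bij_betw_def)
  have inj: "h i \<noteq> h j" if "i < card I" "j < card I" "i \<noteq> j" for i j
    using h that by (auto simp: bij_betw_def inj_on_def)
  have "(\<Sum>i<card I. \<bar>f (v (h i)) - f (u (h i))\<bar>) < \<epsilon>"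
  proof (rule small[unfolded small_variation_def, rule_format])
    show "(\<Sum>i<card I. v (h i) - u (h i)) < \<delta>"
      using len by (simp add: sum.reindex_bij_betw[OF h, of "\<lambda>i. v i - u i"])
    show "a \<le> u (h i) \<and> u (h i) \<le> v (h i) \<and> v (h i) \<le> b" if "i < card I" for i
      using bounds hI that by blast
    show "{u (h i)<..<v (h i)} \<inter> {u (h j)<..<v (h j)} = {}"
      if "i < card I" "j < card I" "i \<noteq> j" for i j
      using disj hI inj that by blast
  qed
  then show ?thesis
    by (simp add: sum.reindex_bij_betw[OF h, of "\<lambda>i. \<bar>f (v i) - f (u i)\<bar>"])
qed

text \<open>Monotone sequences take the place of partitions: cutting such a sequence off at a point \<open>m\<close>,
  from above with \<open>min\<close> or from below with \<open>max\<close>, gives a sequence of the same kind, so that no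
  point has to be inserted into a partition when an interval is split.\<close>
definition variation_sums :: "(real \<Rightarrow> real) \<Rightarrow> real \<Rightarrow> real \<Rightarrow> real set" where
  "variation_sums f s t =
    {\<Sum>i<n. \<bar>f (u (Suc i)) - f (u i)\<bar> | (n::nat) u. mono u \<and> (\<forall>i. u i \<in> {s..t})}"

definition variation :: "(real \<Rightarrow> real) \<Rightarrow> real \<Rightarrow> real \<Rightarrow> real" where
  "variation f s t = Sup (variation_sums f s t)"

lemma variation_sumsI:
  assumes "mono u" "\<And>i. u i \<in> {s..t}"
  shows "(\<Sum>i<n. \<bar>f (u (Suc i)) - f (u i)\<bar>) \<in> variation_sums f s t"
  using assms unfolding variation_sums_def by blast

lemma variation_sums_nonempty: "s \<le> t \<Longrightarrow> 0 \<in> variation_sums f s t"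
  using variation_sumsI[of "\<lambda>_. s" s t f 0] by (auto simp: mono_def)

text \<open>Every \<open>x\<close> satisfies \<open>f x = f (min x m) + f (max x m) - f m\<close>, so each increment of \<open>f\<close> is the sum
  of an increment on the left of \<open>m\<close> and one on the right.\<close>
lemma variation_sums_split:
  assumes w: "w \<in> variation_sums f s t" and m: "s \<le> m" "m \<le> t"
  shows "\<exists>y\<in>variation_sums f s m. \<exists>z\<in>variation_sums f m t. w \<le> y + z"
proof -
  obtain n u where u: "mono u" "\<And>i. u i \<in> {s..t}" and w: "w = (\<Sum>i<n::nat. \<bar>f (u (Suc i)) - f (u i)\<bar>)"
    using w unfolding variation_sums_def by blast
  let ?l = "\<lambda>i. min (u i) m" and ?r = "\<lambda>i. max (u i) m"
  have l: "mono ?l" "\<And>i. ?l i \<in> {s..m}" and r: "mono ?r" "\<And>i. ?r i \<in> {m..t}"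
    using u m by (auto simp: mono_def min_def max_def) (meson order_trans)+
  have "f x = f (min x m) + f (max x m) - f m" for x
    by (auto simp: min_def max_def)
  then have "\<bar>f y - f x\<bar> \<le> \<bar>f (min y m) - f (min x m)\<bar> + \<bar>f (max y m) - f (max x m)\<bar>" for x y
    by (smt (verit))
  then have "w \<le> (\<Sum>i<n. \<bar>f (?l (Suc i)) - f (?l i)\<bar>) + (\<Sum>i<n. \<bar>f (?r (Suc i)) - f (?r i)\<bar>)"
    unfolding w sum.distrib[symmetric] by (intro sum_mono)
  then show ?thesis
    using variation_sumsI[OF l] variation_sumsI[OF r] by blast
qed

lemma variation_sums_extend:
  assumes w: "w \<in> variation_sums f s x" and "s \<le> x" "x \<le> y"
  shows "\<exists>w'\<in>variation_sums f s y. w + \<bar>f y - f x\<bar> \<le> w'"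
proof -
  obtain n u where u: "mono u" "\<And>i. u i \<in> {s..x}" and w: "w = (\<Sum>i<n::nat. \<bar>f (u (Suc i)) - f (u i)\<bar>)"
    using w unfolding variation_sums_def by blast
  let ?u = "\<lambda>i. if i \<le> n then u i else if i = Suc n then x else y"
  have ux: "s \<le> u i" "u i \<le> x" for i using u(2) by auto
  have "mono ?u"
    unfolding mono_iff_le_Suc using monoD[OF u(1)] ux \<open>x \<le> y\<close> by (simp add: le_Suc_eq)
  moreover have "?u i \<in> {s..y}" for i
    using ux[of i] ux[of 0] assms by auto
  ultimately have "(\<Sum>i<Suc (Suc n). \<bar>f (?u (Suc i)) - f (?u i)\<bar>) \<in> variation_sums f s y"
    by (rule variation_sumsI[of ?u])
  moreover have "(\<Sum>i<n. \<bar>f (?u (Suc i)) - f (?u i)\<bar>) = w"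
    unfolding w by (intro sum.cong) auto
  then have "w + \<bar>f y - f x\<bar> \<le> (\<Sum>i<Suc (Suc n). \<bar>f (?u (Suc i)) - f (?u i)\<bar>)"
    by simp
  ultimately show ?thesis by blast
qed

lemma sum_Sup_le:
  fixes S :: "'i \<Rightarrow> real set"
  assumes "finite I" and ne: "\<And>i. i \<in> I \<Longrightarrow> S i \<noteq> {}" and bdd: "\<And>i. i \<in> I \<Longrightarrow> bdd_above (S i)"
    and le: "\<And>w. (\<And>i. i \<in> I \<Longrightarrow> w i \<in> S i) \<Longrightarrow> (\<Sum>i\<in>I. w i) \<le> e"
  shows "(\<Sum>i\<in>I. Sup (S i)) \<le> e"
proof (rule field_le_epsilon)
  fix \<eta> :: real assume "0 < \<eta>"
  define \<theta> where "\<theta> = \<eta> / (real (card I) + 1)"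
  have "0 < \<theta>" using \<open>0 < \<eta>\<close> by (simp add: \<theta>_def)
  have "\<exists>w\<in>S i. Sup (S i) - \<theta> < w" if "i \<in> I" for i
    using less_cSup_iff[OF ne[OF that] bdd[OF that], of "Sup (S i) - \<theta>"] \<open>0 < \<theta>\<close> by auto
  then obtain w where w: "\<And>i. i \<in> I \<Longrightarrow> w i \<in> S i \<and> Sup (S i) - \<theta> < w i"
    by metis
  have "(\<Sum>i\<in>I. Sup (S i)) \<le> (\<Sum>i\<in>I. w i + \<theta>)"
    using w by (intro sum_mono) (smt (verit))
  also have "\<dots> = (\<Sum>i\<in>I. w i) + real (card I) * \<theta>"
    by (simp add: sum.distrib)
  also have "real (card I) * \<theta> \<le> \<eta>"
    using \<open>0 < \<eta>\<close> by (simp add: \<theta>_def divide_simps)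
  also have "(\<Sum>i\<in>I. w i) \<le> e" by (rule le) (use w in auto)
  finally show "(\<Sum>i\<in>I. Sup (S i)) \<le> e + \<eta>" by simp
qed

text \<open>If \<open>d\<close> belongs to \<open>\<epsilon> = 1\<close> in the definition of absolute continuity, an interval shorter than \<open>d\<close>
  has variation at most \<open>1\<close>, and finitely many steps of length \<open>d/2\<close> exhaust \<open>[a, b]\<close>.\<close>
lemma abs_continuous_on_imp_bdd_variation:
  assumes ac: "abs_continuous_on a b f"
  shows "bdd_above (variation_sums f a b)"
proof (cases "a \<le> b")
  case False
  then show ?thesis by (auto simp: variation_sums_def)
next
  case True
  obtain d where "0 < d" and d: "small_variation a b f d 1"
    by (rule abs_continuous_onE[OF ac zero_less_one])
  have short: "w \<le> 1" if w: "w \<in> variation_sums f s t" and st: "a \<le> s" "t \<le> b" "t - s < d" for w s t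
  proof -
    obtain n u where u: "mono u" "\<And>i. u i \<in> {s..t}" and w: "w = (\<Sum>i<n::nat. \<bar>f (u (Suc i)) - f (u i)\<bar>)"
      using w unfolding variation_sums_def by blast
    have us: "s \<le> u i" "u i \<le> t" for i using u(2) by auto
    have "w < 1"
      unfolding w
    proof (rule d[unfolded small_variation_def, rule_format])
      show "a \<le> u i \<and> u i \<le> u (Suc i) \<and> u (Suc i) \<le> b" for i
        using us[of i] us[of "Suc i"] st monoD[OF u(1), of i "Suc i"] by simp
      have *: "u (Suc i) \<le> u j" if "i < j" for i j
        using u(1) that by (simp add: monoD)
      show "{u i<..<u (Suc i)} \<inter> {u j<..<u (Suc j)} = {}" if "i \<noteq> j" for i j
        using *[of i j] *[of j i] that by (cases i j rule: linorder_cases) auto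
      show "(\<Sum>i<n. u (Suc i) - u i) < d"
        using us(2)[of n] us(1)[of 0] st by (simp add: sum_lessThan_telescope)
    qed
    then show ?thesis by simp
  qed
  have "bdd_above (variation_sums f a (min b (a + real n * (d/2))))" for n
  proof (induction n)
    case 0
    have "bdd_above (variation_sums f a a)"
      by (rule bdd_aboveI[where M=1], rule short[of _ a a]) (use True \<open>0 < d\<close> in auto)
    then show ?case using True by simp
  next
    case (Suc n)
    let ?m = "min b (a + real n * (d/2))" and ?t = "min b (a + real (Suc n) * (d/2))"
    obtain M where M: "\<And>w. w \<in> variation_sums f a ?m \<Longrightarrow> w \<le> M"
      using Suc by (auto simp: bdd_above_def)
    have m: "a \<le> ?m" "?m \<le> ?t" "?t - ?m < d" "?t \<le> b"
      using True \<open>0 < d\<close> by (auto simp: field_simps min_def)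
    have "w \<le> M + 1" if "w \<in> variation_sums f a ?t" for w
      using variation_sums_split[OF that m(1,2)] M short[OF _ m(1,4,3)] by force
    then show ?case by (rule bdd_aboveI)
  qed
  moreover obtain n :: nat where "b - a \<le> real n * (d/2)"
    using \<open>0 < d\<close> by (meson half_gt_zero_iff less_imp_le reals_Archimedean3)
  then have "min b (a + real n * (d/2)) = b" by auto
  ultimately show ?thesis by metis
qed

lemma variation_sums_mono: "s \<le> s' \<Longrightarrow> t' \<le> t \<Longrightarrow> variation_sums f s' t' \<subseteq> variation_sums f s t"
  unfolding variation_sums_def by (intro Collect_mono impI) (metis atLeastAtMost_iff order_trans)

text \<open>The families are indexed by sets of reals because the members of a division will be their own
  indices.\<close>
definition small_increments :: "(real \<Rightarrow> real) \<Rightarrow> real \<Rightarrow> real \<Rightarrow> bool" where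
  "small_increments H d e \<longleftrightarrow> (\<forall>(p :: real set set) u v. finite p \<longrightarrow> (\<forall>K\<in>p. u K \<le> v K) \<longrightarrow>
      (\<forall>K\<in>p. \<forall>L\<in>p. K \<noteq> L \<longrightarrow> {u K<..<v K} \<inter> {u L<..<v L} = {}) \<longrightarrow>
      (\<Sum>K\<in>p. v K - u K) < d \<longrightarrow> (\<Sum>K\<in>p. H (v K) - H (u K)) \<le> e)"

definition clamp_to :: "real \<Rightarrow> real \<Rightarrow> real \<Rightarrow> real" where
  "clamp_to a b x = max a (min b x)"

context
  fixes a b :: real and f :: "real \<Rightarrow> real"
  assumes ab: "a \<le> b" and ac: "abs_continuous_on a b f"
begin

lemma bdd_variation_sums: "a \<le> s \<Longrightarrow> t \<le> b \<Longrightarrow> bdd_above (variation_sums f s t)"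
  using abs_continuous_on_imp_bdd_variation[OF ac] variation_sums_mono bdd_above_mono by metis

lemma variation_superadditive:
  assumes "a \<le> x" "x \<le> y" "y \<le> b"
  shows "variation f a x + \<bar>f y - f x\<bar> \<le> variation f a y"
proof -
  have "variation f a x \<le> variation f a y - \<bar>f y - f x\<bar>"
    unfolding variation_def[of f a x]
  proof (rule cSup_least)
    fix w assume "w \<in> variation_sums f a x"
    then obtain w' where "w' \<in> variation_sums f a y" "w + \<bar>f y - f x\<bar> \<le> w'"
      using variation_sums_extend assms by blast
    moreover have "w' \<le> variation f a y"
      unfolding variation_def using calculation assms by (intro cSup_upper bdd_variation_sums) auto
    ultimately show "w \<le> variation f a y - \<bar>f y - f x\<bar>" by linarith
  qed (use variation_sums_nonempty assms in blast)
  then show ?thesis by simp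
qed

lemma variation_subadditive:
  assumes "a \<le> x" "x \<le> y" "y \<le> b"
  shows "variation f a y \<le> variation f a x + variation f x y"
  unfolding variation_def[of f a y]
proof (rule cSup_least)
  fix w assume "w \<in> variation_sums f a y"
  then obtain y' z where "y' \<in> variation_sums f a x" "z \<in> variation_sums f x y" "w \<le> y' + z"
    using variation_sums_split assms by blast
  moreover have "y' \<le> variation f a x" "z \<le> variation f x y"
    unfolding variation_def using calculation assms by (auto intro!: cSup_upper bdd_variation_sums)
  ultimately show "w \<le> variation f a x + variation f x y" by linarith
qed (use variation_sums_nonempty[of a y f] assms in auto)

text \<open>The variations of \<open>f\<close> over the intervals of a short family are suprema, and approximating all of
  them at once amounts to refining the family. The refined family is no longer than the given one,
  so the \<open>d\<close> that works for \<open>f\<close> works for its variation.\<close>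
lemma abs_continuous_variation:
  assumes "0 < e"
  shows "\<exists>d>0. small_increments (\<lambda>x. variation f a (clamp_to a b x)) d e"
proof -
  obtain d where "0 < d" and d: "small_variation a b f d e"
    by (rule abs_continuous_onE[OF ac assms])
  have main: "(\<Sum>i\<in>I. variation f a (v i) - variation f a (u i)) \<le> e"
    if "finite I" and bounds: "\<And>i. i \<in> I \<Longrightarrow> a \<le> u i \<and> u i \<le> v i \<and> v i \<le> b"
      and disj: "\<And>i j. i \<in> I \<Longrightarrow> j \<in> I \<Longrightarrow> i \<noteq> j \<Longrightarrow> {u i<..<v i} \<inter> {u j<..<v j} = {}"
      and small: "(\<Sum>i\<in>I. v i - u i) < d" for I :: "real set set" and u v
  proof -
    have "(\<Sum>i\<in>I. variation f a (v i) - variation f a (u i)) \<le> (\<Sum>i\<in>I. variation f (u i) (v i))"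
      using variation_subadditive[of "u i" "v i" for i] bounds by (intro sum_mono) (simp add: algebra_simps)
    also have "\<dots> \<le> e"
      unfolding variation_def
    proof (rule sum_Sup_le[OF \<open>finite I\<close>])
      fix w assume w: "\<And>i. i \<in> I \<Longrightarrow> w i \<in> variation_sums f (u i) (v i)"
      define P where "P i n h \<longleftrightarrow> mono h \<and> (\<forall>j. h j \<in> {u i..v i}) \<and>
          w i = (\<Sum>j<n. \<bar>f (h (Suc j)) - f (h j)\<bar>)" for i and n :: nat and h
      have "\<exists>n h. P i n h" if "i \<in> I" for i
        using w[OF that] unfolding variation_sums_def P_def by blast
      then obtain n h where P: "\<And>i. i \<in> I \<Longrightarrow> P i (n i) (h i)"
        by metis
      then have h: "mono (h i)" "h i j \<in> {u i..v i}"
        and wi: "w i = (\<Sum>j<n i. \<bar>f (h i (Suc j)) - f (h i j)\<bar>)" if "i \<in> I" for i j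
        using P[OF that] unfolding P_def by auto
      have hb: "u i \<le> h i j" "h i j \<le> v i" if "i \<in> I" for i j using h(2)[OF that] by auto
      have hm: "h i j \<le> h i k" if "i \<in> I" "j \<le> k" for i j k using h(1)[OF that(1)] that(2) by (simp add: monoD)
      let ?S = "Sigma I (\<lambda>i. {..<n i})"
      have "(\<Sum>i\<in>I. w i) = (\<Sum>i\<in>I. \<Sum>j<n i. \<bar>f (h i (Suc j)) - f (h i j)\<bar>)"
        using wi by (intro sum.cong) auto
      also have "\<dots> = (\<Sum>p\<in>?S. \<bar>f (h (fst p) (Suc (snd p))) - f (h (fst p) (snd p))\<bar>)"
        using \<open>finite I\<close> by (subst sum.Sigma) (auto simp: case_prod_beta)
      also have "\<dots> < e"
      proof (rule small_variation_finite_family[OF d])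
        show "finite ?S" using \<open>finite I\<close> by auto
        show "a \<le> h (fst p) (snd p) \<and> h (fst p) (snd p) \<le> h (fst p) (Suc (snd p)) \<and>
           h (fst p) (Suc (snd p)) \<le> b" if "p \<in> ?S" for p
          using that hb[of "fst p" "snd p"] hb[of "fst p" "Suc (snd p)"] hm[of "fst p" "snd p" "Suc (snd p)"] bounds[of "fst p"]
          by (auto intro: order_trans)
        show "{h (fst p) (snd p)<..<h (fst p) (Suc (snd p))} \<inter>
             {h (fst q) (snd q)<..<h (fst q) (Suc (snd q))} = {}"
          if "p \<in> ?S" "q \<in> ?S" "p \<noteq> q" for p q
        proof (cases "fst p = fst q")
          case True
          then have "snd p \<noteq> snd q" using that(3) by (simp add: prod_eq_iff)
          then have "h (fst p) (Suc (snd p)) \<le> h (fst p) (snd q) \<or> h (fst p) (Suc (snd q)) \<le> h (fst p) (snd p)"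
            using that(1) hm[of "fst p" "Suc (snd p)" "snd q"] hm[of "fst p" "Suc (snd q)" "snd p"]
            by (cases "snd p" "snd q" rule: linorder_cases) (auto simp: Suc_le_eq)
          then show ?thesis using True by auto
        next
          case False
          have inside: "{h (fst p) (snd p)<..<h (fst p) (Suc (snd p))} \<subseteq> {u (fst p)<..<v (fst p)}"
            if "p \<in> ?S" for p
          proof -
            have "fst p \<in> I" using that by auto
            from hb(1)[OF this, of "snd p"] hb(2)[OF this, of "Suc (snd p)"] show ?thesis by auto
          qed
          have "{u (fst p)<..<v (fst p)} \<inter> {u (fst q)<..<v (fst q)} = {}"
            by (rule disj[OF _ _ False]) (use that in auto)
          then show ?thesis
            using inside[OF that(1)] inside[OF that(2)] by blast
        qed
        have "(\<Sum>p\<in>?S. h (fst p) (Suc (snd p)) - h (fst p) (snd p)) =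
            (\<Sum>i\<in>I. \<Sum>j<n i. h i (Suc j) - h i j)"
          using \<open>finite I\<close> by (subst sum.Sigma) (auto simp: case_prod_beta)
        also have "\<dots> \<le> (\<Sum>i\<in>I. v i - u i)"
          using hb by (intro sum_mono) (simp add: sum_lessThan_telescope diff_mono)
        finally show "(\<Sum>p\<in>?S. h (fst p) (Suc (snd p)) - h (fst p) (snd p)) < d"
          using small by simp
      qed
      finally show "(\<Sum>i\<in>I. w i) \<le> e" by simp
    next
      show "variation_sums f (u i) (v i) \<noteq> {}" "bdd_above (variation_sums f (u i) (v i))"
        if "i \<in> I" for i
        using bounds[OF that] variation_sums_nonempty[of "u i" "v i" f] bdd_variation_sums[of "u i" "v i"]
        by auto
    qed
    finally show ?thesis .
  qed
  let ?c = "clamp_to a b"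
  have c: "a \<le> ?c x" "?c x \<le> b" for x using ab by (auto simp: clamp_to_def)
  have sub: "{?c s<..<?c t} \<subseteq> {s<..<t}" for s t by (auto simp: clamp_to_def)
  have cmono: "?c x \<le> ?c y" and clen: "?c y - ?c x \<le> y - x" if "x \<le> y" for x y
    using that by (auto simp: clamp_to_def)
  have "small_increments (\<lambda>x. variation f a (?c x)) d e"
    unfolding small_increments_def
  proof (intro allI impI)
    fix I :: "real set set" and u v
    assume I: "finite I" "\<forall>K\<in>I. u K \<le> v K"
      "\<forall>K\<in>I. \<forall>L\<in>I. K \<noteq> L \<longrightarrow> {u K<..<v K} \<inter> {u L<..<v L} = {}" "(\<Sum>K\<in>I. v K - u K) < d"
    show "(\<Sum>K\<in>I. variation f a (?c (v K)) - variation f a (?c (u K))) \<le> e"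
    proof (rule main[OF I(1)])
      show "{?c (u K)<..<?c (v K)} \<inter> {?c (u L)<..<?c (v L)} = {}"
        if "K \<in> I" "L \<in> I" "K \<noteq> L" for K L
        using I(3) that sub by blast
      have "(\<Sum>K\<in>I. ?c (v K) - ?c (u K)) \<le> (\<Sum>K\<in>I. v K - u K)"
        using I(2) clen by (intro sum_mono) auto
      then show "(\<Sum>K\<in>I. ?c (v K) - ?c (u K)) < d" using I(4) by simp
    qed (use I c cmono in auto)
  qed
  with \<open>0 < d\<close> show ?thesis by blast
qed

end

lemma mono_small_increments_imp_continuous:
  assumes mono: "mono H" and small: "\<And>e. 0 < e \<Longrightarrow> \<exists>d>0. small_increments H d e"
  shows "continuous_on UNIV H"
  unfolding continuous_on_iff
proof (intro ballI allI impI)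
  fix x e :: real assume "0 < e"
  then obtain d where "0 < d" and d: "small_increments H d (e/2)"
    using small[of "e/2"] by auto
  have *: "H t - H s \<le> e/2" if "s \<le> t" "t - s < d" for s t
    using d[unfolded small_increments_def, rule_format, of "{{}}" "\<lambda>_. s" "\<lambda>_. t"] that by auto
  have "dist (H y) (H x) < e" if "dist y x < d" for y
    using *[of x y] *[of y x] that \<open>0 < e\<close> monoD[OF mono, of x y] monoD[OF mono, of y x]
    by (cases "x \<le> y") (auto simp: dist_real_def)
  with \<open>0 < d\<close> show "\<exists>d>0. \<forall>x'\<in>UNIV. dist x' x < d \<longrightarrow> dist (H x') (H x) < e" by blast
qed

text \<open>An open set is the union of an increasing sequence of finite unions of compact intervals. Each of
  these has a division into non-overlapping intervals whose total length is less than \<open>d\<close>, and its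
  Stieltjes measure is at most the sum of the increments of \<open>H\<close>.\<close>
lemma interval_measure_small_on_open:
  fixes H :: "real \<Rightarrow> real"
  assumes mono: "mono H" and cont: "continuous_on UNIV H"
    and small: "small_increments H d e"
    and U: "open U" "emeasure lborel U < ennreal d"
  shows "emeasure (interval_measure H) U \<le> ennreal e"
proof -
  let ?\<mu> = "interval_measure H"
  have Icc: "emeasure ?\<mu> {s..t} = ennreal (H t - H s)" if "s \<le> t" for s t
    using that mono cont by (intro emeasure_interval_measure_Icc) (auto dest: monoD)
  obtain \<D> where \<D>: "countable \<D>" "\<D> \<subseteq> Pow U" "\<And>X. X \<in> \<D> \<Longrightarrow> \<exists>a b. X = cbox a b" "\<Union>\<D> = U"
    using open_countable_Union_open_cbox[OF U(1)] by metis
  show ?thesis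
  proof (cases "\<D> = {}")
    case True
    then show ?thesis using \<D>(4) by auto
  next
    case False
    define B where "B n = (\<Union>i\<le>n. from_nat_into \<D> i)" for n :: nat
    have in\<D>: "from_nat_into \<D> i \<in> \<D>" for i
      using False by (simp add: from_nat_into)
    have box: "\<exists>a b. from_nat_into \<D> i = cbox a b" for i
      using \<D>(3)[OF in\<D>] .
    have meas: "B n \<in> sets borel" for n
      unfolding B_def using box by (intro sets.finite_UN) (auto, metis cbox_interval closed_cbox borel_closed)
    have BU: "B n \<subseteq> U" for n
      unfolding B_def using \<D>(2) in\<D> by blast
    have le: "emeasure ?\<mu> (B n) \<le> ennreal e" for n
    proof -
      have "finite (from_nat_into \<D> ` {..n})" by simp
      then obtain p where p: "p division_of B n"
        unfolding B_def using box elementary_unions_intervals[of "from_nat_into \<D> ` {..n}"] by (metis imageE)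
      let ?u = "\<lambda>K::real set. Inf K" and ?v = "\<lambda>K::real set. Sup K"
      have K: "K = {?u K..?v K}" and Kle: "?u K \<le> ?v K" if K: "K \<in> p" for K
      proof -
        obtain s t where "K = cbox s t" "K \<noteq> {}"
          using division_ofD(3,4)[OF p K] by blast
        then show "K = {?u K..?v K}" "?u K \<le> ?v K" by auto
      qed
      have Kb: "K \<in> sets borel" if K: "K \<in> p" for K
        using division_ofD(4)[OF p K] by auto
      have fin: "finite p" using p by auto
      have "(\<Sum>K\<in>p. ?v K - ?u K) = (\<Sum>K\<in>p. measure lborel K)"
      proof (rule sum.cong[OF refl])
        fix L assume "L \<in> p"
        note L = K[OF this] Kle[OF this]
        show "?v L - ?u L = measure lborel L"
          using measure_lborel_Icc[OF L(2)] L(1) by metis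
      qed
      also have "\<dots> = measure lborel (B n)"
      proof -
        have "measure lborel K = measure lebesgue K" if "K \<in> p" for K
          using Kb[OF that] by (simp add: measure_completion)
        then show ?thesis
          using content_division[OF p] meas by (simp add: measure_completion)
      qed
      also have "\<dots> < d"
      proof -
        have "emeasure lborel (B n) < ennreal d"
          using emeasure_mono[OF BU, of lborel n] U by (auto intro: le_less_trans)
        moreover have "emeasure lborel (B n) = ennreal (measure lborel (B n))"
          using calculation by (intro emeasure_eq_ennreal_measure) auto
        ultimately show ?thesis
          using meas by (auto simp: ennreal_less_iff)
      qed
      finally have len: "(\<Sum>K\<in>p. ?v K - ?u K) < d" .
      have disj: "{?u K<..<?v K} \<inter> {?u L<..<?v L} = {}" if "K \<in> p" "L \<in> p" "K \<noteq> L" for K L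
      proof -
        have "interior K \<inter> interior L = {}" using division_ofD(5)[OF p that] .
        then show ?thesis using K[OF that(1)] K[OF that(2)] by (metis interior_atLeastAtMost_real)
      qed
      have "emeasure ?\<mu> (B n) = emeasure ?\<mu> (\<Union>p)" using p by (simp add: division_of_def)
      also have "\<dots> \<le> (\<Sum>K\<in>p. emeasure ?\<mu> K)"
        using emeasure_subadditive_finite[OF fin, of "\<lambda>K. K" ?\<mu>] Kb by (auto simp: image_subset_iff)
      also have "\<dots> = (\<Sum>K\<in>p. ennreal (H (?v K) - H (?u K)))"
      proof (rule sum.cong[OF refl])
        fix L assume "L \<in> p"
        note L = K[OF this] Kle[OF this]
        show "emeasure ?\<mu> L = ennreal (H (?v L) - H (?u L))"
          using Icc[OF L(2)] L(1) by metis
      qed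
      also have "\<dots> = ennreal (\<Sum>K\<in>p. H (?v K) - H (?u K))"
        using Kle mono by (intro sum_ennreal) (simp add: monoD)
      also have "\<dots> \<le> ennreal e"
        by (intro ennreal_leI small[unfolded small_increments_def, rule_format] fin len)
          (use Kle disj in blast)+
      finally show ?thesis .
    qed
    have "U = (\<Union>n. B n)"
    proof
      show "U \<subseteq> (\<Union>n. B n)"
      proof
        fix x assume "x \<in> U"
        then obtain D where "D \<in> \<D>" "x \<in> D" using \<D>(4) by blast
        moreover obtain n where "from_nat_into \<D> n = D"
          using from_nat_into_surj[OF \<D>(1) \<open>D \<in> \<D>\<close>] by blast
        ultimately show "x \<in> (\<Union>n. B n)" unfolding B_def by blast
      qed
    qed (use BU in blast)
    then have "emeasure ?\<mu> U = (SUP n. emeasure ?\<mu> (B n))"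
      using meas by (subst SUP_emeasure_incseq) (auto simp: incseq_def B_def intro: order_trans)
    then show ?thesis using le by (simp add: SUP_le_iff)
  qed
qed

text \<open>Null sets lie in open sets of small Lebesgue measure, hence of small Stieltjes measure. So the
  Stieltjes measure of \<open>H\<close> is absolutely continuous, and \<open>h\<close> is its Radon-Nikodym derivative.\<close>
lemma mono_abs_continuous_density:
  fixes H :: "real \<Rightarrow> real"
  assumes mono: "mono H" and small: "\<And>e. 0 < e \<Longrightarrow> \<exists>d>0. small_increments H d e"
  obtains h :: "real \<Rightarrow> real" where "\<And>x. 0 \<le> h x" "\<And>s t. s \<le> t \<Longrightarrow> (h has_integral (H t - H s)) {s..t}"
proof -
  have cont: "continuous_on UNIV H"
    by (rule mono_small_increments_imp_continuous[OF mono small])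
  let ?\<mu> = "interval_measure H"
  have Icc: "emeasure ?\<mu> {s..t} = ennreal (H t - H s)" if "s \<le> t" for s t
    using that mono cont by (intro emeasure_interval_measure_Icc) (auto dest: monoD)
  have "absolutely_continuous lborel ?\<mu>"
    unfolding absolutely_continuous_def
  proof
    fix N :: "real set" assume N: "N \<in> null_sets lborel"
    have "emeasure ?\<mu> N \<le> ennreal e" if e: "0 < e" for e
    proof -
      obtain d where "0 < d" and d: "small_increments H d e"
        using small[OF e] by blast
      have "N \<in> sets lebesgue" "emeasure lebesgue N = 0"
        using N by (auto simp: null_sets_def)
      then obtain U where U: "open U" "N \<subseteq> U" "emeasure lebesgue (U - N) < ennreal d"
        using sets_lebesgue_outer_open[OF _ \<open>0 < d\<close>, of N] by metis
      have "emeasure lborel U \<le> emeasure lborel N + emeasure lborel (U - N)"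
        using emeasure_subadditive[of N lborel "U - N"] N U by (auto simp: null_sets_def Un_absorb1)
      also have "\<dots> < ennreal d"
        using U N by (auto simp: null_sets_def)
      finally have "emeasure ?\<mu> U \<le> ennreal e"
        by (rule interval_measure_small_on_open[OF mono cont d U(1)])
      moreover have "emeasure ?\<mu> N \<le> emeasure ?\<mu> U"
        using U by (intro emeasure_mono) auto
      ultimately show ?thesis by (rule order_trans[rotated])
    qed
    note le_all = this
    have "emeasure ?\<mu> N \<le> 0"
    proof (rule ennreal_le_epsilon)
      fix e :: real assume "0 < e"
      from le_all[OF this] show "emeasure ?\<mu> N \<le> 0 + ennreal e" by simp
    qed
    then show "N \<in> null_sets ?\<mu>"
      using N by (simp add: null_sets_def)
  qed
  then obtain g where g: "g \<in> borel_measurable lborel" and dens: "density lborel g = ?\<mu>"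
    using sigma_finite_measure.Radon_Nikodym[OF sigma_finite_lborel, of ?\<mu>] by auto
  have int: "(\<integral>\<^sup>+x\<in>{s..t}. g x \<partial>lborel) = ennreal (H t - H s)" if "s \<le> t" for s t
    using Icc[OF that] g unfolding dens[symmetric] by (subst (asm) emeasure_density) auto
  have "((\<lambda>x. enn2real (g x)) has_integral (H t - H s)) {s..t}" if "s \<le> t" for s t
  proof -
    have "AE x in lborel. g x * indicator {s..t} x \<noteq> \<infinity>"
      using g int[OF that] by (intro nn_integral_noteq_infinite) auto
    then have "(\<integral>\<^sup>+x. ennreal (enn2real (g x) * indicator {s..t} x) \<partial>lborel) = ennreal (H t - H s)"
      unfolding int[OF that, symmetric]
      by (intro nn_integral_cong_AE, eventually_elim) (auto simp: indicator_def ennreal_enn2real less_top)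
    then have "((\<lambda>x. enn2real (g x) * indicator {s..t} x) has_integral (H t - H s)) UNIV"
      using g monoD[OF mono that] by (intro nn_integral_has_integral) auto
    then show ?thesis
      by (subst has_integral_restrict_UNIV[symmetric])
        (simp add: indicator_def of_bool_def if_distrib cong: if_cong)
  qed
  then show thesis by (intro that[of "\<lambda>x. enn2real (g x)"]) auto
qed


text \<open>Jordan decomposition: with \<open>V\<close> the variation of \<open>f\<close>, both \<open>V\<close> and \<open>V + f\<close> are increasing and
  absolutely continuous, and \<open>f\<close> is their difference. Clamping the argument to \<open>[a, b]\<close> extends them to
  the line without new increments.\<close>
lemma abs_continuous_has_density:
  assumes ab: "a \<le> b" and ac: "abs_continuous_on a b f"
  obtains g :: "real \<Rightarrow> real" where "\<And>s t. g absolutely_integrable_on {s..t}"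
    and "\<And>s t. a \<le> s \<Longrightarrow> s \<le> t \<Longrightarrow> t \<le> b \<Longrightarrow> (g has_integral (f t - f s)) {s..t}"
proof -
  let ?c = "clamp_to a b"
  have c: "a \<le> ?c x" "?c x \<le> b" for x using ab by (auto simp: clamp_to_def)
  have cmono: "?c x \<le> ?c y" if "x \<le> y" for x y using that by (auto simp: clamp_to_def)
  have cid: "?c x = x" if "a \<le> x" "x \<le> b" for x using that by (auto simp: clamp_to_def)
  define V where "V x = variation f a (?c x)" for x
  define W where "W x = V x + f (?c x)" for x
  have V: "V x + \<bar>f (?c y) - f (?c x)\<bar> \<le> V y" if "x \<le> y" for x y
    unfolding V_def using variation_superadditive[OF ab ac c(1) cmono[OF that] c(2)] .
  have monoV: "mono V" and monoW: "mono W"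
    using V unfolding mono_def W_def by (smt (verit))+
  have Vsmall: "\<exists>d>0. small_increments V d e" if e: "0 < e" for e
    unfolding V_def by (rule abs_continuous_variation[OF ab ac e])
  have Wsmall: "\<exists>d>0. small_increments W d e" if e: "0 < e" for e
  proof -
    obtain d where "0 < d" and d: "small_increments V d (e/2)"
      using Vsmall[of "e/2"] e by auto
    have "small_increments W d e"
      unfolding small_increments_def
    proof (intro allI impI)
      fix p :: "real set set" and u v
      assume p: "finite p" "\<forall>K\<in>p. u K \<le> v K"
        "\<forall>K\<in>p. \<forall>L\<in>p. K \<noteq> L \<longrightarrow> {u K<..<v K} \<inter> {u L<..<v L} = {}" "(\<Sum>K\<in>p. v K - u K) < d"
      have "(\<Sum>K\<in>p. W (v K) - W (u K)) \<le> (\<Sum>K\<in>p. 2 * (V (v K) - V (u K)))"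
      proof (rule sum_mono)
        fix K assume "K \<in> p"
        then have "V (u K) + \<bar>f (?c (v K)) - f (?c (u K))\<bar> \<le> V (v K)" using V p(2) by blast
        then show "W (v K) - W (u K) \<le> 2 * (V (v K) - V (u K))"
          using abs_ge_self[of "f (?c (v K)) - f (?c (u K))"] unfolding W_def by (simp add: algebra_simps)
      qed
      also have "\<dots> = 2 * (\<Sum>K\<in>p. V (v K) - V (u K))" by (simp add: sum_distrib_left)
      also have "(\<Sum>K\<in>p. V (v K) - V (u K)) \<le> e/2"
        using d p unfolding small_increments_def by blast
      finally show "(\<Sum>K\<in>p. W (v K) - W (u K)) \<le> e" by simp
    qed
    with \<open>0 < d\<close> show ?thesis by blast
  qed
  obtain h1 where h1: "\<And>x. 0 \<le> h1 x" "\<And>s t. s \<le> t \<Longrightarrow> (h1 has_integral (V t - V s)) {s..t}"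
    using mono_abs_continuous_density[OF monoV Vsmall] by metis
  obtain h2 where h2: "\<And>x. 0 \<le> h2 x" "\<And>s t. s \<le> t \<Longrightarrow> (h2 has_integral (W t - W s)) {s..t}"
    using mono_abs_continuous_density[OF monoW Wsmall] by metis
  show thesis
  proof (rule that[of "\<lambda>x. h2 x - h1 x"])
    show "(\<lambda>x. h2 x - h1 x) absolutely_integrable_on {s..t}" for s t
    proof (cases "s \<le> t")
      case True
      have "h1 integrable_on {s..t}" "h2 integrable_on {s..t}"
        using h1(2)[OF True] h2(2)[OF True] by (auto simp: integrable_on_def)
      then show ?thesis
        using h1(1) h2(1) by (intro set_integral_diff(1) nonnegative_absolutely_integrable_1) auto
    qed auto
    show "((\<lambda>x. h2 x - h1 x) has_integral (f t - f s)) {s..t}" if "a \<le> s" "s \<le> t" "t \<le> b" for s t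
    proof -
      have "f t - f s = (W t - W s) - (V t - V s)" using that by (simp add: W_def cid)
      then show ?thesis using has_integral_diff[OF h2(2)[OF that(2)] h1(2)[OF that(2)]] by simp
    qed
  qed
qed

lemma right_derivative_of_integral_AE:
  fixes g :: "real \<Rightarrow> real"
  assumes "\<And>s t. g integrable_on {s..t}"
  obtains N where "negligible N"
    and "\<And>x e. x \<notin> N \<Longrightarrow> 0 < e \<Longrightarrow> \<exists>d>0. \<forall>h. 0 < h \<and> h < d \<longrightarrow> \<bar>integral {x..x+h} g / h - g x\<bar> < e"
proof -
  obtain N where "negligible N" and N: "\<And>x e. \<lbrakk>x \<notin> N; 0 < e\<rbrakk> \<Longrightarrow> \<exists>d>0. \<forall>h. 0 < h \<and> h < d \<longrightarrow>
      norm (integral (cbox x (x + h *\<^sub>R One)) g /\<^sub>R h ^ DIM(real) - g x) < e"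
    using integrable_ccontinuous_explicit[of g] assms by (auto simp: cbox_interval)
  show thesis
    by (rule that[OF \<open>negligible N\<close>]) (use N in \<open>simp add: divide_inverse mult.commute cbox_interval\<close>)
qed

text \<open>Lebesgue's differentiation theorem for intervals to the right of a point, applied to \<open>g\<close> and to
  its reflection, gives both one-sided derivatives.\<close>
lemma derivative_of_integral_AE:
  fixes g F :: "real \<Rightarrow> real"
  assumes int: "\<And>s t. g integrable_on {s..t}"
    and F: "\<And>s t. a \<le> s \<Longrightarrow> s \<le> t \<Longrightarrow> t \<le> b \<Longrightarrow> (g has_integral (F t - F s)) {s..t}"
  obtains N where "negligible N"
    and "\<And>x. x \<notin> N \<Longrightarrow> a < x \<Longrightarrow> x < b \<Longrightarrow> (F has_real_derivative g x) (at x)"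
proof -
  obtain N where "negligible N" and N: "\<And>x e. x \<notin> N \<Longrightarrow> 0 < e \<Longrightarrow>
      \<exists>d>0. \<forall>h. 0 < h \<and> h < d \<longrightarrow> \<bar>integral {x..x+h} g / h - g x\<bar> < e"
    by (rule right_derivative_of_integral_AE[OF int]) blast
  have intm: "(\<lambda>x. g (- x)) integrable_on {s..t}" for s t
    using int[of "-t" "-s"] Henstock_Kurzweil_Integration.integrable_reflect_real[where f=g and a="-t" and b="-s"] by simp
  obtain M where "negligible M" and M: "\<And>x e. x \<notin> M \<Longrightarrow> 0 < e \<Longrightarrow>
      \<exists>d>0. \<forall>h. 0 < h \<and> h < d \<longrightarrow> \<bar>integral {x..x+h} (\<lambda>x. g (- x)) / h - g (- x)\<bar> < e"
    by (rule right_derivative_of_integral_AE[OF intm]) blast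
  have negM: "negligible (uminus ` M)"
    using \<open>negligible M\<close> by (intro negligible_differentiable_image_negligible) (auto intro!: derivative_intros)
  have "(F has_real_derivative g x) (at x)" if x: "x \<notin> N \<union> uminus ` M" "a < x" "x < b" for x
    unfolding has_field_derivative_iff LIM_eq
  proof (intro allI impI)
    fix e :: real assume "0 < e"
    have "x \<notin> N" "- x \<notin> M" using x(1) by (auto simp: image_iff)
    obtain d1 where "0 < d1" and d1: "\<And>h. 0 < h \<Longrightarrow> h < d1 \<Longrightarrow> \<bar>integral {x..x+h} g / h - g x\<bar> < e"
      using N[OF \<open>x \<notin> N\<close> \<open>0 < e\<close>] by blast
    obtain d2 where "0 < d2" and d2: "\<And>h. 0 < h \<Longrightarrow> h < d2 \<Longrightarrow>
        \<bar>integral {- x..- x+h} (\<lambda>x. g (- x)) / h - g x\<bar> < e"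
      using M[OF \<open>- x \<notin> M\<close> \<open>0 < e\<close>] by auto
    define d where "d = Min {d1, d2, x - a, b - x}"
    have "0 < d" using \<open>0 < d1\<close> \<open>0 < d2\<close> x by (simp add: d_def)
    have "norm ((F y - F x) / (y - x) - g x) < e" if y: "y \<noteq> x" "norm (y - x) < d" for y
    proof (cases "x < y")
      case True
      have "integral {x..y} g = F y - F x"
        using F[of x y] True y x by (intro integral_unique) (auto simp: d_def)
      then show ?thesis using d1[of "y - x"] True y by (simp add: d_def)
    next
      case False
      then have "y < x" using y by simp
      have "integral {- x..- y} (\<lambda>x. g (- x)) = F x - F y"
        using F[of y x] \<open>y < x\<close> y x Henstock_Kurzweil_Integration.integral_reflect_real[where f=g and a=y and b=x]
        by (auto simp: d_def dest!: integral_unique)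
      moreover have "(F y - F x) / (y - x) = (F x - F y) / (x - y)"
        using \<open>y < x\<close> by (simp add: field_simps)
      ultimately show ?thesis using d2[of "x - y"] \<open>y < x\<close> y by (simp add: d_def)
    qed
    with \<open>0 < d\<close> show "\<exists>s>0. \<forall>y. y \<noteq> x \<and> norm (y - x) < s \<longrightarrow> norm ((F y - F x) / (y - x) - g x) < e"
      by blast
  qed
  moreover have "negligible (N \<union> uminus ` M)" using \<open>negligible N\<close> negM by simp
  ultimately show thesis using that by blast
qed

text \<open>The value of \<^const>\<open>deriv\<close> at a point of non-differentiability is unspecified, so the inequality rests
  on the fact that an absolutely continuous function is differentiable almost everywhere, with the
  density of its increments as derivative.\<close>
lemma abs_continuous_increment_le:
  assumes ac: "abs_continuous_on a b f" and xy: "a \<le> x" "x \<le> y" "y \<le> b"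
  shows "ennreal \<bar>f y - f x\<bar> \<le> (\<integral>\<^sup>+z\<in>{x..y}. ennreal \<bar>deriv f z\<bar> \<partial>lebesgue)"
proof -
  have "a \<le> b" using xy by simp
  then obtain g where abs_int: "\<And>s t. g absolutely_integrable_on {s..t}"
    and g: "\<And>s t. a \<le> s \<Longrightarrow> s \<le> t \<Longrightarrow> t \<le> b \<Longrightarrow> (g has_integral (f t - f s)) {s..t}"
    using abs_continuous_has_density[OF _ ac] by metis
  obtain N where "negligible N" and N: "\<And>x. x \<notin> N \<Longrightarrow> a < x \<Longrightarrow> x < b \<Longrightarrow> (f has_real_derivative g x) (at x)"
    by (rule derivative_of_integral_AE[of g a b f, OF set_lebesgue_integral_eq_integral(1)[OF abs_int] g]) blast+
  have "f y - f x = integral {x..y} g"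
    using g[OF xy] by (simp add: integral_unique)
  also have "\<dots> = (\<integral>z. indicator {x..y} z *\<^sub>R g z \<partial>lebesgue)"
    using set_lebesgue_integral_eq_integral(2)[OF abs_int, of x y] by (simp add: set_lebesgue_integral_def)
  finally have "ennreal \<bar>f y - f x\<bar> \<le> (\<integral>\<^sup>+z. ennreal (norm (indicator {x..y} z *\<^sub>R g z)) \<partial>lebesgue)"
    using integral_norm_bound_ennreal[OF abs_int[unfolded set_integrable_def, of x y]] by simp
  also have "\<dots> = (\<integral>\<^sup>+z\<in>{x..y}. ennreal \<bar>deriv f z\<bar> \<partial>lebesgue)"
  proof (rule nn_integral_cong_AE)
    have "negligible (N \<union> {x, y})" using \<open>negligible N\<close> by simp
    then have "AE z in lebesgue. z \<notin> N \<union> {x, y}"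
      by (simp only: negligible_iff_null_sets AE_not_in)
    then show "AE z in lebesgue. ennreal (norm (indicator {x..y} z *\<^sub>R g z)) =
        ennreal \<bar>deriv f z\<bar> * indicator {x..y} z"
    proof eventually_elim
      case (elim z)
      show ?case
      proof (cases "z \<in> {x..y}")
        case True
        then have "deriv f z = g z"
          using elim xy by (intro DERIV_imp_deriv N) auto
        then show ?thesis using True by simp
      qed simp
    qed
  qed
  finally show ?thesis .
qed

section \<open>The modular and the Luxemburg norm\<close>

text \<open>The Musielak-Orlicz modular; \<^const>\<open>lp_norm\<close> is its Luxemburg norm.\<close>
definition modular :: "(real \<Rightarrow> real) \<Rightarrow> (real \<Rightarrow> ennreal) \<Rightarrow> (real \<Rightarrow> real) \<Rightarrow> ennreal" where
  "modular p \<omega> f = (\<integral>\<^sup>+x\<in>torus. ennreal (\<bar>f x\<bar> powr p x) * \<omega> x \<partial>lebesgue)"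

abbreviation abs_integral :: "real set \<Rightarrow> (real \<Rightarrow> real) \<Rightarrow> ennreal" where
  "abs_integral B f \<equiv> \<integral>\<^sup>+x\<in>B. ennreal \<bar>f x\<bar> \<partial>lebesgue"

abbreviation modular_on :: "(real \<Rightarrow> real) \<Rightarrow> (real \<Rightarrow> ennreal) \<Rightarrow> real set \<Rightarrow> (real \<Rightarrow> real) \<Rightarrow> ennreal" where
  "modular_on p \<omega> B f \<equiv> \<integral>\<^sup>+x\<in>B. ennreal (\<bar>f x\<bar> powr p x) * \<omega> x \<partial>lebesgue"

abbreviation weight_mass :: "(real \<Rightarrow> ennreal) \<Rightarrow> real set \<Rightarrow> ennreal" where
  "weight_mass \<omega> B \<equiv> \<integral>\<^sup>+x\<in>B. \<omega> x \<partial>lebesgue"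

lemma exponentsD:
  assumes "p \<in> exponents"
  shows "x \<in> torus \<Longrightarrow> 1 \<le> p x" "p \<in> borel_measurable (lebesgue_on torus)"
  using assms by (auto simp: exponents_def)

lemma lp_norm_eq: "lp_norm p \<omega> f = Inf {ennreal \<alpha> |\<alpha>. 0 < \<alpha> \<and> modular p \<omega> (\<lambda>x. f x / \<alpha>) \<le> 1}"
  by (simp add: lp_norm_def modular_def)

lemma lp_norm_le:
  assumes "0 < \<alpha>" and "modular p \<omega> (\<lambda>x. f x / \<alpha>) \<le> 1"
  shows "lp_norm p \<omega> f \<le> ennreal \<alpha>"
  unfolding lp_norm_eq by (rule Inf_lower) (use assms in blast)

lemma modular_mono_AE:
  assumes "\<And>x. x \<in> torus \<Longrightarrow> 1 \<le> p x"
    and "AE x in lebesgue. x \<in> torus \<longrightarrow> \<bar>f x\<bar> \<le> \<bar>g x\<bar>"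
  shows "modular p \<omega> f \<le> modular p \<omega> g"
  unfolding modular_def using assms(2)
proof (intro nn_integral_mono_AE, eventually_elim)
  case (elim x)
  have "ennreal (\<bar>f x\<bar> powr p x) \<le> ennreal (\<bar>g x\<bar> powr p x)" if "x \<in> torus"
    using elim that assms(1)[OF that] by (intro ennreal_leI powr_mono2) auto
  then show ?case by (auto simp: indicator_def intro: mult_right_mono)
qed

lemma lp_norm_lessD:
  assumes p: "\<And>x. x \<in> torus \<Longrightarrow> 1 \<le> p x" and "lp_norm p \<omega> f < ennreal \<beta>"
  shows "0 < \<beta>" and "modular p \<omega> (\<lambda>x. f x / \<beta>) \<le> 1"
proof -
  obtain \<alpha> where \<alpha>: "0 < \<alpha>" "modular p \<omega> (\<lambda>x. f x / \<alpha>) \<le> 1" "ennreal \<alpha> < ennreal \<beta>"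
    using assms(2) unfolding lp_norm_eq Inf_less_iff by blast
  then have "\<alpha> < \<beta>" by (simp add: ennreal_less_iff)
  then show "0 < \<beta>" using \<alpha>(1) by simp
  have "modular p \<omega> (\<lambda>x. f x / \<beta>) \<le> modular p \<omega> (\<lambda>x. f x / \<alpha>)"
    using \<alpha>(1) \<open>\<alpha> < \<beta>\<close> by (intro modular_mono_AE[OF p]) (auto simp: frac_le)
  then show "modular p \<omega> (\<lambda>x. f x / \<beta>) \<le> 1"
    using \<alpha>(2) by (rule order_trans)
qed

lemma lp_norm_mono_AE:
  assumes p: "\<And>x. x \<in> torus \<Longrightarrow> 1 \<le> p x"
    and le: "AE x in lebesgue. x \<in> torus \<longrightarrow> \<bar>f x\<bar> \<le> \<bar>g x\<bar>"
  shows "lp_norm p \<omega> f \<le> lp_norm p \<omega> g"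
  unfolding lp_norm_eq
proof (rule Inf_superset_mono, clarify)
  fix \<alpha> :: real assume \<alpha>: "0 < \<alpha>" "modular p \<omega> (\<lambda>x. g x / \<alpha>) \<le> 1"
  have "modular p \<omega> (\<lambda>x. f x / \<alpha>) \<le> modular p \<omega> (\<lambda>x. g x / \<alpha>)"
    using le \<alpha>(1) by (intro modular_mono_AE[OF p]) (auto elim!: eventually_mono simp: divide_right_mono)
  then show "\<exists>\<alpha>'. ennreal \<alpha> = ennreal \<alpha>' \<and> 0 < \<alpha>' \<and> modular p \<omega> (\<lambda>x. f x / \<alpha>') \<le> 1"
    using \<alpha> by (intro exI[of _ \<alpha>]) auto
qed

text \<open>Norm inequalities are proved for functions that have been scaled to modular at most \<open>1\<close>. This
  is the passage back to norms, infinite ones included.\<close>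
lemma ennreal_le_mult_if_bounds:
  assumes "0 < K" and le: "\<And>\<beta>. 0 < \<beta> \<Longrightarrow> x < ennreal \<beta> \<Longrightarrow> y \<le> ennreal (K * \<beta>)"
  shows "y \<le> ennreal K * x"
proof (cases x)
  case (real a)
  show ?thesis
  proof (rule ennreal_le_epsilon)
    fix e :: real assume "0 < e"
    have "y \<le> ennreal (K * (a + e / K))"
      using real \<open>0 < e\<close> \<open>0 < K\<close> by (intro le) (auto simp: ennreal_less_iff add_nonneg_pos)
    also have "\<dots> = ennreal K * x + ennreal e"
      using real \<open>0 < e\<close> \<open>0 < K\<close> by (simp add: distrib_left ennreal_mult ennreal_plus)
    finally show "y \<le> ennreal K * x + ennreal e" .
  qed
next
  case top
  then show ?thesis using \<open>0 < K\<close> by (simp add: ennreal_mult_top)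
qed

text \<open>The values of an exponent off the torus are arbitrary. Multiplication by the indicator function
  of the torus makes it measurable on the line and leaves the integrand unchanged.\<close>
lemma lp_integrand_measurable:
  assumes "p \<in> borel_measurable (lebesgue_on torus)" "\<omega> \<in> borel_measurable lebesgue"
    "f \<in> borel_measurable lebesgue"
  shows "(\<lambda>x. ennreal (\<bar>f x\<bar> powr p x) * \<omega> x * indicator torus x) \<in> borel_measurable lebesgue"
proof -
  have [measurable]: "torus \<in> sets lebesgue" by (simp add: torus_def)
  have p': "(\<lambda>x. indicator torus x *\<^sub>R p x) \<in> borel_measurable lebesgue"
    using assms(1) by (subst borel_measurable_restrict_space_iff[symmetric]) auto
  have "(\<lambda>x. ennreal (\<bar>f x\<bar> powr (indicator torus x *\<^sub>R p x)) * \<omega> x * indicator torus x) \<in> borel_measurable lebesgue"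
    using p' assms(2,3) by measurable
  then show ?thesis
    by (rule measurable_cong[THEN iffD1, rotated]) (auto simp: indicator_def)
qed

text \<open>All exponents are at least \<open>1\<close>, so dividing a function by \<open>C \<ge> 1\<close> divides its modular by at least
  \<open>C\<close>.\<close>
lemma lp_norm_le_of_modular_le:
  assumes p: "\<And>x. x \<in> torus \<Longrightarrow> 1 \<le> p x" and meas: "p \<in> borel_measurable (lebesgue_on torus)"
    "\<omega> \<in> borel_measurable lebesgue" "f \<in> borel_measurable lebesgue"
    and C: "1 \<le> C" "0 < \<beta>" and le: "modular p \<omega> (\<lambda>x. f x / \<beta>) \<le> ennreal C"
  shows "lp_norm p \<omega> f \<le> ennreal (C * \<beta>)"
proof (rule lp_norm_le)
  show "0 < C * \<beta>" using C by simp
  have pw: "ennreal (\<bar>f x / (C * \<beta>)\<bar> powr p x) * \<omega> x * indicator torus x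
      \<le> ennreal (1 / C) * (ennreal (\<bar>f x / \<beta>\<bar> powr p x) * \<omega> x * indicator torus x)" for x
  proof (cases "x \<in> torus")
    case True
    have "\<bar>f x / (C * \<beta>)\<bar> powr p x = (1/C) powr p x * \<bar>f x / \<beta>\<bar> powr p x"
      using C by (simp add: powr_mult[symmetric] abs_mult)
    also have "(1/C) powr p x \<le> (1/C) powr 1"
      using C(1) p[OF True] by (intro powr_mono') auto
    finally have "\<bar>f x / (C * \<beta>)\<bar> powr p x \<le> (1/C) * \<bar>f x / \<beta>\<bar> powr p x"
      using C(1) by (simp add: mult_right_mono)
    then have "ennreal (\<bar>f x / (C * \<beta>)\<bar> powr p x) \<le> ennreal (1/C) * ennreal (\<bar>f x / \<beta>\<bar> powr p x)"
      using C(1) by (simp add: ennreal_mult[symmetric] ennreal_leI)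
    then show ?thesis using True by (simp add: mult.assoc[symmetric] mult_right_mono)
  qed simp
  have "modular p \<omega> (\<lambda>x. f x / (C * \<beta>)) \<le>
      (\<integral>\<^sup>+x. ennreal (1 / C) * (ennreal (\<bar>f x / \<beta>\<bar> powr p x) * \<omega> x * indicator torus x) \<partial>lebesgue)"
    unfolding modular_def by (rule nn_integral_mono) (rule pw)
  also have "\<dots> = ennreal (1 / C) * modular p \<omega> (\<lambda>x. f x / \<beta>)"
    unfolding modular_def using meas
    by (intro nn_integral_cmult lp_integrand_measurable borel_measurable_divide) auto
  also have "\<dots> \<le> ennreal (1 / C) * ennreal C"
    by (rule mult_left_mono[OF le]) simp
  also have "\<dots> = 1"
    using C(1) by (simp add: ennreal_mult[symmetric])
  finally show "modular p \<omega> (\<lambda>x. f x / (C * \<beta>)) \<le> 1" .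
qed

lemma convex_combination_powr_le:
  fixes p :: real
  assumes "1 \<le> p" "0 \<le> u" "0 \<le> v" "0 < \<alpha>" "0 < \<beta>"
  shows "((\<alpha> * u + \<beta> * v) / (\<alpha> + \<beta>)) powr p \<le> \<alpha> / (\<alpha> + \<beta>) * u powr p + \<beta> / (\<alpha> + \<beta>) * v powr p"
proof -
  have small: "(c * x) powr p \<le> c * x powr p" if "0 < c" "c \<le> 1" "0 \<le> x" for c x :: real
  proof -
    have "c powr p \<le> c powr 1" using that assms(1) by (intro powr_mono') auto
    then show ?thesis using that by (simp add: powr_mult mult_right_mono)
  qed
  let ?a = "\<alpha> / (\<alpha> + \<beta>)" and ?b = "\<beta> / (\<alpha> + \<beta>)"
  have ab: "0 < ?a" "?a \<le> 1" "0 < ?b" "?b \<le> 1" "?a = 1 - ?b" using assms by (auto simp: field_simps)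
  consider "u = 0" | "v = 0" | "0 < u" "0 < v" using assms by linarith
  then have "(?a * u + ?b * v) powr p \<le> ?a * u powr p + ?b * v powr p"
  proof cases
    case 1
    then show ?thesis using small[OF ab(3,4) assms(3)] by simp
  next
    case 2
    then show ?thesis using small[OF ab(1,2) assms(2)] by simp
  next
    case 3
    then show ?thesis
      using convex_onD[OF powr_convex[OF assms(1)], of ?b u v] ab by (simp del: add_divide_distrib)
  qed
  then show ?thesis by (simp add: add_divide_distrib)
qed

text \<open>Convexity of the power: the quotient \<open>(f x + g x) / (\<alpha> + \<beta>)\<close> is the convex combination of \<open>f x / \<alpha>\<close>
  and \<open>g x / \<beta>\<close> with weights \<open>\<alpha> / (\<alpha> + \<beta>)\<close> and \<open>\<beta> / (\<alpha> + \<beta>)\<close>.\<close>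
lemma lp_norm_triangle:
  assumes p: "\<And>x. x \<in> torus \<Longrightarrow> 1 \<le> p x" and meas: "p \<in> borel_measurable (lebesgue_on torus)"
    "\<omega> \<in> borel_measurable lebesgue" "f \<in> borel_measurable lebesgue" "g \<in> borel_measurable lebesgue"
  shows "lp_norm p \<omega> (\<lambda>x. f x + g x) \<le> lp_norm p \<omega> f + lp_norm p \<omega> g"
proof (cases "lp_norm p \<omega> f = \<infinity> \<or> lp_norm p \<omega> g = \<infinity>")
  case False
  have *: "lp_norm p \<omega> (\<lambda>x. f x + g x) \<le> ennreal (\<alpha> + \<beta>)"
    if "lp_norm p \<omega> f < ennreal \<alpha>" "lp_norm p \<omega> g < ennreal \<beta>" for \<alpha> \<beta>
  proof (rule lp_norm_le)
    note \<alpha> = lp_norm_lessD[OF p that(1)] and \<beta> = lp_norm_lessD[OF p that(2)]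
    show "0 < \<alpha> + \<beta>" using \<alpha>(1) \<beta>(1) by simp
    let ?F = "\<lambda>x. ennreal (\<bar>f x / \<alpha>\<bar> powr p x) * \<omega> x * indicator torus x"
    let ?G = "\<lambda>x. ennreal (\<bar>g x / \<beta>\<bar> powr p x) * \<omega> x * indicator torus x"
    have F: "?F \<in> borel_measurable lebesgue" and G: "?G \<in> borel_measurable lebesgue"
      using meas by (intro lp_integrand_measurable borel_measurable_divide; simp)+
    have pw: "ennreal (\<bar>(f x + g x) / (\<alpha> + \<beta>)\<bar> powr p x) * \<omega> x * indicator torus x
        \<le> ennreal (\<alpha>/(\<alpha>+\<beta>)) * ?F x + ennreal (\<beta>/(\<alpha>+\<beta>)) * ?G x" for x
    proof (cases "x \<in> torus")
      case True
      have "\<bar>(f x + g x) / (\<alpha> + \<beta>)\<bar> \<le> (\<alpha> * \<bar>f x / \<alpha>\<bar> + \<beta> * \<bar>g x / \<beta>\<bar>) / (\<alpha> + \<beta>)"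
        using \<alpha>(1) \<beta>(1) by (simp add: abs_triangle_ineq divide_right_mono)
      then have "\<bar>(f x + g x) / (\<alpha> + \<beta>)\<bar> powr p x \<le>
          ((\<alpha> * \<bar>f x / \<alpha>\<bar> + \<beta> * \<bar>g x / \<beta>\<bar>) / (\<alpha> + \<beta>)) powr p x"
        using p[OF True] by (intro powr_mono2) auto
      also have "\<dots> \<le> \<alpha> / (\<alpha> + \<beta>) * \<bar>f x / \<alpha>\<bar> powr p x + \<beta> / (\<alpha> + \<beta>) * \<bar>g x / \<beta>\<bar> powr p x"
        using p[OF True] \<alpha>(1) \<beta>(1) by (intro convex_combination_powr_le) auto
      finally have "ennreal (\<bar>(f x + g x) / (\<alpha> + \<beta>)\<bar> powr p x) \<le>
          ennreal (\<alpha> / (\<alpha> + \<beta>)) * ennreal (\<bar>f x / \<alpha>\<bar> powr p x) +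
          ennreal (\<beta> / (\<alpha> + \<beta>)) * ennreal (\<bar>g x / \<beta>\<bar> powr p x)"
        using \<alpha>(1) \<beta>(1) by (simp add: ennreal_mult[symmetric] ennreal_plus[symmetric] ennreal_leI del: ennreal_plus)
      then show ?thesis
        using True mult_right_mono[of _ _ "\<omega> x"] by (simp add: mult.assoc[symmetric] distrib_right[symmetric])
    qed simp
    have "modular p \<omega> (\<lambda>x. (f x + g x) / (\<alpha> + \<beta>)) \<le>
        (\<integral>\<^sup>+x. ennreal (\<alpha>/(\<alpha>+\<beta>)) * ?F x + ennreal (\<beta>/(\<alpha>+\<beta>)) * ?G x \<partial>lebesgue)"
      unfolding modular_def by (rule nn_integral_mono) (rule pw)
    also have "\<dots> = ennreal (\<alpha>/(\<alpha>+\<beta>)) * modular p \<omega> (\<lambda>x. f x / \<alpha>) + ennreal (\<beta>/(\<alpha>+\<beta>)) * modular p \<omega> (\<lambda>x. g x / \<beta>)"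
      unfolding modular_def using F G by (simp add: nn_integral_add nn_integral_cmult)
    also have "\<dots> \<le> ennreal (\<alpha>/(\<alpha>+\<beta>)) * 1 + ennreal (\<beta>/(\<alpha>+\<beta>)) * 1"
      using \<alpha>(2) \<beta>(2) by (intro add_mono mult_left_mono) auto
    also have "\<dots> = 1"
      using \<alpha>(1) \<beta>(1) by (simp add: ennreal_plus[symmetric] add_divide_distrib[symmetric] del: ennreal_plus)
    finally show "modular p \<omega> (\<lambda>x. (f x + g x) / (\<alpha> + \<beta>)) \<le> 1" .
  qed
  obtain a b where ab: "lp_norm p \<omega> f = ennreal a" "0 \<le> a" "lp_norm p \<omega> g = ennreal b" "0 \<le> b"
    using False by (metis ennreal_cases infinity_ennreal_def)
  show ?thesis
  proof (rule ennreal_le_epsilon)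
    fix e :: real assume "0 < e"
    then have "lp_norm p \<omega> (\<lambda>x. f x + g x) \<le> ennreal ((a + e/2) + (b + e/2))"
      using ab by (intro *) (auto simp: ennreal_less_iff)
    also have "\<dots> = lp_norm p \<omega> f + lp_norm p \<omega> g + ennreal e"
      using ab \<open>0 < e\<close> by (simp add: ennreal_plus[symmetric] del: ennreal_plus)
    finally show "lp_norm p \<omega> (\<lambda>x. f x + g x) \<le> lp_norm p \<omega> f + lp_norm p \<omega> g + ennreal e" .
  qed
qed auto

lemma lp_norm_scale_le:
  assumes p: "\<And>x. x \<in> torus \<Longrightarrow> 1 \<le> p x" and "0 < c"
  shows "lp_norm p \<omega> (\<lambda>x. c * f x) \<le> ennreal c * lp_norm p \<omega> f"
proof (rule ennreal_le_mult_if_bounds[OF \<open>0 < c\<close>])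
  fix \<beta> assume "lp_norm p \<omega> f < ennreal \<beta>"
  note \<beta> = lp_norm_lessD[OF p this]
  show "lp_norm p \<omega> (\<lambda>x. c * f x) \<le> ennreal (c * \<beta>)"
    by (rule lp_norm_le) (use \<beta> \<open>0 < c\<close> in auto)
qed

section \<open>Duality for Muckenhoupt weights\<close>

text \<open>The integrand in the definition of the dual norm of a weight, at the trial value \<open>l\<close>.\<close>
abbreviation dual_integrand :: "(real \<Rightarrow> real) \<Rightarrow> (real \<Rightarrow> ennreal) \<Rightarrow> real \<Rightarrow> real \<Rightarrow> ennreal" where
  "dual_integrand p \<omega> l x \<equiv> mod_fun (conj_exponent (p x) / ennreal (p x)) (1 / \<omega> x / ennreal l)"

text \<open>Young's inequality for the exponents \<open>p\<close> and \<open>p / (p - 1)\<close> and the factors \<open>z * (w / s) powr (1 / p)\<close>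
  and \<open>(1 / (w * l)) powr (1 / p)\<close>.\<close>
lemma young_pointwise:
  fixes p z w s l :: real
  assumes "1 < p" "0 \<le> z" "0 < w" "0 < s" "0 < l"
  shows "z * (s * l) powr (- (1 / p)) \<le> z powr p * w / s + (1 / (w * l)) powr (1 / (p - 1))"
proof -
  define a b where "a = z * (w / s) powr (1 / p)" and "b = (1 / (w * l)) powr (1 / p)"
  have ab: "0 \<le> a" "0 \<le> b" using assms by (auto simp: a_def b_def)
  have "(w / s) powr (1 / p) * (1 / (w * l)) powr (1 / p) = (w / s * (1 / (w * l))) powr (1 / p)"
    using assms by (simp add: powr_mult[symmetric])
  also have "w / s * (1 / (w * l)) = 1 / (s * l)" using assms by simp
  also have "(1 / (s * l)) powr (1 / p) = (s * l) powr (- (1 / p))"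
  proof -
    have "(1 / y) powr a = y powr (- a)" if "0 < y" for y a :: real
      using that by (simp add: powr_minus_divide powr_divide)
    then show ?thesis using assms by simp
  qed
  finally have "z * (s * l) powr (- (1 / p)) = a * b" by (simp add: a_def b_def)
  also have "a * b \<le> a powr p / p + b powr (p / (p - 1)) / (p / (p - 1))"
    using assms ab by (intro Youngs_inequality) (auto simp: field_simps)
  also have "\<dots> \<le> a powr p + b powr (p / (p - 1))"
  proof (rule add_mono)
    show "a powr p / p \<le> a powr p"
      using assms(1) by (simp add: divide_le_eq mult_left_le mult_le_cancel_left1)
    have "1 \<le> p / (p - 1)" using assms(1) by (simp add: field_simps)
    then show "b powr (p / (p - 1)) / (p / (p - 1)) \<le> b powr (p / (p - 1))"
      by (simp only: divide_le_eq mult_le_cancel_left1) auto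
  qed
  also have "a powr p = z powr p * w / s"
    using assms by (simp add: a_def powr_mult powr_powr)
  also have "b powr (p / (p - 1)) = (1 / (w * l)) powr (1 / (p - 1))"
    using assms by (simp add: b_def powr_powr)
  finally show ?thesis .
qed

text \<open>For \<open>p = 1\<close> the dual term is infinite unless \<open>w * l \<ge> 1\<close>, and then the first term alone suffices.
  An infinite weight makes the first term infinite unless \<open>z = 0\<close>.\<close>
lemma holder_pointwise:
  assumes "1 \<le> p" "0 < w" "0 < s" "0 < l"
  shows "ennreal (\<bar>z\<bar> * (s * l) powr (- (1 / p))) \<le> ennreal (1 / s) * (ennreal (\<bar>z\<bar> powr p) * w) +
    mod_fun (conj_exponent p / ennreal p) (1 / w / ennreal l)"
proof (cases w)
  case top
  show ?thesis
  proof (cases "z = 0")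
    case False
    then have "ennreal (1 / s) * (ennreal (\<bar>z\<bar> powr p) * w) = top"
      using top \<open>0 < s\<close> by (simp add: ennreal_mult_eq_top_iff)
    then show ?thesis by simp
  qed auto
next
  case (real v)
  then have "0 < v" using \<open>0 < w\<close> by simp
  have dual: "1 / w / ennreal l = ennreal (1 / (v * l))"
    using \<open>0 < v\<close> \<open>0 < l\<close> real by (simp add: divide_ennreal ennreal_1[symmetric] del: ennreal_1)
  have main: "ennreal (1 / s) * (ennreal (\<bar>z\<bar> powr p) * w) = ennreal (\<bar>z\<bar> powr p * v / s)"
    using real \<open>0 < s\<close> by (simp add: ennreal_mult[symmetric] mult.commute)
  show ?thesis
  proof (cases "p = 1")
    case True
    have exp: "conj_exponent p / ennreal p = \<infinity>"
      using True by (simp add: conj_exponent_def divide_ennreal_def)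
    show ?thesis
    proof (cases "1 / (v * l) \<le> 1")
      case le: True
      have "\<bar>z\<bar> * (s * l) powr (- (1 / p)) = \<bar>z\<bar> / s * (1 / l)"
        using True assms by (simp add: powr_minus divide_inverse)
      also have "\<dots> \<le> \<bar>z\<bar> / s * v"
        using le \<open>0 < v\<close> assms by (intro mult_left_mono) (auto simp: field_simps)
      also have "\<dots> = \<bar>z\<bar> powr p * v / s" using True by simp
      finally show ?thesis
        unfolding main by (simp add: ennreal_leI add_increasing2)
    next
      case False
      then have "\<not> ennreal (1 / (v * l)) \<le> 1"
        using \<open>0 < v\<close> assms by (simp add: ennreal_le_1)
      then show ?thesis unfolding exp dual mod_fun_def by simp
    qed
  next
    case False
    then have p: "1 < p" using assms by simp
    have exp: "conj_exponent p / ennreal p = ennreal (1 / (p - 1))"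
      using p by (simp add: conj_exponent_def divide_ennreal)
    have "mod_fun (conj_exponent p / ennreal p) (1 / w / ennreal l) = ennreal ((1 / (v * l)) powr (1 / (p - 1)))"
      unfolding exp dual mod_fun_def using \<open>0 < v\<close> assms p by simp
    then show ?thesis
      unfolding main
      using young_pointwise[OF p abs_ge_zero \<open>0 < v\<close> assms(3,4), of z] \<open>0 < v\<close> assms
      by (simp add: ennreal_plus[symmetric] ennreal_leI del: ennreal_plus)
  qed
qed

lemma dual_integrand_measurable:
  assumes "p \<in> borel_measurable (lebesgue_on torus)" "\<omega> \<in> borel_measurable lebesgue"
    "B \<in> sets lebesgue" "B \<subseteq> torus"
  shows "(\<lambda>x. dual_integrand p \<omega> l x * indicator B x) \<in> borel_measurable lebesgue"
proof -
  have [measurable]: "torus \<in> sets lebesgue" by (simp add: torus_def)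
  have [measurable]: "B \<in> sets lebesgue" "\<omega> \<in> borel_measurable lebesgue" using assms by auto
  let ?p = "\<lambda>x. indicator torus x *\<^sub>R p x"
  have [measurable]: "?p \<in> borel_measurable lebesgue"
    using assms(1) by (subst borel_measurable_restrict_space_iff[symmetric]) auto
  have [measurable]: "(\<lambda>x. conj_exponent (?p x) / ennreal (?p x)) \<in> borel_measurable lebesgue"
    unfolding conj_exponent_def by measurable
  have "(\<lambda>x. dual_integrand ?p \<omega> l x * indicator B x) \<in> borel_measurable lebesgue"
    unfolding mod_fun_def by measurable
  then show ?thesis
    by (rule measurable_cong[THEN iffD1, rotated]) (use assms(4) in \<open>auto simp: indicator_def\<close>)
qed

text \<open>Hoelder's inequality with the two modulars normalised separately, the one of \<open>f\<close> by \<open>s\<close> and the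
  dual one by \<open>l\<close>. For a constant exponent the factor \<open>(s * l) powr (- (1 / p))\<close> could be pulled out
  of the integral, which is the usual form.\<close>
lemma holder_modular:
  assumes p: "\<And>x. x \<in> torus \<Longrightarrow> 1 \<le> p x" and meas: "p \<in> borel_measurable (lebesgue_on torus)"
    "f \<in> borel_measurable lebesgue" and w: "is_weight \<omega>"
    and B: "B \<in> sets lebesgue" "B \<subseteq> torus"
    and "0 < s" "0 < l"
    and F: "modular_on p \<omega> B f \<le> ennreal s"
    and dual: "(\<integral>\<^sup>+x\<in>B. dual_integrand p \<omega> l x \<partial>lebesgue) \<le> 1"
  shows "(\<integral>\<^sup>+x\<in>B. ennreal (\<bar>f x\<bar> * (s * l) powr (- (1 / p x))) \<partial>lebesgue) \<le> 2"
proof -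
  have wm: "\<omega> \<in> borel_measurable lebesgue" and wpos: "AE x in lebesgue. 0 < \<omega> x"
    using w by (auto simp: is_weight_def)
  let ?F = "\<lambda>x. ennreal (\<bar>f x\<bar> powr p x) * \<omega> x * indicator B x"
  have Fm: "?F \<in> borel_measurable lebesgue"
  proof -
    have "(\<lambda>x. ennreal (\<bar>f x\<bar> powr p x) * \<omega> x * indicator torus x * indicator B x) \<in> borel_measurable lebesgue"
      using lp_integrand_measurable[OF meas(1) wm meas(2)] B(1) by measurable
    then show ?thesis
      by (rule measurable_cong[THEN iffD1, rotated]) (use B(2) in \<open>auto simp: indicator_def\<close>)
  qed
  note Gm = dual_integrand_measurable[OF meas(1) wm B, of l]
  have "(\<integral>\<^sup>+x\<in>B. ennreal (\<bar>f x\<bar> * (s * l) powr (- (1 / p x))) \<partial>lebesgue) \<le>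
      (\<integral>\<^sup>+x. ennreal (1 / s) * ?F x + dual_integrand p \<omega> l x * indicator B x \<partial>lebesgue)"
  proof (rule nn_integral_mono_AE)
    show "AE x in lebesgue. ennreal (\<bar>f x\<bar> * (s * l) powr (- (1 / p x))) * indicator B x \<le>
        ennreal (1 / s) * ?F x + dual_integrand p \<omega> l x * indicator B x"
      using wpos
    proof eventually_elim
      case (elim x)
      then show ?case
        using holder_pointwise[of "p x" "\<omega> x" s l "f x"] p[of x] \<open>0 < s\<close> \<open>0 < l\<close> B(2)
        by (cases "x \<in> B") auto
    qed
  qed
  also have "\<dots> = ennreal (1 / s) * (\<integral>\<^sup>+x. ?F x \<partial>lebesgue) + (\<integral>\<^sup>+x\<in>B. dual_integrand p \<omega> l x \<partial>lebesgue)"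
    using Fm Gm by (simp add: nn_integral_add nn_integral_cmult)
  also have "\<dots> \<le> ennreal (1 / s) * ennreal s + 1"
    using F dual by (intro add_mono mult_left_mono) auto
  also have "\<dots> = 2" using \<open>0 < s\<close> by (simp add: ennreal_mult[symmetric])
  finally show ?thesis .
qed

abbreviation dual_norm :: "(real \<Rightarrow> real) \<Rightarrow> (real \<Rightarrow> ennreal) \<Rightarrow> real set \<Rightarrow> ennreal" where
  "dual_norm p \<omega> B \<equiv> local_norm B (\<lambda>x. conj_exponent (p x) / ennreal (p x)) (\<lambda>x. 1 / \<omega> x)"

text \<open>The Muckenhoupt condition on compact intervals, with an explicit constant.\<close>
abbreviation muckenhoupt_bound :: "(real \<Rightarrow> real) \<Rightarrow> (real \<Rightarrow> ennreal) \<Rightarrow> real \<Rightarrow> bool" where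
  "muckenhoupt_bound p \<omega> A \<equiv> \<forall>s t. -pi \<le> s \<and> s < t \<and> t \<le> pi \<longrightarrow>
      weight_mass \<omega> {s..t} / ennreal ((t - s) powr mean_exponent p {s..t}) * dual_norm p \<omega> {s..t} \<le> ennreal A"

lemma muckenhouptE:
  assumes "\<omega> \<in> muckenhoupt p"
  obtains A where "0 < A" "is_weight \<omega>"
    and "muckenhoupt_bound p \<omega> A"
proof -
  let ?S = "SUP B\<in>{B. is_interval B \<and> B \<subseteq> torus \<and> 0 < measure lebesgue B}.
        weight_mass \<omega> B / ennreal (measure lebesgue B powr mean_exponent p B) * dual_norm p \<omega> B"
  have w: "is_weight \<omega>" and S: "?S < \<infinity>" using assms by (auto simp: muckenhoupt_def)
  obtain A where A: "?S = ennreal A" "0 \<le> A" using S by (cases ?S) auto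
  show thesis
  proof (rule that[of "A + 1"], safe)
    fix s t :: real assume st: "-pi \<le> s" "s < t" "t \<le> pi"
    then have m: "measure lebesgue {s..t} = t - s" by simp
    have "weight_mass \<omega> {s..t} / ennreal (measure lebesgue {s..t} powr mean_exponent p {s..t}) *
        dual_norm p \<omega> {s..t} \<le> ?S"
      using st m by (intro SUP_upper) (auto simp: torus_def is_interval_cc)
    also have "\<dots> \<le> ennreal (A + 1)" using A by (simp add: ennreal_leI)
    finally show "weight_mass \<omega> {s..t} / ennreal ((t - s) powr mean_exponent p {s..t}) *
        dual_norm p \<omega> {s..t} \<le> ennreal (A + 1)"
      unfolding m .
  qed (use A w in auto)
qed

lemma exponents_AE_bound:
  assumes "p \<in> exponents"
  obtains P where "1 \<le> P" "AE x in lebesgue. x \<in> torus \<longrightarrow> p x \<le> P"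
proof -
  have m: "p \<in> borel_measurable (lebesgue_on torus)" and fin: "esssup (lebesgue_on torus) (\<lambda>x. ereal (p x)) < \<infinity>"
    using assms by (auto simp: exponents_def)
  have "AE x in lebesgue_on torus. ereal (p x) \<le> esssup (lebesgue_on torus) (\<lambda>x. ereal (p x))"
    by (rule esssup_AE)
  moreover have "\<exists>P. esssup (lebesgue_on torus) (\<lambda>x. ereal (p x)) \<le> ereal P"
    using fin by (cases "esssup (lebesgue_on torus) (\<lambda>x. ereal (p x))") auto
  then obtain P where "esssup (lebesgue_on torus) (\<lambda>x. ereal (p x)) \<le> ereal P" by blast
  ultimately have "AE x in lebesgue_on torus. p x \<le> max 1 P"
  proof (elim eventually_mono)
    fix x assume "ereal (p x) \<le> esssup (lebesgue_on torus) (\<lambda>x. ereal (p x))"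
    then have "ereal (p x) \<le> ereal P" using \<open>_ \<le> ereal P\<close> by (rule order_trans)
    then show "p x \<le> max 1 P" by simp
  qed
  then have "AE x in lebesgue. x \<in> torus \<longrightarrow> p x \<le> max 1 P"
    by (subst (asm) AE_restrict_space_iff) (auto simp: torus_def)
  then show thesis by (rule that[rotated]) simp
qed

section \<open>Averages over intervals of equal length\<close>

text \<open>The modulus of continuity of \<open>1/p\<close> on an interval of length \<open>L\<close> compensates a logarithm as large as
  \<open>ln (1 / L)\<close>. Hence \<open>I\<close> raised to exponents that differ by this modulus gives comparable values.\<close>
lemma log_modulus_absorbs_ln:
  fixes c C L I :: real
  assumes "0 < c" "1 \<le> C" "0 < L" "L \<le> I" "I \<le> C"
  shows "\<bar>ln I\<bar> * (c / ln (exp 1 + 1 / L)) \<le> c * (1 + ln C)"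
    and "ln (I / L) * (c / ln (exp 1 + 1 / L)) \<le> c * (1 + ln C)"
proof -
  let ?l = "ln (exp 1 + 1 / L)"
  have "ln (exp 1) \<le> ?l" using assms by (intro ln_mono) auto
  then have l1: "1 \<le> ?l" by simp
  have "ln (1 / L) \<le> ?l" using assms by (intro ln_mono) (auto intro: add_pos_pos)
  then have l2: "- ln L \<le> ?l" using assms by (simp add: ln_div)
  have I: "ln L \<le> ln I" "ln I \<le> ln C" using assms by (auto intro!: ln_mono)
  have C: "0 \<le> ln C" using assms by simp
  then have lC: "ln C \<le> ?l * ln C" "0 \<le> ?l * ln C" using l1 by (simp_all add: mult_le_cancel_right1)
  have absorb: "X * (c / ?l) \<le> c * (1 + ln C)" if "X \<le> ?l + ?l * ln C" for X
  proof -
    have "c * X \<le> c * (?l * (1 + ln C))"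
      using that assms by (intro mult_left_mono) (auto simp: distrib_left)
    moreover have "0 < ?l" using l1 by linarith
    ultimately show ?thesis
      by (simp only: times_divide_eq_right pos_divide_le_eq) (simp only: mult_ac)
  qed
  have "\<bar>ln I\<bar> \<le> ?l + ?l * ln C" using I l1 l2 lC by linarith
  then show "\<bar>ln I\<bar> * (c / ?l) \<le> c * (1 + ln C)" by (rule absorb)
  have "ln (I / L) = ln I - ln L" using assms by (simp add: ln_div)
  also have "\<dots> \<le> ?l + ?l * ln C" using I l2 lC by linarith
  finally show "ln (I / L) * (c / ?l) \<le> c * (1 + ln C)" by (rule absorb)
qed

lemma set_average_bounds:
  fixes g :: "real \<Rightarrow> real"
  assumes "s < t" and int: "set_integrable lebesgue {s..t} g"
    and le: "AE y in lebesgue. y \<in> {s..t} \<longrightarrow> lo \<le> g y \<and> g y \<le> hi"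
  shows "lo \<le> 1 / (t - s) * (LINT y:{s..t}|lebesgue. g y)"
    and "1 / (t - s) * (LINT y:{s..t}|lebesgue. g y) \<le> hi"
proof -
  have const: "set_integrable lebesgue {s..t} (\<lambda>_. k)" "(LINT y:{s..t}|lebesgue. k) = (t - s) * k" for k :: real
    using \<open>s < t\<close> by (auto simp: set_integrable_def set_lebesgue_integral_def)
  have "(LINT y:{s..t}|lebesgue. lo) \<le> (LINT y:{s..t}|lebesgue. g y)"
    using le by (intro set_integral_mono_AE const int) (auto elim!: eventually_mono)
  moreover have "(LINT y:{s..t}|lebesgue. g y) \<le> (LINT y:{s..t}|lebesgue. hi)"
    using le by (intro set_integral_mono_AE const int) (auto elim!: eventually_mono)
  ultimately show "lo \<le> 1 / (t - s) * (LINT y:{s..t}|lebesgue. g y)"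
    and "1 / (t - s) * (LINT y:{s..t}|lebesgue. g y) \<le> hi"
    using \<open>s < t\<close> by (auto simp: const(2) field_simps)
qed

text \<open>The reciprocal of the mean exponent is the average of \<open>1/p\<close>, so bounds for \<open>1/p\<close> and for its
  oscillation on the interval pass to it.\<close>
lemma mean_exponent_bounds:
  assumes p: "p \<in> exponents" and P: "1 \<le> P" "AE x in lebesgue. x \<in> torus \<longrightarrow> p x \<le> P"
    and c: "0 < c" "\<forall>x\<in>torus. \<forall>y\<in>torus. x \<noteq> y \<longrightarrow>
      \<bar>1 / p x - 1 / p y\<bar> \<le> c / ln (exp 1 + 1 / \<bar>x - y\<bar>)"
    and st: "-pi \<le> s" "s < t" "t \<le> pi"
  shows "1 \<le> mean_exponent p {s..t}" "mean_exponent p {s..t} \<le> P"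
    and "x \<in> {s..t} \<Longrightarrow> \<bar>1 / mean_exponent p {s..t} - 1 / p x\<bar> \<le> c / ln (exp 1 + 1 / (t - s))"
proof -
  let ?q = "1 / (t - s) * (LINT y:{s..t}|lebesgue. 1 / p y)"
  note p1 = exponentsD(1)[OF p]
  have sub: "{s..t} \<subseteq> torus" using st by (auto simp: torus_def)
  have q: "1 / mean_exponent p {s..t} = ?q"
    using st by (simp add: mean_exponent_def divide_inverse)
  have pm: "(\<lambda>x. indicator torus x *\<^sub>R p x) \<in> borel_measurable lebesgue"
    using p unfolding exponents_def by (subst borel_measurable_restrict_space_iff[symmetric]) (auto simp: torus_def)
  have int: "set_integrable lebesgue {s..t} (\<lambda>y. 1 / p y)"
    unfolding set_integrable_def
  proof (rule Bochner_Integration.integrable_bound[of _ "\<lambda>x. indicator {s..t} x :: real"])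
    show "integrable lebesgue (\<lambda>x. indicator {s..t} x :: real)"
      using st(2) by (intro integrable_real_indicator) auto
    have "(\<lambda>y. indicator {s..t} y *\<^sub>R (1 / (indicator torus y *\<^sub>R p y))) \<in> borel_measurable lebesgue"
      by (intro borel_measurable_scaleR borel_measurable_indicator borel_measurable_divide pm) auto
    then show "(\<lambda>y. indicator {s..t} y *\<^sub>R (1 / p y)) \<in> borel_measurable lebesgue"
      by (rule measurable_cong[THEN iffD1, rotated]) (use sub in \<open>auto simp: indicator_def\<close>)
    show "AE y in lebesgue. norm (indicator {s..t} y *\<^sub>R (1 / p y)) \<le> norm (indicator {s..t} y :: real)"
    proof (rule AE_I2)
      fix y
      show "norm (indicator {s..t} y *\<^sub>R (1 / p y)) \<le> norm (indicator {s..t} y :: real)"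
        using p1[of y] sub by (cases "y \<in> {s..t}") (auto simp: divide_le_eq subset_iff)
    qed
  qed
  have "1 / P \<le> ?q" "?q \<le> 1"
  proof -
    have le: "AE y in lebesgue. y \<in> {s..t} \<longrightarrow> 1 / P \<le> 1 / p y \<and> 1 / p y \<le> 1"
      using P(2)
    proof eventually_elim
      case (elim y)
      show ?case
      proof
        assume "y \<in> {s..t}"
        then have "1 \<le> p y" "p y \<le> P" using elim sub p1 by auto
        then show "1 / P \<le> 1 / p y \<and> 1 / p y \<le> 1" by (auto simp: field_simps)
      qed
    qed
    show "1 / P \<le> ?q" "?q \<le> 1" using set_average_bounds[OF st(2) int le] by auto
  qed
  moreover have m: "mean_exponent p {s..t} = 1 / ?q" using q by (metis div_by_1 divide_divide_eq_right mult_1)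
  have "0 < ?q" using \<open>1 / P \<le> ?q\<close> P(1) by (smt (verit) divide_pos_pos)
  moreover have "1 \<le> 1 / q" "1 / q \<le> P" if "1 / P \<le> q" "q \<le> 1" "0 < q" for q
    using that P(1) by (auto simp: field_simps)
  ultimately show "1 \<le> mean_exponent p {s..t}" "mean_exponent p {s..t} \<le> P"
    unfolding m by blast+
  assume x: "x \<in> {s..t}"
  let ?e = "c / ln (exp 1 + 1 / (t - s))"
  have le: "1 / p x - ?e \<le> 1 / p y \<and> 1 / p y \<le> 1 / p x + ?e" if y: "y \<in> {s..t}" for y
  proof (cases "x = y")
    case True
    have "0 \<le> ln (exp 1 + 1 / (t - s))" using st by (intro ln_ge_zero) (auto intro: add_increasing2)
    then show ?thesis using True c(1) by simp
  next
    case False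
    have "ln (exp 1 + 1 / (t - s)) \<le> ln (exp 1 + 1 / \<bar>x - y\<bar>)"
      using x y st False by (intro ln_mono add_left_mono divide_left_mono) (auto intro: add_pos_pos)
    moreover have "0 < ln (exp 1 + 1 / (t - s))"
    proof -
      have "1 < exp (1::real)" "0 < 1 / (t - s)" using st by auto
      then show ?thesis by (intro ln_gt_zero) linarith
    qed
    ultimately have "c / ln (exp 1 + 1 / \<bar>x - y\<bar>) \<le> ?e"
      using c(1) by (intro divide_left_mono) auto
    then show ?thesis using c(2)[rule_format, of x y] subsetD[OF sub x] subsetD[OF sub y] False
      by (simp add: abs_le_iff)
  qed
  then have "AE y in lebesgue. y \<in> {s..t} \<longrightarrow> 1 / p x - ?e \<le> 1 / p y \<and> 1 / p y \<le> 1 / p x + ?e"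
    by (intro AE_I2) auto
  from set_average_bounds[OF st(2) int this]
  show "\<bar>1 / mean_exponent p {s..t} - 1 / p x\<bar> \<le> ?e"
    unfolding q by linarith
qed

text \<open>The weight has positive mass on the interval, so an infinite dual norm would make the product in
  the Muckenhoupt condition infinite.\<close>
lemma dual_norm_finite:
  assumes w: "is_weight \<omega>"
    and A: "weight_mass \<omega> {s..t} / ennreal m * dual_norm p \<omega> {s..t} \<le> ennreal A" and "s < t"
  obtains l where "0 < l" "(\<integral>\<^sup>+x\<in>{s..t}. dual_integrand p \<omega> l x \<partial>lebesgue) \<le> 1"
proof -
  have wm: "\<omega> \<in> borel_measurable lebesgue" and wpos: "AE x in lebesgue. 0 < \<omega> x"
    using w by (auto simp: is_weight_def)
  have ne: "weight_mass \<omega> {s..t} \<noteq> 0"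
  proof
    assume "weight_mass \<omega> {s..t} = 0"
    moreover have "(\<lambda>x. \<omega> x * indicator {s..t} x) \<in> borel_measurable lebesgue"
      using wm by (intro borel_measurable_times_ennreal borel_measurable_indicator) auto
    ultimately have "AE x in lebesgue. \<omega> x * indicator {s..t} x = 0"
      by (simp add: nn_integral_0_iff_AE)
    with wpos have "AE x in lebesgue. x \<notin> {s..t}"
      by eventually_elim (auto simp: indicator_def split: if_splits)
    then have "{s..t} \<in> null_sets lebesgue"
      by (subst AE_iff_null_sets) auto
    then show False using \<open>s < t\<close> by (simp add: null_sets_def)
  qed
  have "dual_norm p \<omega> {s..t} \<noteq> \<infinity>"
  proof
    assume inf: "dual_norm p \<omega> {s..t} = \<infinity>"
    have "weight_mass \<omega> {s..t} / ennreal m \<noteq> 0"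
      using ne by (simp add: divide_ennreal_def)
    then show False using A inf by (auto simp: ennreal_mult_eq_top_iff top_unique)
  qed
  then have "dual_norm p \<omega> {s..t} < \<infinity>" by (simp add: less_top)
  then show thesis
    unfolding local_norm_def Inf_less_iff using that by blast
qed

lemma holder_integrand_measurable:
  assumes "p \<in> borel_measurable (lebesgue_on torus)" "f \<in> borel_measurable lebesgue"
    "B \<in> sets lebesgue" "B \<subseteq> torus"
  shows "(\<lambda>x. ennreal (\<bar>f x\<bar> * l powr (- (1 / p x))) * indicator B x) \<in> borel_measurable lebesgue"
proof -
  have [measurable]: "torus \<in> sets lebesgue" by (simp add: torus_def)
  have [measurable]: "B \<in> sets lebesgue" "f \<in> borel_measurable lebesgue" using assms by auto
  let ?p = "\<lambda>x. indicator torus x *\<^sub>R p x"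
  have [measurable]: "?p \<in> borel_measurable lebesgue"
    using assms(1) by (subst borel_measurable_restrict_space_iff[symmetric]) auto
  have "(\<lambda>x. ennreal (\<bar>f x\<bar> * l powr (- (1 / ?p x))) * indicator B x) \<in> borel_measurable lebesgue"
    by measurable
  then show ?thesis
    by (rule measurable_cong[THEN iffD1, rotated]) (use assms(4) in \<open>auto simp: indicator_def\<close>)
qed

text \<open>Hoelder's inequality on the whole torus for functions of modular at most \<open>1\<close>; a common bound
  \<open>k\<close> of all powers \<open>l powr (1 / p x)\<close> removes the variable power.\<close>
lemma integral_le_of_dual_modular:
  assumes p: "p \<in> exponents" and w: "is_weight \<omega>"
    and l: "0 < l" "(\<integral>\<^sup>+x\<in>torus. dual_integrand p \<omega> l x \<partial>lebesgue) \<le> 1"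
    and f: "f \<in> borel_measurable lebesgue" "modular p \<omega> f \<le> 1"
    and k: "0 < k" "AE x in lebesgue. x \<in> torus \<longrightarrow> l powr (1 / p x) \<le> k"
  shows "abs_integral torus f \<le> ennreal (2 * k)"
proof -
  note p1 = exponentsD(1)[OF p] and pm = exponentsD(2)[OF p]
  let ?F = "\<lambda>x. ennreal (\<bar>f x\<bar> * (1 * l) powr (- (1 / p x)))"
  have le2: "(\<integral>\<^sup>+x\<in>torus. ?F x \<partial>lebesgue) \<le> 2"
    using l f(2)[unfolded modular_def] by (intro holder_modular[OF p1 pm f(1) w]) (auto simp: torus_def)
  have "abs_integral torus f \<le> (\<integral>\<^sup>+x. ennreal k * (?F x * indicator torus x) \<partial>lebesgue)"
  proof (rule nn_integral_mono_AE)
    show "AE x in lebesgue. ennreal \<bar>f x\<bar> * indicator torus x \<le> ennreal k * (?F x * indicator torus x)"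
      using k(2)
    proof eventually_elim
      case (elim x)
      show ?case
      proof (cases "x \<in> torus")
        case True
        then have "1 \<le> k * l powr (- (1 / p x))"
          using l(1) elim by (simp add: powr_minus field_simps)
        then have "\<bar>f x\<bar> * 1 \<le> \<bar>f x\<bar> * (k * l powr (- (1 / p x)))" by (intro mult_left_mono) auto
        then have "ennreal \<bar>f x\<bar> \<le> ennreal (k * (\<bar>f x\<bar> * (1 * l) powr (- (1 / p x))))"
          by (intro ennreal_leI) (simp add: mult_ac)
        then show ?thesis
          using True k(1) by (subst (asm) ennreal_mult) auto
      qed simp
    qed
  qed
  also have "\<dots> = ennreal k * (\<integral>\<^sup>+x\<in>torus. ?F x \<partial>lebesgue)"
    by (intro nn_integral_cmult holder_integrand_measurable[OF pm f(1)]) (auto simp: torus_def)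
  also have "\<dots> \<le> ennreal k * 2"
    by (intro mult_left_mono le2) simp
  also have "\<dots> = ennreal (2 * k)"
    using k(1) by (simp add: ennreal_mult mult.commute)
  finally show ?thesis .
qed

lemma integral_le_of_modular:
  assumes p: "p \<in> exponents" and A: "\<omega> \<in> muckenhoupt p"
  obtains C where "1 \<le> C"
    and "\<And>f. f \<in> borel_measurable lebesgue \<Longrightarrow> modular p \<omega> f \<le> 1 \<Longrightarrow>
      abs_integral torus f \<le> ennreal C"
proof -
  note p1 = exponentsD(1)[OF p] and pm = exponentsD(2)[OF p]
  obtain a where "0 < a" and w: "is_weight \<omega>" and a: "muckenhoupt_bound p \<omega> a"
    by (rule muckenhouptE[OF A])
  have pi2: "- pi < pi" using pi_gt_zero by linarith
  have "weight_mass \<omega> {-pi..pi} / ennreal ((pi - (-pi)) powr mean_exponent p {-pi..pi}) *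
      dual_norm p \<omega> {-pi..pi} \<le> ennreal a"
    using a pi2 by blast
  note fin = dual_norm_finite[OF w this pi2]
  obtain l where l: "0 < l" "(\<integral>\<^sup>+x\<in>torus. dual_integrand p \<omega> l x \<partial>lebesgue) \<le> 1"
    unfolding torus_def by (rule fin)
  have "l powr (1 / p x) \<le> max 1 l" if "x \<in> torus" for x
  proof -
    have "l powr (1 / p x) \<le> max 1 l powr (1 / p x)"
      using l(1) p1[OF that] by (intro powr_mono2) auto
    also have "\<dots> \<le> max 1 l powr 1" using p1[OF that] by (intro powr_mono) auto
    finally show ?thesis by simp
  qed
  then have "abs_integral torus f \<le> ennreal (2 * max 1 l)"
    if "f \<in> borel_measurable lebesgue" "modular p \<omega> f \<le> 1" for f
    by (intro integral_le_of_dual_modular[OF p w l that]) auto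
  then show thesis by (intro that[of "2 * max 1 l"]) auto
qed

text \<open>If the weight is not integrable, the Muckenhoupt condition forces the dual norm of the torus to
  vanish. Hoelder's inequality then holds with arbitrarily small \<open>l\<close>, and \<open>f\<close> must vanish almost
  everywhere. This disposes of the weight that is infinite almost everywhere.\<close>
lemma integral_eq_0_of_modular:
  assumes p: "p \<in> exponents" and A: "\<omega> \<in> muckenhoupt p"
    and inf: "weight_mass \<omega> torus = \<infinity>"
    and f: "f \<in> borel_measurable lebesgue" "modular p \<omega> f \<le> 1"
  shows "abs_integral torus f = 0"
proof -
  note p1 = exponentsD(1)[OF p] and pm = exponentsD(2)[OF p]
  obtain P where P: "1 \<le> P" "AE x in lebesgue. x \<in> torus \<longrightarrow> p x \<le> P"
    by (rule exponents_AE_bound[OF p])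
  obtain a where "0 < a" and w: "is_weight \<omega>" and a: "muckenhoupt_bound p \<omega> a"
    by (rule muckenhouptE[OF A])
  have pi2: "- pi < pi" using pi_gt_zero by linarith
  have "weight_mass \<omega> {-pi..pi} / ennreal ((pi - (-pi)) powr mean_exponent p {-pi..pi}) *
      dual_norm p \<omega> {-pi..pi} \<le> ennreal a"
    using a pi2 by blast
  moreover have "weight_mass \<omega> {-pi..pi} = top"
    using inf by (simp add: torus_def)
  ultimately have "top / ennreal ((pi - (-pi)) powr mean_exponent p {-pi..pi}) * dual_norm p \<omega> torus \<le> ennreal a"
    by (simp only: torus_def)
  then have "top * dual_norm p \<omega> torus \<le> ennreal a"
    by (simp add: divide_ennreal_def ennreal_top_mult)
  then have "dual_norm p \<omega> torus = 0"
    by (simp add: ennreal_top_mult top_unique split: if_splits)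
  then have lt: "dual_norm p \<omega> torus < ennreal d" if "0 < d" for d using that by simp
  have small: "\<exists>l. 0 < l \<and> l < d \<and> (\<integral>\<^sup>+x\<in>torus. dual_integrand p \<omega> l x \<partial>lebesgue) \<le> 1" if d: "0 < d" for d
  proof -
    obtain l where "0 < l" "ennreal l < ennreal d" "(\<integral>\<^sup>+x\<in>torus. dual_integrand p \<omega> l x \<partial>lebesgue) \<le> 1"
      using lt[OF d] unfolding local_norm_def Inf_less_iff by blast
    then show ?thesis by (intro exI[of _ l]) (simp add: ennreal_less_iff)
  qed
  have "abs_integral torus f \<le> 0 + ennreal e" if "0 < e" for e :: real
  proof -
    \<comment> \<open>If \<open>l < d\<close>, almost every power \<open>l powr (1 / p x)\<close> is at most \<open>e / 2\<close>.\<close>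
    define d where "d = min 1 ((e / 2) powr P)"
    have "0 < d" using \<open>0 < e\<close> by (simp add: d_def)
    then obtain l where l: "0 < l" "l < d" "(\<integral>\<^sup>+x\<in>torus. dual_integrand p \<omega> l x \<partial>lebesgue) \<le> 1"
      using small by blast
    have "l powr (1 / P) \<le> ((e / 2) powr P) powr (1 / P)"
      using l P(1) by (intro powr_mono2) (auto simp: d_def)
    also have "\<dots> = e / 2" using P(1) \<open>0 < e\<close> by (simp add: powr_powr)
    finally have lP: "l powr (1 / P) \<le> e / 2" .
    have "AE x in lebesgue. x \<in> torus \<longrightarrow> l powr (1 / p x) \<le> e / 2"
      using P(2)
    proof eventually_elim
      case (elim x)
      have "l powr (1 / p x) \<le> l powr (1 / P)" if "x \<in> torus"
        using l P(1) p1[OF that] elim that by (intro powr_mono') (auto simp: d_def field_simps)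
      then show ?case using lP by auto
    qed
    then have "abs_integral torus f \<le> ennreal (2 * (e / 2))"
      using \<open>0 < e\<close> by (intro integral_le_of_dual_modular[OF p w l(1,3) f]) auto
    then show ?thesis by simp
  qed
  from ennreal_le_epsilon[OF this] have "abs_integral torus f \<le> 0"
    by this
  then show ?thesis by simp
qed

text \<open>If \<open>s * l\<close> were less than \<open>k\<close>, its negative powers would exceed those of \<open>k\<close>, hence \<open>3 / I\<close>, and
  Hoelder's inequality would bound \<open>3\<close> by \<open>2\<close>. The argument is by contradiction, as
  \<open>s\<close> and \<open>l\<close> may be arbitrarily small and their powers cannot be compared directly.\<close>
lemma local_dual_bound:
  fixes k :: real
  assumes p1: "\<And>x. x \<in> torus \<Longrightarrow> 1 \<le> p x" and pm: "p \<in> borel_measurable (lebesgue_on torus)"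
    and f: "f \<in> borel_measurable lebesgue" and w: "is_weight \<omega>"
    and B: "B \<in> sets lebesgue" "B \<subseteq> torus"
    and "0 < s" "0 < l"
    and F: "modular_on p \<omega> B f \<le> ennreal s"
    and dual: "(\<integral>\<^sup>+x\<in>B. dual_integrand p \<omega> l x \<partial>lebesgue) \<le> 1"
    and I: "abs_integral B f = ennreal I" "0 < I"
    and "0 < k"
    and lower: "AE x in lebesgue. x \<in> B \<longrightarrow> 3 / I \<le> k powr (- (1 / p x))"
  shows "k \<le> s * l"
proof (rule ccontr)
  assume "\<not> k \<le> s * l"
  then have lt: "s * l < k" by simp
  have le2: "(\<integral>\<^sup>+x\<in>B. ennreal (\<bar>f x\<bar> * (s * l) powr (- (1 / p x))) \<partial>lebesgue) \<le> 2"
    by (rule holder_modular[OF p1 pm f w B \<open>0 < s\<close> \<open>0 < l\<close> F dual])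
  have "ennreal 3 = ennreal (3 / I) * ennreal I"
    using I(2) by (subst ennreal_mult[symmetric]) auto
  also have "\<dots> = (\<integral>\<^sup>+x. ennreal (3 / I) * (ennreal \<bar>f x\<bar> * indicator B x) \<partial>lebesgue)"
    using f B(1) unfolding I(1)[symmetric]
    by (intro nn_integral_cmult[symmetric] borel_measurable_times_ennreal borel_measurable_indicator) auto
  also have "\<dots> \<le> (\<integral>\<^sup>+x\<in>B. ennreal (\<bar>f x\<bar> * (s * l) powr (- (1 / p x))) \<partial>lebesgue)"
  proof (rule nn_integral_mono_AE)
    show "AE x in lebesgue. ennreal (3 / I) * (ennreal \<bar>f x\<bar> * indicator B x) \<le>
        ennreal (\<bar>f x\<bar> * (s * l) powr (- (1 / p x))) * indicator B x"
      using lower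
    proof eventually_elim
      case (elim x)
      show ?case
      proof (cases "x \<in> B")
        case True
        have "k powr (- (1 / p x)) \<le> (s * l) powr (- (1 / p x))"
          using p1[of x] True B(2) lt \<open>0 < s\<close> \<open>0 < l\<close> by (intro powr_mono2') (auto simp: subset_iff)
        then have "3 / I \<le> (s * l) powr (- (1 / p x))" using elim True by simp
        then have "3 / I * \<bar>f x\<bar> \<le> (s * l) powr (- (1 / p x)) * \<bar>f x\<bar>"
          by (rule mult_right_mono) simp
        then show ?thesis
          using True I(2) by (simp add: ennreal_mult[symmetric] ennreal_leI mult.commute)
      qed simp
    qed
  qed
  also have "\<dots> \<le> ennreal 2" using le2 by simp
  finally show False by (simp only: ennreal_le_iff)
qed

text \<open>The constant \<open>k = (3 * exp (P * E)) powr (- P) * I powr b\<close> is chosen so that its power is at least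
  \<open>3 * exp (P * E)\<close> times \<open>I powr (- (b / p))\<close>; replacing the exponent \<open>b / p\<close> by \<open>1\<close> costs
  a factor of at most \<open>exp (P * E)\<close>.\<close>
lemma powr_compare_lower:
  fixes p b P I E e :: real
  assumes p: "1 \<le> p" "p \<le> P" and b: "1 \<le> b" "b \<le> P" and "0 < I"
    and E: "0 \<le> E" "\<bar>ln I\<bar> * e \<le> E" and e: "\<bar>1 / b - 1 / p\<bar> \<le> e"
  shows "3 / I \<le> ((3 * exp (P * E)) powr (- P) * I powr b) powr (- (1 / p))"
proof -
  let ?D = "3 * exp (P * E)"
  have "0 \<le> P * E" using p E by simp
  then have D: "1 \<le> ?D" using one_le_exp_iff[of "P * E"] by linarith
  have eq: "(?D powr (- P) * I powr b) powr (- (1 / p)) = ?D powr (P / p) * I powr (- (b / p))"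
    using \<open>0 < I\<close> by (simp add: powr_mult powr_powr)
  have "?D powr 1 \<le> ?D powr (P / p)"
    using D p by (intro powr_mono) auto
  then have 1: "?D \<le> ?D powr (P / p)" by simp
  have "1 - b / p = b * (1 / b - 1 / p)" using p b by (simp add: field_simps)
  then have "\<bar>ln I * (1 - b / p)\<bar> = b * (\<bar>ln I\<bar> * \<bar>1 / b - 1 / p\<bar>)"
    using b by (simp add: abs_mult)
  also have "\<dots> \<le> P * (\<bar>ln I\<bar> * e)"
    using b e p by (intro mult_mono mult_left_mono) auto
  also have "\<dots> \<le> P * E" using p E by (intro mult_left_mono) auto
  finally have "- (P * E) - ln I \<le> - (b / p) * ln I" by (simp add: algebra_simps)
  then have "exp (- (P * E) - ln I) \<le> I powr (- (b / p))"
    using \<open>0 < I\<close> by (simp add: powr_def)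
  moreover have "exp (- (P * E) - ln I) = 1 / (exp (P * E) * I)"
    using \<open>0 < I\<close> by (simp add: exp_diff exp_minus divide_inverse)
  ultimately have 2: "1 / (exp (P * E) * I) \<le> I powr (- (b / p))" by simp
  have "3 / I = ?D * (1 / (exp (P * E) * I))" by simp
  also have "\<dots> \<le> ?D powr (P / p) * I powr (- (b / p))"
    using 1 2 \<open>0 < I\<close> by (intro mult_mono) auto
  finally show ?thesis unfolding eq .
qed

lemma powr_compare_upper:
  fixes p b P a E e :: real
  assumes p: "1 \<le> p" "p \<le> P" and b: "1 \<le> b" "b \<le> P" and "1 < a"
    and E: "ln a * e \<le> E" and e: "\<bar>1 / b - 1 / p\<bar> \<le> e"
  shows "a powr p \<le> exp (P * P * E) * a powr b"
proof -
  have "0 \<le> ln a" using \<open>1 < a\<close> by simp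
  have "p - b = p * b * (1 / b - 1 / p)" using p b by (simp add: field_simps)
  also have "\<dots> \<le> p * b * e" using p b e by (intro mult_left_mono) auto
  also have "\<dots> \<le> P * P * e" using p b e by (intro mult_mono) auto
  finally have "ln a * (p - b) \<le> ln a * (P * P * e)"
    using \<open>0 \<le> ln a\<close> by (intro mult_left_mono)
  also have "\<dots> = P * P * (ln a * e)" by simp
  also have "\<dots> \<le> P * P * E" using E p by (intro mult_left_mono) auto
  finally have "p * ln a \<le> P * P * E + b * ln a" by (simp add: algebra_simps)
  then have "exp (p * ln a) \<le> exp (P * P * E + b * ln a)" by simp
  then show ?thesis
    using \<open>1 < a\<close> by (simp add: powr_def exp_add)
qed

text \<open>This is where the Muckenhoupt condition and log-Hoelder continuity meet. Let \<open>I\<close> be the integral of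
  \<open>\<bar>f\<bar>\<close> over an interval of length \<open>L\<close>, and \<open>b\<close> the mean exponent. As the average \<open>I / L\<close> exceeds \<open>1\<close>,
  the number \<open>I\<close> lies between \<open>L\<close> and a constant, so \<open>p x\<close> may be replaced by \<open>b\<close> in powers of \<open>I\<close>
  and of \<open>I / L\<close>. Hoelder's inequality then gives \<open>I powr b \<le> const * \<sigma> * dual_norm\<close>, and the
  Muckenhoupt condition for the interval turns this into the claim, as for a constant exponent.\<close>
lemma local_modular_bound:
  assumes p: "p \<in> log_exponents" and Ap: "\<omega> \<in> muckenhoupt p"
  obtains K where "0 \<le> K"
    and "\<forall>f s t \<sigma> I. f \<in> borel_measurable lebesgue \<longrightarrow> modular p \<omega> f \<le> 1 \<longrightarrow>
      -pi \<le> s \<longrightarrow> s < t \<longrightarrow> t \<le> pi \<longrightarrow> 0 < \<sigma> \<longrightarrow>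
      modular_on p \<omega> {s..t} f \<le> ennreal \<sigma> \<longrightarrow>
      abs_integral {s..t} f = ennreal I \<longrightarrow> t - s < I \<longrightarrow>
      (\<integral>\<^sup>+x\<in>{s..t}. ennreal ((I / (t - s)) powr p x) * \<omega> x \<partial>lebesgue) \<le> ennreal (K * \<sigma>)"
proof -
  have pe: "p \<in> exponents" using p by (simp add: log_exponents_def)
  note p1 = exponentsD(1)[OF pe] and pm = exponentsD(2)[OF pe]
  obtain c where c: "0 < c" "\<forall>x\<in>torus. \<forall>y\<in>torus. x \<noteq> y \<longrightarrow>
      \<bar>1 / p x - 1 / p y\<bar> \<le> c / ln (exp 1 + 1 / \<bar>x - y\<bar>)"
    using p unfolding log_exponents_def by blast
  obtain P where P: "1 \<le> P" "AE x in lebesgue. x \<in> torus \<longrightarrow> p x \<le> P"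
    by (rule exponents_AE_bound[OF pe])
  obtain A where "0 < A" and w: "is_weight \<omega>" and A: "muckenhoupt_bound p \<omega> A"
    by (rule muckenhouptE[OF Ap])
  have wm: "\<omega> \<in> borel_measurable lebesgue" using w by (simp add: is_weight_def)
  obtain C where C: "1 \<le> C" "\<And>f. f \<in> borel_measurable lebesgue \<Longrightarrow> modular p \<omega> f \<le> 1 \<Longrightarrow>
      abs_integral torus f \<le> ennreal C"
    using integral_le_of_modular[OF pe Ap] by blast
  define E where "E = c * (1 + ln C)"
  have "0 \<le> E" using c(1) C(1) by (simp add: E_def)
  \<comment> \<open>The reciprocal of the constant in the estimate of \<open>I powr b\<close> by Hoelder's inequality.\<close>
  define \<kappa> where "\<kappa> = (3 * exp (P * E)) powr (- P)"
  have "0 < \<kappa>" by (simp add: \<kappa>_def)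
  define K where "K = exp (P * P * E) * (A / \<kappa>)"
  have "(\<integral>\<^sup>+x\<in>{s..t}. ennreal ((I / (t - s)) powr p x) * \<omega> x \<partial>lebesgue) \<le> ennreal (K * \<sigma>)"
    if f: "f \<in> borel_measurable lebesgue" "modular p \<omega> f \<le> 1"
      and st: "-pi \<le> s" "s < t" "t \<le> pi" and "0 < \<sigma>"
      and F: "modular_on p \<omega> {s..t} f \<le> ennreal \<sigma>"
      and I: "abs_integral {s..t} f = ennreal I" and LI: "t - s < I"
    for f s t \<sigma> I
  proof -
    let ?b = "mean_exponent p {s..t}" and ?L = "t - s" and ?e = "c / ln (exp 1 + 1 / (t - s))"
    have sub: "{s..t} \<subseteq> torus" using st by (auto simp: torus_def)
    note b = mean_exponent_bounds(1,2)[OF pe P c st] and osc = mean_exponent_bounds(3)[OF pe P c st]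
    have "0 < I" using LI st by linarith
    have "ennreal I \<le> ennreal C"
      unfolding I[symmetric] using sub
      by (intro order_trans[OF _ C(2)[OF f]] nn_integral_mono) (auto simp: indicator_def)
    then have "I \<le> C" using C(1) by (simp add: ennreal_le_iff)
    have E1: "\<bar>ln I\<bar> * ?e \<le> E" and E2: "ln (I / ?L) * ?e \<le> E"
      unfolding E_def using st LI \<open>I \<le> C\<close>
      by (intro log_modulus_absorbs_ln[OF c(1) C(1)]; simp)+
    have dual: "ennreal (\<kappa> * I powr ?b / \<sigma>) \<le> dual_norm p \<omega> {s..t}"
      unfolding local_norm_def
    proof (rule Inf_greatest, clarify)
      fix l :: real assume l: "0 < l" "(\<integral>\<^sup>+x\<in>{s..t}. dual_integrand p \<omega> l x \<partial>lebesgue) \<le> 1"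
      have "AE x in lebesgue. x \<in> {s..t} \<longrightarrow> 3 / I \<le> (\<kappa> * I powr ?b) powr (- (1 / p x))"
        using P(2)
      proof eventually_elim
        case (elim x)
        show ?case
        proof
          assume x: "x \<in> {s..t}"
          then have "x \<in> torus" using sub by blast
          show "3 / I \<le> (\<kappa> * I powr ?b) powr (- (1 / p x))"
            unfolding \<kappa>_def
            by (rule powr_compare_lower[OF p1[OF \<open>x \<in> torus\<close>] _ b \<open>0 < I\<close> \<open>0 \<le> E\<close> E1 osc[OF x]])
              (use elim \<open>x \<in> torus\<close> in simp)
        qed
      qed
      then have "\<kappa> * I powr ?b \<le> \<sigma> * l"
        by (intro local_dual_bound[OF p1 pm f(1) w _ sub \<open>0 < \<sigma>\<close> l(1) F l(2) I \<open>0 < I\<close>])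
          (use \<open>0 < \<kappa>\<close> \<open>0 < I\<close> in auto)
      then show "ennreal (\<kappa> * I powr ?b / \<sigma>) \<le> ennreal l"
        using \<open>0 < \<sigma>\<close> by (intro ennreal_leI) (simp add: divide_le_eq mult.commute)
    qed
    let ?w = "weight_mass \<omega> {s..t}"
    have "?w * ennreal ((I / ?L) powr ?b) \<le> ennreal (A * \<sigma> / \<kappa>)"
    proof -
      have "?w * ennreal ((I / ?L) powr ?b) =
          ennreal (\<sigma> / \<kappa>) * (?w / ennreal (?L powr ?b) * ennreal (\<kappa> * I powr ?b / \<sigma>))"
      proof -
        have "(I / ?L) powr ?b = I powr ?b / ?L powr ?b" by (rule powr_divide)
        also have "\<dots> = \<sigma> / \<kappa> * (inverse (?L powr ?b) * (\<kappa> * I powr ?b / \<sigma>))"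
          using \<open>0 < \<sigma>\<close> \<open>0 < \<kappa>\<close> by (simp add: field_simps)
        finally have "ennreal ((I / ?L) powr ?b) =
            ennreal (\<sigma> / \<kappa>) * (ennreal (inverse (?L powr ?b)) * ennreal (\<kappa> * I powr ?b / \<sigma>))"
          using \<open>0 < \<sigma>\<close> \<open>0 < \<kappa>\<close> by (simp add: ennreal_mult[symmetric])
        moreover have "?w / ennreal (?L powr ?b) = ?w * ennreal (inverse (?L powr ?b))"
          using st by (simp add: divide_ennreal_def inverse_ennreal)
        ultimately show ?thesis by (simp only: mult_ac)
      qed
      also have "\<dots> \<le> ennreal (\<sigma> / \<kappa>) * (?w / ennreal (?L powr ?b) * dual_norm p \<omega> {s..t})"
        by (intro mult_left_mono dual) auto
      also have "\<dots> \<le> ennreal (\<sigma> / \<kappa>) * ennreal A"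
        using A st by (intro mult_left_mono) auto
      also have "\<dots> = ennreal (A * \<sigma> / \<kappa>)"
        using \<open>0 < \<sigma>\<close> \<open>0 < \<kappa>\<close> \<open>0 < A\<close> by (simp add: ennreal_mult[symmetric] mult.commute)
      finally show ?thesis .
    qed
    note wb = this
    have "(\<integral>\<^sup>+x\<in>{s..t}. ennreal ((I / ?L) powr p x) * \<omega> x \<partial>lebesgue) \<le>
        (\<integral>\<^sup>+x. ennreal (exp (P * P * E) * (I / ?L) powr ?b) * (\<omega> x * indicator {s..t} x) \<partial>lebesgue)"
    proof (rule nn_integral_mono_AE)
      show "AE x in lebesgue. ennreal ((I / ?L) powr p x) * \<omega> x * indicator {s..t} x \<le>
          ennreal (exp (P * P * E) * (I / ?L) powr ?b) * (\<omega> x * indicator {s..t} x)"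
        using P(2)
      proof eventually_elim
        case (elim x)
        show ?case
        proof (cases "x \<in> {s..t}")
          case True
          have "(I / ?L) powr p x \<le> exp (P * P * E) * (I / ?L) powr ?b"
            by (rule powr_compare_upper[OF _ _ b _ E2 osc[OF True]])
              (use True sub elim p1[of x] LI st in \<open>simp_all add: subset_iff\<close>)
          then show ?thesis using True by (simp add: mult_right_mono ennreal_leI)
        qed simp
      qed
    qed
    also have "\<dots> = ennreal (exp (P * P * E) * (I / ?L) powr ?b) * ?w"
      using wm by (intro nn_integral_cmult borel_measurable_times_ennreal borel_measurable_indicator) auto
    also have "\<dots> = ennreal (exp (P * P * E)) * (?w * ennreal ((I / ?L) powr ?b))"
      by (simp add: ennreal_mult mult_ac)
    also have "\<dots> \<le> ennreal (exp (P * P * E)) * ennreal (A * \<sigma> / \<kappa>)"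
      by (intro mult_left_mono wb) auto
    also have "\<dots> = ennreal (K * \<sigma>)"
      using \<open>0 < \<sigma>\<close> \<open>0 < \<kappa>\<close> \<open>0 < A\<close> by (simp add: K_def ennreal_mult[symmetric] mult_ac)
    finally show ?thesis .
  qed
  moreover have "0 \<le> K" using \<open>0 < A\<close> \<open>0 < \<kappa>\<close> by (simp add: K_def)
  ultimately show thesis by (intro that[of K]) auto
qed

text \<open>The half-open intervals of the partition of the torus into \<open>N\<close> equal parts; they miss only the
  right end point.\<close>
definition cell :: "nat \<Rightarrow> nat \<Rightarrow> real set" where
  "cell N i = {-pi + real i * (2 * pi / real N) ..< -pi + real (Suc i) * (2 * pi / real N)}"

lemma cell_measurable [simp]: "cell N i \<in> sets lebesgue"
  by (simp add: cell_def)

lemma cell_unique: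
  assumes "x \<in> cell N i" "x \<in> cell N j"
  shows "i = j"
proof -
  let ?d = "2 * pi / real N"
  have "real i * ?d < real (Suc j) * ?d" "real j * ?d < real (Suc i) * ?d"
    using assms by (auto simp: cell_def)
  moreover have "0 \<le> ?d" by simp
  ultimately have "real i < real (Suc j)" "real j < real (Suc i)"
    by (meson mult_less_cancel_right not_less_iff_gr_or_eq order_less_le_trans mult_less_cancel_right_disj)+
  then show ?thesis by simp
qed

lemma indicator_cell:
  assumes "x \<in> cell N i"
  shows "indicator (cell N j) x = (if j = i then 1 else 0)"
  using assms cell_unique[OF assms, of j] by (cases "j = i") (auto simp: indicator_def)

lemma cell_bounds:
  assumes "i < N"
  shows "-pi \<le> -pi + real i * (2 * pi / real N)" "-pi + real (Suc i) * (2 * pi / real N) \<le> pi"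
    "cell N i \<subseteq> torus"
proof -
  have "real (Suc i) / real N \<le> 1" using assms by (simp add: divide_le_eq)
  then have "2 * pi * (real (Suc i) / real N) \<le> 2 * pi * 1" by (intro mult_left_mono) auto
  then have *: "real (Suc i) * (2 * pi / real N) \<le> 2 * pi" by (simp add: mult_ac)
  then show b: "-pi \<le> -pi + real i * (2 * pi / real N)" "-pi + real (Suc i) * (2 * pi / real N) \<le> pi"
    by simp_all
  show "cell N i \<subseteq> torus"
  proof
    fix x assume "x \<in> cell N i"
    then have "-pi + real i * (2 * pi / real N) \<le> x" "x < -pi + real (Suc i) * (2 * pi / real N)"
      by (simp_all only: cell_def atLeastLessThan_iff)
    with b show "x \<in> torus" by (simp only: torus_def atLeastAtMost_iff) linarith
  qed
qed

lemma cell_cover: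
  assumes "1 \<le> N" "-pi \<le> x" "x < pi"
  obtains i where "i < N" "x \<in> cell N i"
proof -
  let ?d = "2 * pi / real N"
  have d: "0 < ?d" using assms by simp
  define i where "i = nat \<lfloor>(x + pi) / ?d\<rfloor>"
  have nn: "0 \<le> (x + pi) / ?d" using assms d by (intro divide_nonneg_pos) auto
  then have i: "real i \<le> (x + pi) / ?d" "(x + pi) / ?d < real i + 1"
    unfolding i_def by simp_all
  then have "real i * ?d \<le> x + pi" "x + pi < (real i + 1) * ?d"
    using d by (simp_all only: pos_le_divide_eq pos_divide_less_eq)
  then have x: "x \<in> cell N i" by (auto simp: cell_def add.commute)
  have "real i * ?d < 2 * pi" using \<open>real i * ?d \<le> x + pi\<close> assms by linarith
  then have "real i * (2 * pi) < real N * (2 * pi)"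
    using assms by (simp add: field_simps)
  then have "i < N" by simp
  with x show thesis using that by blast
qed

lemma nn_integral_half_open: "(\<integral>\<^sup>+x\<in>{s..<t}. g x \<partial>lebesgue) = (\<integral>\<^sup>+x\<in>{s..t::real}. g x \<partial>lebesgue)"
proof (rule nn_integral_cong_AE)
  have "AE x in lebesgue. x \<noteq> t" by (intro AE_not_in[of "{t}", simplified]) simp
  then show "AE x in lebesgue. g x * indicator {s..<t} x = g x * indicator {s..t} x"
    by eventually_elim (auto simp: indicator_def)
qed

lemma sum_cell_integrals_le:
  assumes "(\<lambda>x. g x * indicator torus x) \<in> borel_measurable lebesgue"
  shows "(\<Sum>i<N. \<integral>\<^sup>+x\<in>cell N i. g x \<partial>lebesgue) \<le> (\<integral>\<^sup>+x\<in>torus. g x \<partial>lebesgue)"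
proof -
  have eq: "(\<lambda>x. g x * indicator (cell N i) x) = (\<lambda>x. (g x * indicator torus x) * indicator (cell N i) x)"
    if "i < N" for i
    using cell_bounds(3)[OF that] by (auto simp: fun_eq_iff split: split_indicator)
  have m: "(\<lambda>x. g x * indicator (cell N i) x) \<in> borel_measurable lebesgue" if "i < N" for i
    unfolding eq[OF that]
    by (intro borel_measurable_times_ennreal assms borel_measurable_indicator cell_measurable)
  have "(\<Sum>i<N. \<integral>\<^sup>+x\<in>cell N i. g x \<partial>lebesgue) = (\<integral>\<^sup>+x. (\<Sum>i<N. g x * indicator (cell N i) x) \<partial>lebesgue)"
    using m by (subst nn_integral_sum) auto
  also have "\<dots> \<le> (\<integral>\<^sup>+x\<in>torus. g x \<partial>lebesgue)"
  proof (rule nn_integral_mono)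
    fix x
    show "(\<Sum>i<N. g x * indicator (cell N i) x) \<le> g x * indicator torus x"
    proof (cases "\<exists>j<N. x \<in> cell N j")
      case True
      then obtain j where j: "j < N" "x \<in> cell N j" by blast
      have "(\<Sum>i<N. g x * indicator (cell N i) x) = (\<Sum>i<N. if i = j then g x else 0)"
        unfolding indicator_cell[OF j(2)] by (intro sum.cong) auto
      also have "\<dots> = g x" using j(1) by simp
      finally show ?thesis using cell_bounds(3)[OF j(1)] j(2) by (auto simp: indicator_def)
    next
      case False
      then have "(\<Sum>i<N. g x * indicator (cell N i) x) = 0" by (intro sum.neutral) auto
      then show ?thesis by (simp only: zero_le)
    qed
  qed
  finally show ?thesis .
qed

definition cell_average :: "nat \<Rightarrow> (real \<Rightarrow> real) \<Rightarrow> real \<Rightarrow> real" where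
  "cell_average N f x = (\<Sum>i<N. indicator (cell N i) x *
     (enn2real (abs_integral (cell N i) f) / (2 * pi / real N)))"

lemma cell_average_eq:
  assumes "i < N" "x \<in> cell N i"
  shows "cell_average N f x = enn2real (abs_integral (cell N i) f) / (2 * pi / real N)"
proof -
  have "cell_average N f x = (\<Sum>j<N. if j = i then
      enn2real (abs_integral (cell N i) f) / (2 * pi / real N) else 0)"
    unfolding cell_average_def indicator_cell[OF assms(2)] by (intro sum.cong) auto
  then show ?thesis using assms(1) by simp
qed

lemma cell_average_measurable: "cell_average N f \<in> borel_measurable lebesgue"
  unfolding cell_average_def
  by (intro borel_measurable_sum borel_measurable_times borel_measurable_indicator borel_measurable_const cell_measurable)

text \<open>The averaging operators of all equidistant partitions are bounded uniformly. Let \<open>f\<close> have modular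
  at most \<open>1\<close>. The cells on which the average of \<open>\<bar>f\<bar>\<close> is at most \<open>1\<close> contribute together at most the
  mass of the weight. On every other cell the modular of the average is bounded by a
  constant times that of \<open>f\<close> on the cell plus \<open>1 / N\<close>, and the sum of these over all cells is at most
  that constant times \<open>2\<close>.\<close>
lemma cell_average_norm_le:
  assumes p: "p \<in> log_exponents" and Ap: "\<omega> \<in> muckenhoupt p"
  obtains C where "0 < C"
    and "\<forall>N f. 1 \<le> N \<longrightarrow> f \<in> borel_measurable lebesgue \<longrightarrow>
      lp_norm p \<omega> (cell_average N f) \<le> ennreal C * lp_norm p \<omega> f"
proof -
  have pe: "p \<in> exponents" using p by (simp add: log_exponents_def)
  note p1 = exponentsD(1)[OF pe] and pm = exponentsD(2)[OF pe]
  have wm: "\<omega> \<in> borel_measurable lebesgue" using Ap by (simp add: muckenhoupt_def is_weight_def)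
  obtain K where "0 \<le> K" and K: "\<forall>f s t \<sigma> I. f \<in> borel_measurable lebesgue \<longrightarrow> modular p \<omega> f \<le> 1 \<longrightarrow>
      -pi \<le> s \<longrightarrow> s < t \<longrightarrow> t \<le> pi \<longrightarrow> 0 < \<sigma> \<longrightarrow>
      modular_on p \<omega> {s..t} f \<le> ennreal \<sigma> \<longrightarrow>
      abs_integral {s..t} f = ennreal I \<longrightarrow> t - s < I \<longrightarrow>
      (\<integral>\<^sup>+x\<in>{s..t}. ennreal ((I / (t - s)) powr p x) * \<omega> x \<partial>lebesgue) \<le> ennreal (K * \<sigma>)"
    by (rule local_modular_bound[OF p Ap])
  obtain C0 where C0: "1 \<le> C0" "\<And>f. f \<in> borel_measurable lebesgue \<Longrightarrow> modular p \<omega> f \<le> 1 \<Longrightarrow>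
      abs_integral torus f \<le> ennreal C0"
    using integral_le_of_modular[OF pe Ap] by blast
  let ?W = "weight_mass \<omega> torus"
  \<comment> \<open>If the weight has infinite mass, \<open>f\<close> vanishes almost everywhere and the cells contribute nothing.\<close>
  define W where "W = (if ?W = \<infinity> then 0 else ?W)"
  define C where "C = 1 + enn2real W + 2 * K"
  have "1 \<le> C" using \<open>0 \<le> K\<close> by (simp add: C_def)
  have Wr: "W = ennreal (enn2real W)" by (simp add: W_def less_top)
  have "lp_norm p \<omega> (cell_average N f) \<le> ennreal C * lp_norm p \<omega> f"
    if N: "1 \<le> N" and f: "f \<in> borel_measurable lebesgue" for N f
  proof (rule ennreal_le_mult_if_bounds)
    show "0 < C" using \<open>1 \<le> C\<close> by simp
    fix \<beta> :: real assume "0 < \<beta>" and \<beta>: "lp_norm p \<omega> f < ennreal \<beta>"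
    let ?d = "2 * pi / real N"
    have d: "0 < ?d" using N by simp
    define g where "g x = f x / \<beta>" for x
    have g: "g \<in> borel_measurable lebesgue" unfolding g_def using f by measurable
    have g1: "modular p \<omega> g \<le> 1"
      unfolding g_def by (rule lp_norm_lessD(2)[OF p1 \<beta>])
    define I where "I i = enn2real (abs_integral (cell N i) g)" for i
    have I0: "0 \<le> I i" for i by (simp add: I_def)
    have cell_le: "(\<integral>\<^sup>+x\<in>cell N i. h x \<partial>lebesgue) \<le> (\<integral>\<^sup>+x\<in>torus. h x \<partial>lebesgue)" if "i < N" for h i
      using cell_bounds(3)[OF that] by (intro nn_integral_mono) (auto simp: indicator_def)
    have I: "abs_integral (cell N i) g = ennreal (I i)" if "i < N" for i
    proof -
      have "abs_integral (cell N i) g \<le> ennreal C0"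
        using cell_le[OF that] C0(2)[OF g g1] by (rule order_trans)
      then show ?thesis by (auto simp: I_def ennreal_enn2real_if top_unique)
    qed
    let ?G = "cell_average N g"
    have G: "?G x = I i / ?d" if "i < N" "x \<in> cell N i" for i x
      using cell_average_eq[OF that] by (simp add: I_def)
    have "abs_integral (cell N i) f = ennreal \<beta> * abs_integral (cell N i) g" for i
    proof -
      have "abs_integral (cell N i) f = (\<integral>\<^sup>+x. ennreal \<beta> * (ennreal \<bar>g x\<bar> * indicator (cell N i) x) \<partial>lebesgue)"
        using \<open>0 < \<beta>\<close> by (intro nn_integral_cong) (simp add: g_def mult.assoc[symmetric] ennreal_mult[symmetric])
      also have "\<dots> = ennreal \<beta> * abs_integral (cell N i) g"
        using g by (intro nn_integral_cmult borel_measurable_times_ennreal borel_measurable_indicator) auto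
      finally show ?thesis .
    qed
    then have "cell_average N f = (\<lambda>x. \<beta> * ?G x)"
      using \<open>0 < \<beta>\<close> by (simp add: cell_average_def fun_eq_iff enn2real_mult sum_distrib_left mult_ac)
    have not_pi: "AE x in lebesgue. x \<noteq> pi" by (intro AE_not_in[of "{pi}", simplified]) simp
    have "lp_norm p \<omega> (\<lambda>x. \<beta> * ?G x) \<le> ennreal (C * \<beta>)"
    proof (rule lp_norm_le_of_modular_le[OF p1 pm wm _ \<open>1 \<le> C\<close> \<open>0 < \<beta>\<close>])
      show "(\<lambda>x. \<beta> * ?G x) \<in> borel_measurable lebesgue" using cell_average_measurable by measurable
      define S where "S i = enn2real (modular_on p \<omega> (cell N i) g)" for i
      have S: "modular_on p \<omega> (cell N i) g = ennreal (S i)" if "i < N" for i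
      proof -
        have "modular_on p \<omega> (cell N i) g \<le> 1"
          using cell_le[OF that] g1[unfolded modular_def] by (rule order_trans)
        then show ?thesis by (auto simp: S_def ennreal_enn2real_if top_unique)
      qed
      have S0: "0 \<le> S i" for i by (simp add: S_def)
      let ?V = "\<lambda>i. if ?W = \<infinity> then 0 else weight_mass \<omega> (cell N i)"
      \<comment> \<open>The local bound needs a positive bound on the modular; the terms \<open>1 / N\<close> provide it and add up to \<open>1\<close>.\<close>
      have each: "(\<integral>\<^sup>+x\<in>cell N i. ennreal ((I i / ?d) powr p x) * \<omega> x \<partial>lebesgue) \<le>
          ?V i + ennreal (K * (S i + 1 / real N))" if i: "i < N" for i
      proof (cases "?d < I i")
        case True
        let ?s = "-pi + real i * ?d" and ?t = "-pi + real (Suc i) * ?d"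
        have len: "?t - ?s = ?d" by (simp add: distrib_right add_divide_distrib)
        have st: "-pi \<le> ?s" "?s < ?t" "?t \<le> pi"
          using cell_bounds(1,2)[OF i] len d by linarith+
        have cl: "(\<integral>\<^sup>+x\<in>cell N i. h x \<partial>lebesgue) = (\<integral>\<^sup>+x\<in>{?s..?t}. h x \<partial>lebesgue)" for h
          unfolding cell_def by (rule nn_integral_half_open)
        have "(\<integral>\<^sup>+x\<in>{?s..?t}. ennreal ((I i / (?t - ?s)) powr p x) * \<omega> x \<partial>lebesgue) \<le>
            ennreal (K * (S i + 1 / real N))"
        proof (rule K[rule_format, OF g g1 st])
          show "0 < S i + 1 / real N" using S0[of i] N by (simp add: add_nonneg_pos)
          show "modular_on p \<omega> {?s..?t} g \<le> ennreal (S i + 1 / real N)"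
            using S[OF i] unfolding cl by (simp add: ennreal_leI)
          show "abs_integral {?s..?t} g = ennreal (I i)"
            using I[OF i] unfolding cl .
          show "?t - ?s < I i" unfolding len by (rule True)
        qed
        then show ?thesis unfolding cl len by (rule order_trans) simp
      next
        case False
        show ?thesis
        proof (cases "?W = \<infinity>")
          case inf: True
          have "abs_integral (cell N i) g \<le> 0"
            using cell_le[OF i] integral_eq_0_of_modular[OF pe Ap inf g g1] by metis
          then have "I i = 0" by (simp add: I_def)
          then show ?thesis by simp
        next
          case fin: False
          have "I i / ?d \<le> 1" using False d by (subst pos_divide_le_eq) auto
          then have le1: "ennreal ((I i / ?d) powr p x) \<le> 1" if "x \<in> torus" for x
            using I0[of i] d p1[OF that] by (intro ennreal_le_1[THEN iffD2] powr_le1) auto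
          have "(\<integral>\<^sup>+x\<in>cell N i. ennreal ((I i / ?d) powr p x) * \<omega> x \<partial>lebesgue) \<le> weight_mass \<omega> (cell N i)"
          proof (rule nn_integral_mono)
            fix x
            show "ennreal ((I i / ?d) powr p x) * \<omega> x * indicator (cell N i) x \<le> \<omega> x * indicator (cell N i) x"
              using le1[of x] cell_bounds(3)[OF i] mult_right_mono[of "ennreal ((I i / ?d) powr p x)" 1 "\<omega> x"]
              by (cases "x \<in> cell N i") (auto simp: subset_iff)
          qed
          then show ?thesis using fin by (simp add: add_increasing2)
        qed
      qed
      have Cm: "(\<lambda>x. ennreal ((I i / ?d) powr p x) * \<omega> x * indicator (cell N i) x) \<in> borel_measurable lebesgue"
        if "i < N" for i
      proof -
        have "(\<lambda>x. ennreal (\<bar>I i / ?d\<bar> powr p x) * \<omega> x * indicator torus x * indicator (cell N i) x) \<in> borel_measurable lebesgue"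
          by (intro borel_measurable_times_ennreal[OF lp_integrand_measurable[OF pm wm]]
              borel_measurable_indicator cell_measurable borel_measurable_const)
        then show ?thesis
          by (rule measurable_cong[THEN iffD1, rotated])
            (use I0[of i] cell_bounds(3)[OF that] in \<open>auto simp: indicator_def\<close>)
      qed
      have "modular p \<omega> (\<lambda>x. \<beta> * ?G x / \<beta>) \<le>
          (\<integral>\<^sup>+x. (\<Sum>i<N. ennreal ((I i / ?d) powr p x) * \<omega> x * indicator (cell N i) x) \<partial>lebesgue)"
        unfolding modular_def
      proof (rule nn_integral_mono_AE)
        show "AE x in lebesgue. ennreal (\<bar>\<beta> * ?G x / \<beta>\<bar> powr p x) * \<omega> x * indicator torus x \<le>
            (\<Sum>i<N. ennreal ((I i / ?d) powr p x) * \<omega> x * indicator (cell N i) x)"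
          using not_pi
        proof eventually_elim
          case (elim x)
          show ?case
          proof (cases "x \<in> torus")
            case True
            then obtain i where i: "i < N" "x \<in> cell N i"
              using cell_cover[OF N, of x] elim by (auto simp: torus_def)
            have "\<bar>\<beta> * ?G x / \<beta>\<bar> = I i / ?d" using G[OF i] I0[of i] \<open>0 < \<beta>\<close> by simp
            then have "ennreal (\<bar>\<beta> * ?G x / \<beta>\<bar> powr p x) * \<omega> x * indicator torus x =
                ennreal ((I i / ?d) powr p x) * \<omega> x * indicator (cell N i) x"
              using True i(2) by simp
            also have "\<dots> \<le> (\<Sum>i<N. ennreal ((I i / ?d) powr p x) * \<omega> x * indicator (cell N i) x)"
              using i(1) by (intro member_le_sum) auto
            finally show ?thesis .
          qed simp
        qed
      qed
      also have "\<dots> = (\<Sum>i<N. \<integral>\<^sup>+x\<in>cell N i. ennreal ((I i / ?d) powr p x) * \<omega> x \<partial>lebesgue)"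
        using Cm by (intro nn_integral_sum) auto
      also have "\<dots> \<le> (\<Sum>i<N. ?V i + ennreal (K * (S i + 1 / real N)))"
        using each by (intro sum_mono) auto
      also have "\<dots> = (\<Sum>i<N. ?V i) + ennreal (K * ((\<Sum>i<N. S i) + 1))"
      proof -
        have "(\<Sum>i<N. ennreal (K * (S i + 1 / real N))) = ennreal (\<Sum>i<N. K * (S i + 1 / real N))"
          using \<open>0 \<le> K\<close> S0 by (intro sum_ennreal) simp
        also have "(\<Sum>i<N. K * (S i + 1 / real N)) = K * ((\<Sum>i<N. S i) + 1)"
          using N by (simp add: sum_distrib_left[symmetric] sum.distrib)
        finally show ?thesis by (simp add: sum.distrib)
      qed
      also have "\<dots> \<le> W + ennreal (K * (1 + 1))"
      proof (rule add_mono)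
        have "(\<lambda>x. \<omega> x * indicator torus x) \<in> borel_measurable lebesgue"
          using wm by (intro borel_measurable_times_ennreal borel_measurable_indicator) (auto simp: torus_def)
        then show "(\<Sum>i<N. ?V i) \<le> W"
          using sum_cell_integrals_le[of \<omega> N] by (simp add: W_def)
        have "ennreal (\<Sum>i<N. S i) = (\<Sum>i<N. modular_on p \<omega> (cell N i) g)"
        proof -
          have "ennreal (\<Sum>i<N. S i) = (\<Sum>i<N. ennreal (S i))"
            by (rule sum_ennreal[symmetric]) (rule S0)
          also have "\<dots> = (\<Sum>i<N. modular_on p \<omega> (cell N i) g)"
            by (rule sum.cong) (simp_all add: S)
          finally show ?thesis .
        qed
        also have "\<dots> \<le> ennreal 1"
          using order_trans[OF sum_cell_integrals_le[OF lp_integrand_measurable[OF pm wm g]] g1[unfolded modular_def]]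
          by simp
        finally have "(\<Sum>i<N. S i) \<le> 1" by (simp only: ennreal_le_iff)
        then show "ennreal (K * ((\<Sum>i<N. S i) + 1)) \<le> ennreal (K * (1 + 1))"
          using \<open>0 \<le> K\<close> by (intro ennreal_leI mult_left_mono) auto
      qed
      also have "\<dots> \<le> ennreal C"
      proof -
        have "W + ennreal (K * (1 + 1)) = ennreal (enn2real W + 2 * K)"
          using \<open>0 \<le> K\<close> by (subst Wr) (simp add: ennreal_plus)
        then show ?thesis by (simp add: C_def ennreal_leI)
      qed
      finally show "modular p \<omega> (\<lambda>x. \<beta> * ?G x / \<beta>) \<le> ennreal C" .
    qed
    then show "lp_norm p \<omega> (cell_average N f) \<le> ennreal (C * \<beta>)"
      unfolding \<open>cell_average N f = _\<close> .
  qed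
  then show thesis
    using \<open>1 \<le> C\<close> by (intro that[of C]) auto
qed

section \<open>Landau and Poincare inequalities on an interval\<close>

primrec landau_const :: "nat \<Rightarrow> real" where
  "landau_const 0 = 1"
| "landau_const (Suc j) = 2 * 3 ^ (j + 2) * landau_const j"

lemma landau_const_pos: "0 < landau_const j"
  by (induction j) auto

text \<open>In the left and the right third of the interval there is a point at which the derivative of order
  \<open>j\<close> is already controlled, and the mean value theorem between these two points yields one for
  order \<open>j + 1\<close>. The thirds keep the two points apart.\<close>
lemma small_derivative_point:
  fixes H :: "nat \<Rightarrow> real \<Rightarrow> real"
  assumes cont: "continuous_on UNIV (H 0)"
    and H: "\<And>i x. i < j \<Longrightarrow> (H i has_real_derivative H (Suc i) x) (at x)"
    and "0 < d"
  shows "\<exists>\<xi>\<in>{l..l+d}. \<bar>H j \<xi>\<bar> * d ^ (j + 1) \<le> landau_const j * integral {l..l+d} (\<lambda>x. \<bar>H 0 x\<bar>)"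
  using H \<open>0 < d\<close>
proof (induction j arbitrary: l d)
  case 0
  have cont': "continuous_on {l..l+d} (\<lambda>x. \<bar>H 0 x\<bar>)"
    using cont by (intro continuous_on_rabs continuous_on_subset[OF cont]) auto
  obtain \<xi> where \<xi>: "\<xi> \<in> {l..l+d}" "\<And>x. x \<in> {l..l+d} \<Longrightarrow> \<bar>H 0 \<xi>\<bar> \<le> \<bar>H 0 x\<bar>"
    using continuous_attains_inf[OF _ _ cont'] \<open>0 < d\<close> by auto
  have "integral {l..l+d} (\<lambda>x. \<bar>H 0 \<xi>\<bar>) \<le> integral {l..l+d} (\<lambda>x. \<bar>H 0 x\<bar>)"
    using \<xi>(2) by (intro integral_le integrable_continuous_real cont') auto
  then show ?case
    using \<xi>(1) \<open>0 < d\<close> by (intro bexI[of _ \<xi>]) (auto simp: mult.commute)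
next
  case (Suc j)
  let ?I = "integral {l..l+d} (\<lambda>x. \<bar>H 0 x\<bar>)"
  have "0 < d/3" using \<open>0 < d\<close> by simp
  have int: "(\<lambda>x. \<bar>H 0 x\<bar>) integrable_on {s..t}" for s t
    by (intro integrable_continuous_real continuous_on_rabs continuous_on_subset[OF cont]) auto
  have sub: "integral {s..s + d/3} (\<lambda>x. \<bar>H 0 x\<bar>) \<le> ?I" if "l \<le> s" "s + d/3 \<le> l + d" for s
    using that by (intro integral_subset_le int) auto
  have pt: "\<exists>\<xi>\<in>{s..s+d/3}. \<bar>H j \<xi>\<bar> * (d/3) ^ (j + 1) \<le> landau_const j * ?I"
    if "l \<le> s" "s + d/3 \<le> l + d" for s
  proof -
    have "\<exists>\<xi>\<in>{s..s+d/3}. \<bar>H j \<xi>\<bar> * (d/3) ^ (j + 1) \<le> landau_const j * integral {s..s+d/3} (\<lambda>x. \<bar>H 0 x\<bar>)"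
      by (rule Suc.IH[OF _ \<open>0 < d/3\<close>]) (use Suc.prems in simp)
    moreover have "landau_const j * integral {s..s+d/3} (\<lambda>x. \<bar>H 0 x\<bar>) \<le> landau_const j * ?I"
      using sub[OF that] landau_const_pos[of j] by (simp add: mult_left_mono)
    ultimately show ?thesis by (meson order_trans)
  qed
  obtain a where a: "a \<in> {l..l+d/3}" "\<bar>H j a\<bar> * (d/3) ^ (j + 1) \<le> landau_const j * ?I"
    using pt[of l] \<open>0 < d\<close> by auto
  obtain b where b: "b \<in> {l+2*d/3..l+2*d/3+d/3}" "\<bar>H j b\<bar> * (d/3) ^ (j + 1) \<le> landau_const j * ?I"
    using pt[of "l+2*d/3"] \<open>0 < d\<close> by auto
  have ab: "d/3 \<le> b - a" "a < b" using a(1) b(1) \<open>0 < d\<close> by auto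
  obtain \<xi> where \<xi>: "a < \<xi>" "\<xi> < b" "H j b - H j a = (b - a) * H (Suc j) \<xi>"
    using MVT2[of a b "H j" "H (Suc j)"] ab Suc.prems by auto
  have "\<bar>H (Suc j) \<xi>\<bar> * d ^ (Suc j + 1) = 3 ^ (j + 2) * ((d/3) * \<bar>H (Suc j) \<xi>\<bar> * (d/3) ^ (j + 1))"
    by (simp add: power_divide field_simps)
  also have "(d/3) * \<bar>H (Suc j) \<xi>\<bar> \<le> \<bar>H j a\<bar> + \<bar>H j b\<bar>"
  proof -
    have "(d/3) * \<bar>H (Suc j) \<xi>\<bar> \<le> (b - a) * \<bar>H (Suc j) \<xi>\<bar>"
      using ab by (intro mult_right_mono) auto
    also have "\<dots> = \<bar>H j b - H j a\<bar>" using \<xi>(3) ab by (simp add: abs_mult)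
    finally show ?thesis by linarith
  qed
  then have "3 ^ (j + 2) * ((d/3) * \<bar>H (Suc j) \<xi>\<bar> * (d/3) ^ (j + 1)) \<le>
      3 ^ (j + 2) * ((\<bar>H j a\<bar> + \<bar>H j b\<bar>) * (d/3) ^ (j + 1))"
    using \<open>0 < d\<close> by (intro mult_left_mono mult_right_mono) auto
  also have "\<dots> \<le> 3 ^ (j + 2) * (landau_const j * ?I + landau_const j * ?I)"
    using a(2) b(2) by (intro mult_left_mono) (auto simp: distrib_right)
  also have "\<dots> = landau_const (Suc j) * ?I" by simp
  finally show ?case
    using \<xi>(1,2) a(1) b(1) \<open>0 < d\<close> by (intro bexI[of _ \<xi>]) auto
qed

text \<open>Some point of the interval has a controlled derivative of order \<open>m\<close>, and the oscillation carries
  this to the whole interval. For lower orders the same argument applies, with the oscillation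
  estimated by \<open>d\<close> times the bound for the next order.\<close>
lemma derivative_bound_on_interval:
  fixes H :: "nat \<Rightarrow> real \<Rightarrow> real"
  assumes cont: "continuous_on UNIV (H 0)"
    and H: "\<And>i x. i < m \<Longrightarrow> (H i has_real_derivative H (Suc i) x) (at x)"
    and "0 < d"
    and osc: "\<And>x y. x \<in> {l..l+d} \<Longrightarrow> y \<in> {l..l+d} \<Longrightarrow> \<bar>H m x - H m y\<bar> \<le> M"
    and "j \<le> m" and x: "x \<in> {l..l+d}"
  shows "\<bar>H j x\<bar> * d ^ (j + 1) \<le>
      (1 + (\<Sum>i=j..m. landau_const i)) * (integral {l..l+d} (\<lambda>x. \<bar>H 0 x\<bar>) + M * d ^ (m + 1))"
proof -
  let ?I = "integral {l..l+d} (\<lambda>x. \<bar>H 0 x\<bar>)"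
  let ?S = "?I + M * d ^ (m + 1)"
  have "0 \<le> M" using osc[of l l] \<open>0 < d\<close> by simp
  then have Md: "0 \<le> M * d ^ (m + 1)" using \<open>0 < d\<close> by simp
  have "0 \<le> ?I"
    by (intro integral_nonneg integrable_continuous_real continuous_on_rabs continuous_on_subset[OF cont]) auto
  have pt: "\<exists>\<xi>\<in>{l..l+d}. \<bar>H i \<xi>\<bar> * d ^ (i + 1) \<le> landau_const i * ?I" if "i \<le> m" for i
    by (rule small_derivative_point[of H, OF cont _ \<open>0 < d\<close>]) (use H that in auto)
  show ?thesis
    using \<open>j \<le> m\<close> x
  proof (induction j arbitrary: x rule: inc_induct)
    case base
    obtain \<xi> where \<xi>: "\<xi> \<in> {l..l+d}" "\<bar>H m \<xi>\<bar> * d ^ (m + 1) \<le> landau_const m * ?I"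
      using pt[of m] by auto
    have "\<bar>H m x\<bar> \<le> \<bar>H m \<xi>\<bar> + M"
      using osc[OF base \<xi>(1)] by linarith
    then have "\<bar>H m x\<bar> * d ^ (m + 1) \<le> (\<bar>H m \<xi>\<bar> + M) * d ^ (m + 1)"
      using \<open>0 < d\<close> by (intro mult_right_mono) auto
    also have "\<dots> \<le> landau_const m * ?I + M * d ^ (m + 1)"
      using \<xi>(2) by (simp add: distrib_right)
    also have "\<dots> \<le> (1 + landau_const m) * ?S"
      using \<open>0 \<le> ?I\<close> Md landau_const_pos[of m] by (simp add: distrib_left distrib_right add_increasing)
    finally show ?case by simp
  next
    case (step j)
    obtain \<xi> where \<xi>: "\<xi> \<in> {l..l+d}" "\<bar>H j \<xi>\<bar> * d ^ (j + 1) \<le> landau_const j * ?I"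
      using pt[of j] step by auto
    let ?D = "1 + (\<Sum>i=Suc j..m. landau_const i)"
    have "\<bar>H j x - H j \<xi>\<bar> * d ^ (j + 1) \<le> ?D * ?S"
    proof -
      define B where "B = ?D * ?S / d ^ (j + 2)"
      have B: "norm (H (Suc j) y) \<le> B" if "y \<in> {l..l+d}" for y
        using step.IH[OF that] \<open>0 < d\<close> by (simp add: B_def pos_le_divide_eq)
      have "norm (H j x - H j \<xi>) \<le> B * norm (x - \<xi>)"
        by (rule field_differentiable_bound[of "{l..l+d}" "H j" "H (Suc j)"])
          (use B H step.hyps step.prems \<xi>(1) in \<open>auto intro: has_field_derivative_at_within\<close>)
      also have "\<dots> \<le> B * d"
        using step.prems \<xi>(1) B[OF \<xi>(1)] norm_ge_zero[of "H (Suc j) \<xi>"]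
        by (intro mult_left_mono) auto
      finally have "\<bar>H j x - H j \<xi>\<bar> * d ^ (j + 1) \<le> B * d * d ^ (j + 1)"
        using \<open>0 < d\<close> by (intro mult_right_mono) auto
      also have "\<dots> = ?D * ?S" using \<open>0 < d\<close> by (simp add: B_def)
      finally show ?thesis .
    qed
    moreover have "\<bar>H j x\<bar> * d ^ (j + 1) \<le> \<bar>H j \<xi>\<bar> * d ^ (j + 1) + \<bar>H j x - H j \<xi>\<bar> * d ^ (j + 1)"
      unfolding distrib_right[symmetric] using \<open>0 < d\<close> by (intro mult_right_mono) auto
    moreover have "landau_const j * ?I \<le> landau_const j * ?S"
      using Md landau_const_pos[of j] by (intro mult_left_mono) auto
    moreover have "(\<Sum>i=j..m. landau_const i) = landau_const j + (\<Sum>i=Suc j..m. landau_const i)"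
      using step.hyps by (simp add: sum.atLeast_Suc_atMost)
    ultimately show ?case using \<xi>(2) by (simp add: distrib_right)
  qed
qed

text \<open>By Rolle's theorem each derivative of a periodic function has a zero, so it is bounded by its
  oscillation, hence by \<open>2 * pi\<close> times the supremum of the next derivative.\<close>
lemma periodic_derivative_bound:
  fixes H :: "nat \<Rightarrow> real \<Rightarrow> real"
  assumes H: "\<And>i x. i < m \<Longrightarrow> (H i has_real_derivative H (Suc i) x) (at x)"
    and per: "\<And>i. i < m \<Longrightarrow> H i (-pi) = H i pi"
    and osc: "\<And>x y. x \<in> {-pi..pi} \<Longrightarrow> y \<in> {-pi..pi} \<Longrightarrow> \<bar>H m x - H m y\<bar> \<le> M"
    and "1 \<le> j" "j \<le> m" and x: "x \<in> {-pi..pi}"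
  shows "\<bar>H j x\<bar> \<le> (2 * pi) ^ (m - j) * M"
proof -
  have zero: "\<exists>\<xi>\<in>{-pi..pi}. H i \<xi> = 0" if "1 \<le> i" "i \<le> m" for i
  proof -
    have "i - 1 < m" using that by simp
    obtain \<xi> where "-pi < \<xi>" "\<xi> < pi" "H (i - 1) pi - H (i - 1) (-pi) = (pi - (-pi)) * H (Suc (i - 1)) \<xi>"
      using MVT2[of "-pi" pi "H (i - 1)" "H (Suc (i - 1))"] H[OF \<open>i - 1 < m\<close>] pi_gt_zero by auto
    then show ?thesis using per[OF \<open>i - 1 < m\<close>] that by (intro bexI[of _ \<xi>]) auto
  qed
  show ?thesis
    using \<open>j \<le> m\<close> \<open>1 \<le> j\<close> x
  proof (induction j arbitrary: x rule: inc_induct)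
    case base
    then obtain \<xi> where "\<xi> \<in> {-pi..pi}" "H m \<xi> = 0" using zero by blast
    then show ?case using osc[OF base(2), of \<xi>] by simp
  next
    case (step j)
    obtain \<xi> where \<xi>: "\<xi> \<in> {-pi..pi}" "H j \<xi> = 0" using zero[of j] step by auto
    have B: "norm (H (Suc j) y) \<le> (2 * pi) ^ (m - Suc j) * M" if "y \<in> {-pi..pi}" for y
      using step.IH that by simp
    have "norm (H j x - H j \<xi>) \<le> (2 * pi) ^ (m - Suc j) * M * norm (x - \<xi>)"
      by (rule field_differentiable_bound[of "{-pi..pi}" "H j" "H (Suc j)"])
        (use B H step.hyps step.prems \<xi>(1) in \<open>auto intro: has_field_derivative_at_within\<close>)
    also have "\<dots> \<le> (2 * pi) ^ (m - Suc j) * M * (2 * pi)"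
      using step.prems \<xi>(1) B[OF \<xi>(1)] norm_ge_zero[of "H (Suc j) \<xi>"]
      by (intro mult_left_mono) (auto simp: abs_le_iff)
    also have "\<dots> = (2 * pi) ^ (m - j) * M"
    proof -
      have "m - j = Suc (m - Suc j)" using step.hyps by simp
      then show ?thesis by simp
    qed
    finally show ?case using \<xi>(2) by simp
  qed
qed

section \<open>Sobolev functions in the weighted norm\<close>

lemma deriv_periodic:
  fixes f :: "real \<Rightarrow> real"
  assumes "\<And>x. f (x + c) = f x"
  shows "deriv f (x + c) = deriv f x"
proof -
  have "(f has_field_derivative D) (at (x + c)) \<longleftrightarrow> (f has_field_derivative D) (at x)" for D
    using DERIV_shift[of f D x c] assms by simp
  then show ?thesis by (simp add: deriv_def)
qed

lemma higher_deriv_periodic: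
  fixes f :: "real \<Rightarrow> real"
  assumes "\<And>x. f (x + c) = f x"
  shows "(deriv ^^ j) f (x + c) = (deriv ^^ j) f x"
proof (induction j arbitrary: x)
  case (Suc j)
  show ?case by (simp, rule deriv_periodic, rule Suc)
qed (simp add: assms)

lemma lp_spaceD:
  assumes "f \<in> lp_space p \<omega>"
  shows "f (x + 2 * pi) = f x" "f \<in> borel_measurable lebesgue" "lp_norm p \<omega> f < \<infinity>"
  using assms by (auto simp: lp_space_def periodic_fun_simple_def periodic_fun_def)

lemma sobolevD:
  assumes "g \<in> sobolev (Suc m) p \<omega>"
  shows "g \<in> lp_space p \<omega>" "(deriv ^^ (Suc m)) g \<in> lp_space p \<omega>"
    "abs_continuous_on (-pi) pi ((deriv ^^ m) g)"
    "j < m \<Longrightarrow> ((deriv ^^ j) g has_real_derivative (deriv ^^ (Suc j)) g x) (at x)"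
    "(deriv ^^ j) g (x + 2 * pi) = (deriv ^^ j) g x"
proof -
  show g: "g \<in> lp_space p \<omega>" and "(deriv ^^ (Suc m)) g \<in> lp_space p \<omega>"
    "abs_continuous_on (-pi) pi ((deriv ^^ m) g)"
    using assms by (auto simp: sobolev_def)
  show "((deriv ^^ j) g has_real_derivative (deriv ^^ (Suc j)) g x) (at x)" if "j < m"
    using assms that by (auto simp: sobolev_def DERIV_deriv_iff_real_differentiable)
  show "(deriv ^^ j) g (x + 2 * pi) = (deriv ^^ j) g x"
    by (rule higher_deriv_periodic) (rule lp_spaceD(1)[OF g])
qed

lemma lp_space_integrable:
  assumes p: "p \<in> exponents" and Ap: "\<omega> \<in> muckenhoupt p" and f: "f \<in> lp_space p \<omega>"
  shows "abs_integral torus f < \<infinity>"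
proof -
  note p1 = exponentsD(1)[OF p]
  note fD = lp_spaceD[OF f]
  obtain C where C: "\<And>f. f \<in> borel_measurable lebesgue \<Longrightarrow> modular p \<omega> f \<le> 1 \<Longrightarrow>
      abs_integral torus f \<le> ennreal C"
    using integral_le_of_modular[OF p Ap] by blast
  define b where "b = enn2real (lp_norm p \<omega> f) + 1"
  have "lp_norm p \<omega> f = ennreal (enn2real (lp_norm p \<omega> f))" using fD(3) by simp
  also have "\<dots> < ennreal b" unfolding b_def by (intro ennreal_lessI) (auto intro: add_nonneg_pos)
  finally have b: "lp_norm p \<omega> f < ennreal b" .
  note bD = lp_norm_lessD[OF p1 b]
  have "abs_integral torus f =
      (\<integral>\<^sup>+x. ennreal b * (ennreal \<bar>f x / b\<bar> * indicator torus x) \<partial>lebesgue)"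
    using bD(1) by (intro nn_integral_cong) (simp add: mult.assoc[symmetric] ennreal_mult[symmetric])
  also have "\<dots> = ennreal b * (\<integral>\<^sup>+x\<in>torus. ennreal \<bar>f x / b\<bar> \<partial>lebesgue)"
    using fD(2) by (intro nn_integral_cmult borel_measurable_times_ennreal borel_measurable_indicator)
      (auto simp: torus_def)
  also have "\<dots> \<le> ennreal b * ennreal C"
    using fD(2) bD(2) by (intro mult_left_mono C) auto
  also have "\<dots> < \<infinity>" by (simp add: ennreal_mult_less_top)
  finally show ?thesis .
qed

lemma lp_norm_le_linear_combination:
  assumes p: "p \<in> exponents" and w: "\<omega> \<in> borel_measurable lebesgue"
    and meas: "F \<in> borel_measurable lebesgue" "G \<in> borel_measurable lebesgue"
    and ab: "0 < a" "0 < b"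
    and le: "AE x in lebesgue. x \<in> torus \<longrightarrow> \<bar>h x\<bar> \<le> a * F x + b * G x"
  shows "lp_norm p \<omega> h \<le> ennreal a * lp_norm p \<omega> F + ennreal b * lp_norm p \<omega> G"
proof -
  let ?n = "lp_norm p \<omega>"
  note p1 = exponentsD(1)[OF p] and pm = exponentsD(2)[OF p]
  have "?n h \<le> ?n (\<lambda>x. a * F x + b * G x)"
  proof (rule lp_norm_mono_AE[OF p1])
    show "AE x in lebesgue. x \<in> torus \<longrightarrow> \<bar>h x\<bar> \<le> \<bar>a * F x + b * G x\<bar>"
      using le by eventually_elim auto
  qed
  also have "\<dots> \<le> ?n (\<lambda>x. a * F x) + ?n (\<lambda>x. b * G x)"
    by (rule lp_norm_triangle[OF p1 pm w]) (use meas in auto)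
  also have "\<dots> \<le> ennreal a * ?n F + ennreal b * ?n G"
    by (intro add_mono lp_norm_scale_le[OF p1] ab)
  finally show ?thesis .
qed

lemma AE_torus_cell:
  assumes N: "1 \<le> N" and P: "\<And>i x. i < N \<Longrightarrow> x \<in> cell N i \<Longrightarrow> P x"
  shows "AE x in lebesgue. x \<in> torus \<longrightarrow> P x"
proof -
  have "AE x in lebesgue. x \<noteq> pi" by (intro AE_not_in[of "{pi}", simplified]) simp
  then show ?thesis
  proof eventually_elim
    case (elim x)
    show ?case
    proof
      assume "x \<in> torus"
      then obtain i where "i < N" "x \<in> cell N i"
        using cell_cover[OF N, of x] elim by (auto simp: torus_def)
      then show "P x" by (rule P)
    qed
  qed
qed

lemma sobolev_oscillation:
  assumes p: "p \<in> exponents" and Ap: "\<omega> \<in> muckenhoupt p" and g: "g \<in> sobolev (Suc m) p \<omega>"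
    and st: "-pi \<le> s" "t \<le> pi" and x: "x \<in> {s..t}" and y: "y \<in> {s..t}"
  shows "\<bar>(deriv ^^ m) g x - (deriv ^^ m) g y\<bar> \<le>
    enn2real (abs_integral {s..t} ((deriv ^^ (Suc m)) g))"
proof -
  let ?I = "abs_integral {s..t} ((deriv ^^ (Suc m)) g)"
  have "?I \<le> abs_integral torus ((deriv ^^ (Suc m)) g)"
    using st by (intro nn_integral_mono) (auto simp: indicator_def torus_def)
  also have "\<dots> < \<infinity>" by (rule lp_space_integrable[OF p Ap sobolevD(2)[OF g]])
  finally have fin: "?I < top" by simp
  have main: "\<bar>(deriv ^^ m) g b - (deriv ^^ m) g a\<bar> \<le> enn2real ?I"
    if ab: "s \<le> a" "a \<le> b" "b \<le> t" for a b
  proof -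
    have "ennreal \<bar>(deriv ^^ m) g b - (deriv ^^ m) g a\<bar> \<le>
        abs_integral {a..b} (deriv ((deriv ^^ m) g))"
      using ab st by (intro abs_continuous_increment_le[OF sobolevD(3)[OF g]]) auto
    also have "\<dots> \<le> ?I"
      using ab by (intro nn_integral_mono) (auto simp: indicator_def)
    also have "\<dots> = ennreal (enn2real ?I)" using fin by simp
    finally show ?thesis by (simp add: ennreal_le_iff)
  qed
  show ?thesis using main[of x y] main[of y x] x y by (cases "x \<le> y") (auto simp: abs_minus_commute)
qed

text \<open>On each cell the Landau inequality bounds the derivative of order \<open>r\<close> by averages of \<open>\<bar>g1 - g2\<bar>\<close> and
  of the two derivatives of order \<open>m + 1\<close>, so the weighted inequality reduces to the boundedness of
  averages. It is stated for two functions, as the derivative of order \<open>m + 1\<close> of a difference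
  is the difference of the derivatives only almost everywhere.\<close>
lemma interpolation_inequality:
  assumes p: "p \<in> log_exponents" and Ap: "\<omega> \<in> muckenhoupt p" and rm: "1 \<le> r" "r \<le> m"
  obtains C where "0 < C"
    and "\<forall>g1\<in>sobolev (Suc m) p \<omega>. \<forall>g2\<in>sobolev (Suc m) p \<omega>. \<forall>u. 0 < u \<and> u \<le> 1 \<longrightarrow>
      lp_norm p \<omega> (\<lambda>x. (deriv ^^ r) g1 x - (deriv ^^ r) g2 x) \<le>
      ennreal (C / u ^ r) * (lp_norm p \<omega> (\<lambda>x. g1 x - g2 x) +
        ennreal (u ^ Suc m) * (lp_norm p \<omega> ((deriv ^^ (Suc m)) g1) + lp_norm p \<omega> ((deriv ^^ (Suc m)) g2)))"
proof -
  let ?n = "lp_norm p \<omega>"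
  have pe: "p \<in> exponents" using p by (simp add: log_exponents_def)
  note p1 = exponentsD(1)[OF pe] and pm = exponentsD(2)[OF pe]
  have wm: "\<omega> \<in> borel_measurable lebesgue" using Ap by (simp add: muckenhoupt_def is_weight_def)
  obtain A where "0 < A" and A: "\<forall>N f. 1 \<le> N \<longrightarrow> f \<in> borel_measurable lebesgue \<longrightarrow>
      ?n (cell_average N f) \<le> ennreal A * ?n f"
    by (rule cell_average_norm_le[OF p Ap])
  define E where "E = 1 + (\<Sum>i=r..m. landau_const i)"
  have "0 < E" unfolding E_def by (intro add_pos_nonneg sum_nonneg) (auto intro: less_imp_le landau_const_pos)
  have "?n (\<lambda>x. (deriv ^^ r) g1 x - (deriv ^^ r) g2 x) \<le>
      ennreal (E * 2 ^ r * A / u ^ r) * (?n (\<lambda>x. g1 x - g2 x) +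
        ennreal (u ^ Suc m) * (?n ((deriv ^^ (Suc m)) g1) + ?n ((deriv ^^ (Suc m)) g2)))"
    if g1: "g1 \<in> sobolev (Suc m) p \<omega>" and g2: "g2 \<in> sobolev (Suc m) p \<omega>" and u: "0 < u" "u \<le> 1" for g1 g2 u
  proof -
    \<comment> \<open>The cell length lies between \<open>u / 2\<close> and \<open>u\<close>.\<close>
    define N where "N = nat \<lceil>2 * pi / u\<rceil>"
    have "1 \<le> 2 * pi / u" using u pi_ge_two by (simp add: field_simps)
    then have N': "2 * pi / u \<le> real N" "real N \<le> 2 * (2 * pi / u)" and N: "1 \<le> N"
      unfolding N_def by linarith+
    let ?d = "2 * pi / real N"
    have d: "0 < ?d" using N by simp
    have du: "?d \<le> u" "u / 2 \<le> ?d" using N N' u by (simp_all add: field_simps)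
    define a where "a = E * 2 ^ r / u ^ r"
    have "0 < a" using \<open>0 < E\<close> u by (simp add: a_def)
    have ad: "E / ?d ^ r \<le> a"
    proof -
      have "E / ?d ^ r \<le> E / (u / 2) ^ r"
        using \<open>0 < E\<close> u d du by (intro divide_left_mono power_mono mult_pos_pos zero_less_power) auto
      then show ?thesis by (simp add: a_def power_divide)
    qed
    have aud: "E * ?d ^ (Suc m - r) \<le> a * u ^ Suc m"
    proof -
      have "Suc m = r + (Suc m - r)" using rm by simp
      then have "u ^ Suc m = u ^ r * u ^ (Suc m - r)" by (metis power_add)
      then have eq: "a * u ^ Suc m = E * 2 ^ r * u ^ (Suc m - r)" using u by (simp add: a_def)
      have "E * ?d ^ (Suc m - r) \<le> E * u ^ (Suc m - r)"
        using \<open>0 < E\<close> d du by (intro mult_left_mono power_mono) auto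
      also have "\<dots> \<le> E * 2 ^ r * u ^ (Suc m - r)"
        using \<open>0 < E\<close> u by (intro mult_right_mono) auto
      finally show ?thesis unfolding eq .
    qed
    \<comment> \<open>For \<open>j \<le> m\<close> this is the derivative of order \<open>j\<close> of the difference, by linearity.\<close>
    define H where "H j x = (deriv ^^ j) g1 x - (deriv ^^ j) g2 x" for j x
    have HD: "(H i has_real_derivative H (Suc i) x) (at x)" if "i < m" for i x
      unfolding H_def using sobolevD(4)[OF g1 that] sobolevD(4)[OF g2 that] by (rule DERIV_diff)
    have "isCont (H 0) x" for x
      using HD[of 0 x] rm by (auto intro: DERIV_isCont)
    then have cont: "continuous_on UNIV (H 0)" by (simp add: continuous_at_imp_continuous_on)
    have H0: "H 0 = (\<lambda>x. g1 x - g2 x)" by (simp add: H_def fun_eq_iff)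
    have H0m: "H 0 \<in> borel_measurable lebesgue"
      using borel_measurable_continuous_onI[OF cont] by (intro measurable_completion) simp
    let ?T1 = "(deriv ^^ (Suc m)) g1" and ?T2 = "(deriv ^^ (Suc m)) g2"
    note T1m = lp_spaceD(2)[OF sobolevD(2)[OF g1]] and T2m = lp_spaceD(2)[OF sobolevD(2)[OF g2]]
    have pw: "\<bar>H r x\<bar> \<le> a * cell_average N (H 0) x +
        a * u ^ Suc m * (cell_average N ?T1 x + cell_average N ?T2 x)"
      if i: "i < N" "x \<in> cell N i" for i x
    proof -
      let ?l = "-pi + real i * ?d"
      have len: "?l + ?d = -pi + real (Suc i) * ?d" by (simp add: distrib_right add_divide_distrib)
      have l: "-pi \<le> ?l" "?l + ?d \<le> pi" using cell_bounds(1,2)[OF i(1)] len by linarith+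
      have x: "x \<in> {?l..?l+?d}" using i(2) unfolding len by (auto simp only: cell_def atLeastLessThan_iff atLeastAtMost_iff less_imp_le)
      have cl: "(\<integral>\<^sup>+x\<in>cell N i. h x \<partial>lebesgue) = (\<integral>\<^sup>+x\<in>{?l..?l+?d}. h x \<partial>lebesgue)" for h
        unfolding cell_def len by (rule nn_integral_half_open)
      define M1 where "M1 = enn2real (abs_integral (cell N i) ?T1)"
      define M2 where "M2 = enn2real (abs_integral (cell N i) ?T2)"
      define M0 where "M0 = enn2real (abs_integral (cell N i) (H 0))"
      have osc: "\<bar>H m a - H m b\<bar> \<le> M1 + M2" if ab: "a \<in> {?l..?l+?d}" "b \<in> {?l..?l+?d}" for a b
        using sobolev_oscillation[OF pe Ap g1 l ab] sobolev_oscillation[OF pe Ap g2 l ab]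
        unfolding H_def M1_def M2_def cl by linarith
      have int: "integral {?l..?l+?d} (\<lambda>x. \<bar>H 0 x\<bar>) = M0"
      proof -
        have c: "continuous_on {?l..?l+?d} (\<lambda>x. \<bar>H 0 x\<bar>)"
          by (intro continuous_on_rabs continuous_on_subset[OF cont]) auto
        have "set_integrable lebesgue {?l..?l+?d} (\<lambda>x. \<bar>H 0 x\<bar>)"
          using integrable_continuous_real[OF c] by (intro nonnegative_absolutely_integrable_1) auto
        then have "(\<integral>\<^sup>+x. ennreal (indicator {?l..?l+?d} x *\<^sub>R \<bar>H 0 x\<bar>) \<partial>lebesgue) =
            ennreal (\<integral>x. indicator {?l..?l+?d} x *\<^sub>R \<bar>H 0 x\<bar> \<partial>lebesgue)"
          unfolding set_integrable_def by (intro nn_integral_eq_integral) auto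
        also have "(\<integral>x. indicator {?l..?l+?d} x *\<^sub>R \<bar>H 0 x\<bar> \<partial>lebesgue) = integral {?l..?l+?d} (\<lambda>x. \<bar>H 0 x\<bar>)"
          using set_lebesgue_integral_eq_integral(2)[OF \<open>set_integrable lebesgue {?l..?l+?d} (\<lambda>x. \<bar>H 0 x\<bar>)\<close>]
          by (simp add: set_lebesgue_integral_def)
        also have "(\<integral>\<^sup>+x. ennreal (indicator {?l..?l+?d} x *\<^sub>R \<bar>H 0 x\<bar>) \<partial>lebesgue) =
            abs_integral {?l..?l+?d} (H 0)"
          by (intro nn_integral_cong) (auto simp: indicator_def)
        finally have eq: "abs_integral {?l..?l+?d} (H 0) = ennreal (integral {?l..?l+?d} (\<lambda>x. \<bar>H 0 x\<bar>))" .
        have "0 \<le> integral {?l..?l+?d} (\<lambda>x. \<bar>H 0 x\<bar>)"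
          by (intro integral_nonneg integrable_continuous_real c) auto
        then show ?thesis unfolding M0_def cl eq by simp
      qed
      have "\<bar>H r x\<bar> * ?d ^ (r + 1) \<le> E * (M0 + (M1 + M2) * ?d ^ (m + 1))"
        using derivative_bound_on_interval[of H m ?d ?l "M1 + M2" r x, OF cont HD d osc rm(2) x]
        unfolding int E_def by blast
      then have "\<bar>H r x\<bar> \<le> E * (M0 + (M1 + M2) * ?d ^ (m + 1)) / ?d ^ (r + 1)"
        by (simp only: pos_le_divide_eq[OF zero_less_power[OF d]])
      also have "\<dots> = E / ?d ^ r * (M0 / ?d) + E * ?d ^ (Suc m - r) * (M1 / ?d + M2 / ?d)"
      proof -
        have "m + 1 = (Suc m - r) + r" using rm by simp
        then have "?d ^ (m + 1) = ?d ^ (Suc m - r) * ?d ^ r" by (metis power_add)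
        moreover have "?d ^ r \<noteq> 0" "?d \<noteq> 0" using N by auto
        moreover have "E * (M0 + (M1 + M2) * (X * Y)) / (Y * D) = E / Y * (M0 / D) + E * X * (M1 / D + M2 / D)"
          if "Y \<noteq> 0" "D \<noteq> 0" for X Y D :: real
          using that by (simp add: field_simps)
        ultimately show ?thesis by (simp only: power_add power_one_right)
      qed
      also have "\<dots> \<le> a * (M0 / ?d) + a * u ^ Suc m * (M1 / ?d + M2 / ?d)"
        using ad aud d by (intro add_mono mult_right_mono) (auto simp: M0_def M1_def M2_def)
      finally show ?thesis
        by (simp only: cell_average_eq[OF i] M0_def M1_def M2_def)
    qed
    have "?n (H r) \<le> ennreal a * ?n (cell_average N (H 0)) +
        ennreal (a * u ^ Suc m) * ?n (\<lambda>x. cell_average N ?T1 x + cell_average N ?T2 x)"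
      using \<open>0 < a\<close> u
      by (intro lp_norm_le_linear_combination[OF pe wm] cell_average_measurable
          borel_measurable_add AE_torus_cell[OF N] pw) auto
    also have "\<dots> \<le> ennreal a * (ennreal A * ?n (H 0)) +
        ennreal (a * u ^ Suc m) * (ennreal A * ?n ?T1 + ennreal A * ?n ?T2)"
    proof (intro add_mono mult_left_mono)
      show "?n (cell_average N (H 0)) \<le> ennreal A * ?n (H 0)"
        using A N H0m by blast
      have "?n (\<lambda>x. cell_average N ?T1 x + cell_average N ?T2 x) \<le>
          ?n (cell_average N ?T1) + ?n (cell_average N ?T2)"
        by (rule lp_norm_triangle[OF p1 pm wm cell_average_measurable cell_average_measurable])
      also have "\<dots> \<le> ennreal A * ?n ?T1 + ennreal A * ?n ?T2"
        using A N T1m T2m by (intro add_mono) blast+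
      finally show "?n (\<lambda>x. cell_average N ?T1 x + cell_average N ?T2 x) \<le>
          ennreal A * ?n ?T1 + ennreal A * ?n ?T2" .
    qed auto
    also have "\<dots> = ennreal (a * A) * (?n (H 0) + ennreal (u ^ Suc m) * (?n ?T1 + ?n ?T2))"
    proof -
      have "ennreal (a * A) = ennreal a * ennreal A" "ennreal (a * u ^ Suc m) = ennreal a * ennreal (u ^ Suc m)"
        using \<open>0 < a\<close> \<open>0 < A\<close> u by (auto intro!: ennreal_mult simp del: power_Suc)
      then show ?thesis by (simp only: distrib_left mult_ac)
    qed
    also have "a * A = E * 2 ^ r * A / u ^ r" by (simp add: a_def)
    finally show ?thesis unfolding H0 unfolding H_def .
  qed
  then show thesis using \<open>0 < E\<close> \<open>0 < A\<close> by (intro that[of "E * 2 ^ r * A"]) auto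
qed

lemma sobolev_derivative_bound:
  assumes p: "p \<in> exponents" and Ap: "\<omega> \<in> muckenhoupt p" and g: "g \<in> sobolev (Suc m) p \<omega>"
    and r: "1 \<le> r" "r \<le> m" and x: "x \<in> torus"
  shows "\<bar>(deriv ^^ r) g x\<bar> \<le> (2 * pi) ^ (m - r) * enn2real (abs_integral torus ((deriv ^^ (Suc m)) g))"
  unfolding torus_def
proof (rule periodic_derivative_bound[of m "\<lambda>j. (deriv ^^ j) g"])
  show "((deriv ^^ i) g has_real_derivative (deriv ^^ Suc i) g y) (at y)" if "i < m" for i y
    using that by (rule sobolevD(4)[OF g])
  show "(deriv ^^ i) g (- pi) = (deriv ^^ i) g pi" for i
    using sobolevD(5)[OF g, of i "- pi"] by simp
  show "\<bar>(deriv ^^ m) g y - (deriv ^^ m) g z\<bar> \<le>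
      enn2real (abs_integral {- pi..pi} ((deriv ^^ Suc m) g))"
    if "y \<in> {- pi..pi}" "z \<in> {- pi..pi}" for y z
    using that by (intro sobolev_oscillation[OF p Ap g]) auto
qed (use r x in \<open>auto simp: torus_def\<close>)

text \<open>The pointwise bound by the integral over one period is a bound by an average over the
  partition into a single cell.\<close>
lemma poincare_inequality:
  assumes p: "p \<in> log_exponents" and Ap: "\<omega> \<in> muckenhoupt p" and r: "1 \<le> r" "r \<le> m"
  obtains C where "0 < C" and "\<forall>g\<in>sobolev (Suc m) p \<omega>.
      lp_norm p \<omega> ((deriv ^^ r) g) \<le> ennreal C * lp_norm p \<omega> ((deriv ^^ (Suc m)) g)"
proof -
  let ?n = "lp_norm p \<omega>"
  have pe: "p \<in> exponents" using p by (simp add: log_exponents_def)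
  note p1 = exponentsD(1)[OF pe]
  obtain A where "0 < A" and A: "\<forall>N f. 1 \<le> N \<longrightarrow> f \<in> borel_measurable lebesgue \<longrightarrow>
      ?n (cell_average N f) \<le> ennreal A * ?n f"
    by (rule cell_average_norm_le[OF p Ap])
  define E where "E = (2 * pi) ^ (m - r) * (2 * pi)"
  have "0 < E" by (simp add: E_def)
  have "?n ((deriv ^^ r) g) \<le> ennreal (E * A) * ?n ((deriv ^^ (Suc m)) g)"
    if g: "g \<in> sobolev (Suc m) p \<omega>" for g
  proof -
    let ?T = "(deriv ^^ (Suc m)) g"
    note Tm = lp_spaceD(2)[OF sobolevD(2)[OF g]]
    have "AE x in lebesgue. x \<in> torus \<longrightarrow> \<bar>(deriv ^^ r) g x\<bar> \<le> \<bar>E * cell_average 1 ?T x\<bar>"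
    proof (rule AE_torus_cell[of 1])
      fix i x assume i: "i < (1::nat)" "x \<in> cell 1 i"
      have c: "cell 1 i = {-pi..<pi}" using i(1) by (simp add: cell_def)
      have "abs_integral (cell 1 i) ?T = abs_integral torus ?T"
        unfolding c torus_def by (rule nn_integral_half_open)
      then have "E * cell_average 1 ?T x = (2 * pi) ^ (m - r) * enn2real (abs_integral torus ?T)"
        by (simp only: cell_average_eq[OF i] E_def) simp
      moreover have "x \<in> torus" using cell_bounds(3)[OF i(1)] i(2) by blast
      ultimately show "\<bar>(deriv ^^ r) g x\<bar> \<le> \<bar>E * cell_average 1 ?T x\<bar>"
        using sobolev_derivative_bound[OF pe Ap g r] by (simp only:) (meson abs_ge_self order_trans)
    qed simp
    then have "?n ((deriv ^^ r) g) \<le> ?n (\<lambda>x. E * cell_average 1 ?T x)"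
      by (intro lp_norm_mono_AE[OF p1])
    also have "\<dots> \<le> ennreal E * ?n (cell_average 1 ?T)"
      by (rule lp_norm_scale_le[OF p1 \<open>0 < E\<close>])
    also have "\<dots> \<le> ennreal E * (ennreal A * ?n ?T)"
      using A Tm by (intro mult_left_mono) auto
    also have "\<dots> = ennreal (E * A) * ?n ?T"
      using \<open>0 < E\<close> \<open>0 < A\<close> by (simp add: ennreal_mult mult.assoc)
    finally show ?thesis .
  qed
  then show thesis using \<open>0 < E\<close> \<open>0 < A\<close> by (intro that[of "E * A"]) auto
qed

lemma lipschitz_imp_abs_continuous_on:
  assumes lip: "\<And>x y. a \<le> x \<Longrightarrow> x \<le> y \<Longrightarrow> y \<le> b \<Longrightarrow> \<bar>f y - f x\<bar> \<le> B * (y - x)"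
  shows "abs_continuous_on a b f"
  unfolding abs_continuous_on_def small_variation_def[symmetric]
proof (intro allI impI)
  fix e :: real assume "0 < e"
  define B' where "B' = max 1 B"
  show "\<exists>\<delta>>0. small_variation a b f \<delta> e"
    unfolding small_variation_def
  proof (intro exI[of _ "e / B'"] conjI allI impI)
    show "0 < e / B'" using \<open>0 < e\<close> by (simp add: B'_def)
    fix n :: nat and u v
    assume uv: "\<forall>i<n. a \<le> u i \<and> u i \<le> v i \<and> v i \<le> b" and small: "(\<Sum>i<n. v i - u i) < e / B'"
    have "(\<Sum>i<n. \<bar>f (v i) - f (u i)\<bar>) \<le> (\<Sum>i<n. B' * (v i - u i))"
    proof (rule sum_mono)
      fix i assume "i \<in> {..<n}"
      then have i: "a \<le> u i" "u i \<le> v i" "v i \<le> b" using uv by auto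
      have "B * (v i - u i) \<le> B' * (v i - u i)" using i by (intro mult_right_mono) (auto simp: B'_def)
      then show "\<bar>f (v i) - f (u i)\<bar> \<le> B' * (v i - u i)" using lip[OF i] by simp
    qed
    also have "\<dots> = B' * (\<Sum>i<n. v i - u i)" by (simp add: sum_distrib_left)
    also have "\<dots> < B' * (e / B')" using small by (intro mult_strict_left_mono) (auto simp: B'_def)
    also have "\<dots> = e" by (simp add: B'_def)
    finally show "(\<Sum>i<n. \<bar>f (v i) - f (u i)\<bar>) < e" .
  qed
qed

lemma derivative_measurable:
  fixes f f' :: "real \<Rightarrow> real"
  assumes f: "\<And>x. (f has_real_derivative f' x) (at x)"
  shows "f' \<in> borel_measurable lebesgue"
proof -
  have cont: "continuous_on UNIV f"
    using f by (meson DERIV_isCont continuous_at_imp_continuous_on)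
  have "f' \<in> borel_measurable borel"
  proof (rule borel_measurable_LIMSEQ_real)
    fix x
    have lim: "(\<lambda>n. inverse (real (Suc n))) \<longlonglongrightarrow> 0" by (rule LIMSEQ_inverse_real_of_nat)
    have "((\<lambda>h. (f (x + h) - f x) / h) \<longlongrightarrow> f' x) (at 0)"
      using f[of x] by (simp add: DERIV_def)
    moreover have "filterlim (\<lambda>n. inverse (real (Suc n))) (at 0) sequentially"
      using lim by (intro filterlim_atI) auto
    ultimately show "(\<lambda>n. (f (x + inverse (real (Suc n))) - f x) / inverse (real (Suc n))) \<longlonglongrightarrow> f' x"
      by (rule filterlim_compose)
  next
    fix n
    have "continuous_on UNIV (\<lambda>x. (f (x + inverse (real (Suc n))) - f x) / inverse (real (Suc n)))"
      by (intro continuous_intros continuous_on_compose2[OF cont]) auto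
    then show "(\<lambda>x. (f (x + inverse (real (Suc n))) - f x) / inverse (real (Suc n))) \<in> borel_measurable borel"
      by (rule borel_measurable_continuous_onI)
  qed
  then show ?thesis by (intro measurable_completion) simp
qed

text \<open>The derivative of order \<open>r\<close> is bounded on the torus, so the one of order \<open>r - 1\<close> is Lipschitz
  continuous, and the weighted norm of the former is finite by the Poincare inequality.\<close>
lemma sobolev_subset:
  assumes p: "p \<in> log_exponents" and Ap: "\<omega> \<in> muckenhoupt p" and r: "1 \<le> r" "r \<le> m"
    and g: "g \<in> sobolev (Suc m) p \<omega>"
  shows "g \<in> sobolev r p \<omega>"
proof -
  have pe: "p \<in> exponents" using p by (simp add: log_exponents_def)
  have r': "r - 1 < m" "Suc (r - 1) = r" using r by auto
  have D: "((deriv ^^ (r - 1)) g has_real_derivative (deriv ^^ r) g x) (at x)" for x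
    using sobolevD(4)[OF g r'(1)] unfolding r'(2) .
  define B where "B = (2 * pi) ^ (m - r) * enn2real (abs_integral torus ((deriv ^^ (Suc m)) g))"
  have B: "\<bar>(deriv ^^ r) g x\<bar> \<le> B" if "x \<in> {-pi..pi}" for x
    unfolding B_def using that by (intro sobolev_derivative_bound[OF pe Ap g r]) (simp add: torus_def)
  have "abs_continuous_on (-pi) pi ((deriv ^^ (r - 1)) g)"
  proof (rule lipschitz_imp_abs_continuous_on[where B = B])
    fix x y :: real assume xy: "-pi \<le> x" "x \<le> y" "y \<le> pi"
    have "norm ((deriv ^^ (r - 1)) g y - (deriv ^^ (r - 1)) g x) \<le> B * norm (y - x)"
      by (rule field_differentiable_bound[of "{-pi..pi}" _ "(deriv ^^ r) g"])
        (use B D xy in \<open>auto intro: has_field_derivative_at_within\<close>)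
    then show "\<bar>(deriv ^^ (r - 1)) g y - (deriv ^^ (r - 1)) g x\<bar> \<le> B * (y - x)" using xy by simp
  qed
  moreover have "(deriv ^^ r) g \<in> lp_space p \<omega>"
  proof -
    obtain C where "0 < C" and C: "\<forall>g\<in>sobolev (Suc m) p \<omega>.
        lp_norm p \<omega> ((deriv ^^ r) g) \<le> ennreal C * lp_norm p \<omega> ((deriv ^^ (Suc m)) g)"
      by (rule poincare_inequality[OF p Ap r])
    have "lp_norm p \<omega> ((deriv ^^ r) g) \<le> ennreal C * lp_norm p \<omega> ((deriv ^^ (Suc m)) g)"
      using C g by blast
    also have "\<dots> < \<infinity>"
      using lp_spaceD(3)[OF sobolevD(2)[OF g]] by (simp add: ennreal_mult_less_top)
    finally show ?thesis
      using sobolevD(5)[OF g] derivative_measurable[OF D]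
      by (simp add: lp_space_def periodic_fun_simple_def periodic_fun_def)
  qed
  moreover have "\<forall>j<r - 1. \<forall>x. (deriv ^^ j) g differentiable at x"
    using g r unfolding sobolev_def by auto
  ultimately show ?thesis
    using sobolevD(1)[OF g] by (simp add: sobolev_def)
qed

section \<open>The Marchaud inequality\<close>

lemma lp_norm_zero: "lp_norm p \<omega> (\<lambda>x. 0) = 0"
proof -
  have "lp_norm p \<omega> (\<lambda>x. 0) \<le> 0 + ennreal e" if "0 < e" for e
    using lp_norm_le[of e p \<omega> "\<lambda>x. 0"] that by (simp add: modular_def)
  from ennreal_le_epsilon[OF this] show ?thesis by simp
qed

lemma higher_deriv_zero: "(deriv ^^ j) (\<lambda>x::real. 0::real) = (\<lambda>x. 0)"
  by (induction j) auto

lemma zero_in_sobolev: "(\<lambda>x. 0) \<in> sobolev r p \<omega>"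
proof -
  have "(\<lambda>x. 0) \<in> lp_space p \<omega>"
    by (simp add: lp_space_def periodic_fun_simple_def periodic_fun_def lp_norm_zero)
  moreover have "abs_continuous_on (-pi) pi (\<lambda>x. 0)"
    by (rule lipschitz_imp_abs_continuous_on[where B = 0]) auto
  ultimately show ?thesis by (simp add: sobolev_def higher_deriv_zero)
qed

lemma K_functional_finite:
  assumes "f \<in> lp_space p \<omega>"
  shows "K_functional r f u p \<omega> < \<infinity>"
proof -
  have "K_functional r f u p \<omega> \<le> lp_norm p \<omega> (\<lambda>x. f x - (\<lambda>x. 0) x) +
      ennreal (u ^ r) * lp_norm p \<omega> ((deriv ^^ r) (\<lambda>x. 0))"
    unfolding K_functional_def by (rule INF_lower) (rule zero_in_sobolev)
  also have "\<dots> = lp_norm p \<omega> f" unfolding higher_deriv_zero by (simp add: lp_norm_zero)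
  also have "\<dots> < \<infinity>" by (rule lp_spaceD(3)[OF assms])
  finally show ?thesis .
qed

lemma K_functional_mono:
  assumes "0 \<le> u" "u \<le> v"
  shows "K_functional r f u p \<omega> \<le> K_functional r f v p \<omega>"
  unfolding K_functional_def
proof (rule INF_mono)
  fix g assume g: "g \<in> sobolev r p \<omega>"
  have "ennreal (u ^ r) \<le> ennreal (v ^ r)" using assms by (intro ennreal_leI power_mono)
  then show "\<exists>h\<in>sobolev r p \<omega>. lp_norm p \<omega> (\<lambda>x. f x - h x) + ennreal (u ^ r) * lp_norm p \<omega> ((deriv ^^ r) h) \<le>
      lp_norm p \<omega> (\<lambda>x. f x - g x) + ennreal (v ^ r) * lp_norm p \<omega> ((deriv ^^ r) g)"
    using g by (intro bexI[of _ g] add_left_mono mult_right_mono) auto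
qed

text \<open>On the interval from \<open>2 ^ j * t\<close> to \<open>2 ^ (j + 1) * t\<close> the integrand is at least
  \<open>F (2 ^ j * t) / (2 ^ (j + 1) * t) ^ (r + 1)\<close>, because \<open>F\<close> is increasing.\<close>
lemma dyadic_sum_le_integral:
  fixes F :: "real \<Rightarrow> ennreal"
  assumes mono: "\<And>u v. 0 \<le> u \<Longrightarrow> u \<le> v \<Longrightarrow> F u \<le> F v" and "0 < t" and J: "2 ^ (Suc J) * t \<le> 1"
  shows "(\<Sum>j\<le>J. ennreal (1 / (2 ^ j * t) ^ r) * F (2 ^ j * t)) \<le>
    ennreal (2 ^ (r + 1)) * (\<integral>\<^sup>+u\<in>{t..1}. F u / ennreal (u ^ (r + 1)) \<partial>lborel)"
proof -
  define a where "a j = 2 ^ j * t" for j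
  have a: "0 < a j" "a (Suc j) = 2 * a j" for j using \<open>0 < t\<close> by (auto simp: a_def)
  have amono: "a i \<le> a j" if "i \<le> j" for i j
    using that \<open>0 < t\<close> by (simp add: a_def)
  let ?c = "\<lambda>j. F (a j) * ennreal (1 / a (Suc j) ^ (r + 1))"
  have uniq: "i = j" if "u \<in> {a i..<a (Suc i)}" "u \<in> {a j..<a (Suc j)}" for i j u
  proof (rule ccontr)
    assume "i \<noteq> j"
    then have "Suc i \<le> j \<or> Suc j \<le> i" by linarith
    then have "a (Suc i) \<le> a j \<or> a (Suc j) \<le> a i" using amono by blast
    with that show False by auto
  qed
  have "(\<Sum>j\<le>J. ennreal (1 / a j ^ r) * F (a j)) =
      ennreal (2 ^ (r + 1)) * (\<Sum>j\<le>J. ?c j * emeasure lborel {a j..<a (Suc j)})"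
    unfolding sum_distrib_left
  proof (rule sum.cong[OF refl])
    fix j
    have "emeasure lborel {a j..<a (Suc j)} = ennreal (a j)" using a[of j] by simp
    moreover have "ennreal (1 / a j ^ r) = ennreal (2 ^ (r + 1)) * (ennreal (1 / a (Suc j) ^ (r + 1)) * ennreal (a j))"
    proof -
      have "1 / a j ^ r = 2 ^ (r + 1) * (1 / a (Suc j) ^ (r + 1) * a j)"
        using a[of j] by (simp add: power_mult_distrib field_simps)
      then show ?thesis
        using a(1)[of j] a(1)[of "Suc j"] by (simp add: ennreal_mult[symmetric])
    qed
    ultimately show "ennreal (1 / a j ^ r) * F (a j) =
        ennreal (2 ^ (r + 1)) * (?c j * emeasure lborel {a j..<a (Suc j)})"
      by (simp only: mult_ac)
  qed
  also have "(\<Sum>j\<le>J. ?c j * emeasure lborel {a j..<a (Suc j)}) =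
      (\<integral>\<^sup>+u. (\<Sum>j\<le>J. ?c j * indicator {a j..<a (Suc j)} u) \<partial>lborel)"
    by (subst nn_integral_sum) (auto simp: nn_integral_cmult)
  also have "\<dots> \<le> (\<integral>\<^sup>+u\<in>{t..1}. F u / ennreal (u ^ (r + 1)) \<partial>lborel)"
  proof (rule nn_integral_mono)
    fix u
    show "(\<Sum>j\<le>J. ?c j * indicator {a j..<a (Suc j)} u) \<le> F u / ennreal (u ^ (r + 1)) * indicator {t..1} u"
    proof (cases "\<exists>j\<le>J. u \<in> {a j..<a (Suc j)}")
      case True
      then obtain j where j: "j \<le> J" "u \<in> {a j..<a (Suc j)}" by blast
      have ind: "indicator {a i..<a (Suc i)} u = (if i = j then 1 else (0::ennreal))" for i
        using uniq[of u i j] j(2) by (cases "i = j") (auto simp: indicator_def)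
      have "(\<Sum>i\<le>J. ?c i * indicator {a i..<a (Suc i)} u) = (\<Sum>i\<le>J. if i = j then ?c j else 0)"
        unfolding ind by (intro sum.cong) auto
      also have "\<dots> = ?c j" using j(1) by simp
      also have "\<dots> \<le> F u * ennreal (1 / u ^ (r + 1))"
      proof (intro mult_mono ennreal_leI)
        have u: "0 < u" "a j \<le> u" "u \<le> a (Suc j)" using j(2) a(1)[of j] by auto
        then show "F (a j) \<le> F u" using a(1)[of j] by (intro mono) auto
        show "1 / a (Suc j) ^ (r + 1) \<le> 1 / u ^ (r + 1)"
          using u a(1)[of "Suc j"] by (intro divide_left_mono power_mono mult_pos_pos zero_less_power) auto
      qed auto
      also have "\<dots> = F u / ennreal (u ^ (r + 1)) * indicator {t..1} u"
      proof -
        have "t \<le> u" using j(2) amono[of 0 j] by (simp add: a_def)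
        moreover have "u \<le> 1" using j(2) amono[of "Suc j" "Suc J"] j(1) J by (simp add: a_def)
        ultimately show ?thesis
          using \<open>0 < t\<close> by (simp add: divide_ennreal_def inverse_ennreal divide_inverse)
      qed
      finally show ?thesis .
    next
      case False
      then have "(\<Sum>j\<le>J. ?c j * indicator {a j..<a (Suc j)} u) = 0" by (intro sum.neutral) auto
      then show ?thesis by (simp only: zero_le)
    qed
  qed
  finally show ?thesis by (simp only: a_def) (simp add: mult_left_mono)
qed

lemma dyadic_scale:
  fixes t :: real
  assumes "0 < t" "t < 1/2"
  obtains J :: nat where "1/4 < 2 ^ J * t" "2 ^ (Suc J) * t \<le> 1"
proof -
  define n where "n = (LEAST n::nat. 1/2 < 2 ^ n * t)"
  have "\<exists>n::nat. 1 / (2 * t) < 2 ^ n" using real_arch_pow[of 2 "1 / (2 * t)"] by simp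
  then have "\<exists>n::nat. 1/2 < 2 ^ n * t" using assms by (simp add: field_simps)
  then have n: "1/2 < 2 ^ n * t" unfolding n_def by (rule LeastI_ex)
  then have "n \<noteq> 0" using assms by (cases n) auto
  then obtain J where J: "n = Suc J" by (cases n) auto
  have "\<not> 1/2 < 2 ^ J * t" using not_less_Least[of J "\<lambda>n. 1/2 < 2 ^ n * t"] J by (simp add: n_def)
  with n J show thesis by (intro that[of J]) auto
qed

lemma K_functional_witness:
  assumes "f \<in> lp_space p \<omega>" and "0 < \<epsilon>"
  obtains g where "g \<in> sobolev r p \<omega>"
    and "lp_norm p \<omega> (\<lambda>x. f x - g x) \<le> K_functional r f u p \<omega> + ennreal \<epsilon>"
    and "ennreal (u ^ r) * lp_norm p \<omega> ((deriv ^^ r) g) \<le> K_functional r f u p \<omega> + ennreal \<epsilon>"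
proof -
  let ?K = "K_functional r f u p \<omega>"
  have "?K < ?K + ennreal \<epsilon>"
    using K_functional_finite[OF assms(1), of r u] assms(2) by (cases ?K) (auto simp: ennreal_plus[symmetric] ennreal_less_iff simp del: ennreal_plus)
  then obtain g where g: "g \<in> sobolev r p \<omega>"
    "lp_norm p \<omega> (\<lambda>x. f x - g x) + ennreal (u ^ r) * lp_norm p \<omega> ((deriv ^^ r) g) < ?K + ennreal \<epsilon>"
    using INF_less_iff[of "\<lambda>g. lp_norm p \<omega> (\<lambda>x. f x - g x) + ennreal (u ^ r) * lp_norm p \<omega> ((deriv ^^ r) g)"
        "sobolev r p \<omega>" "?K + ennreal \<epsilon>"]
    unfolding K_functional_def by blast
  have "X \<le> X + Y" "Y \<le> X + Y" for X Y :: ennreal by simp_all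
  with g show thesis by (intro that[OF g(1)]) (meson less_imp_le order_trans)+
qed

lemma lp_norm_telescope:
  assumes p: "p \<in> exponents" and w: "\<omega> \<in> borel_measurable lebesgue"
    and meas: "\<And>j. D j \<in> borel_measurable lebesgue"
  shows "lp_norm p \<omega> (D 0) \<le> lp_norm p \<omega> (D J) + (\<Sum>j<J. lp_norm p \<omega> (\<lambda>x. D j x - D (Suc j) x))"
proof (induction J)
  let ?n = "lp_norm p \<omega>"
  case (Suc J)
  note p1 = exponentsD(1)[OF p] and pm = exponentsD(2)[OF p]
  have "?n (\<lambda>x. D (Suc J) x + (D J x - D (Suc J) x)) \<le>
      ?n (D (Suc J)) + ?n (\<lambda>x. D J x - D (Suc J) x)"
    using meas by (intro lp_norm_triangle[OF p1 pm w]) auto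
  then have "?n (D J) \<le> ?n (D (Suc J)) + ?n (\<lambda>x. D J x - D (Suc J) x)"
    by simp
  then have "?n (D J) + (\<Sum>j<J. ?n (\<lambda>x. D j x - D (Suc j) x)) \<le>
      ?n (D (Suc J)) + ?n (\<lambda>x. D J x - D (Suc J) x) +
      (\<Sum>j<J. ?n (\<lambda>x. D j x - D (Suc j) x))"
    by (rule add_right_mono)
  from order_trans[OF Suc this] show ?case by (simp add: add_ac)
qed simp

text \<open>Let \<open>g j\<close> be a near-minimiser of the functional of order \<open>r + k\<close> at \<open>u j = 2 ^ j * t\<close>, and write
  \<open>g 0 = g J + (g 0 - g 1) + \<dots> + (g (J - 1) - g J)\<close>. The interpolation inequality at scale \<open>u j\<close> bounds
  the derivative of order \<open>r\<close> of \<open>g j - g (j + 1)\<close> by a multiple of \<open>1 / u j ^ r\<close> times the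
  functionals at \<open>u j\<close> and \<open>u (j + 1)\<close>. The remaining term \<open>g J\<close> is treated by the Poincare
  inequality, since \<open>u J\<close> is bounded below.\<close>
lemma K_functional_dyadic_sum:
  assumes p: "p \<in> log_exponents" and Ap: "\<omega> \<in> muckenhoupt p" and rk: "1 \<le> r" "1 \<le> k"
  obtains C where "0 < C"
    and "\<forall>f\<in>lp_space p \<omega>. \<forall>t J. 0 < t \<and> 1/4 < 2 ^ J * t \<and> 2 ^ Suc J * t \<le> 1 \<longrightarrow>
      K_functional r f t p \<omega> \<le> ennreal C * ennreal (t ^ r) *
        (\<Sum>j\<le>J. ennreal (1 / (2 ^ j * t) ^ r) * K_functional (r + k) f (2 ^ j * t) p \<omega>)"
proof -
  let ?n = "lp_norm p \<omega>" and ?D = "deriv ^^ r" and ?T = "deriv ^^ (r + k)"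
  have pe: "p \<in> exponents" using p by (simp add: log_exponents_def)
  note p1 = exponentsD(1)[OF pe] and pm = exponentsD(2)[OF pe]
  have wm: "\<omega> \<in> borel_measurable lebesgue" using Ap by (simp add: muckenhoupt_def is_weight_def)
  define m where "m = r + k - 1"
  have m: "Suc m = r + k" "r \<le> m" using rk by (auto simp: m_def)
  obtain C1 where "0 < C1" and C1: "\<forall>g1\<in>sobolev (r + k) p \<omega>. \<forall>g2\<in>sobolev (r + k) p \<omega>. \<forall>u. 0 < u \<and> u \<le> 1 \<longrightarrow>
      ?n (\<lambda>x. ?D g1 x - ?D g2 x) \<le>
        ennreal (C1 / u ^ r) * (?n (\<lambda>x. g1 x - g2 x) +
        ennreal (u ^ (r + k)) *
          (?n (?T g1) + ?n (?T g2)))"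
    by (rule interpolation_inequality[OF p Ap rk(1) m(2), unfolded m(1)])
  obtain C2 where "0 < C2" and C2: "\<forall>g\<in>sobolev (Suc m) p \<omega>.
      ?n (?D g) \<le> ennreal C2 * ?n ((deriv ^^ (Suc m)) g)"
    by (rule poincare_inequality[OF p Ap rk(1) m(2)])
  define C3 where "C3 = C2 * 4 ^ k + 2 * C1 + 2 * C1 * 2 ^ r"
  have "0 < C3" using \<open>0 < C1\<close> \<open>0 < C2\<close> by (simp add: C3_def add_pos_pos)
  have "K_functional r f t p \<omega> \<le> ennreal (1 + C3) * ennreal (t ^ r) *
        (\<Sum>j\<le>J. ennreal (1 / (2 ^ j * t) ^ r) * K_functional (r + k) f (2 ^ j * t) p \<omega>)"
    if f: "f \<in> lp_space p \<omega>" and t: "0 < t" and J: "1/4 < 2 ^ J * t" "2 ^ Suc J * t \<le> 1" for f t J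
  proof -
    define u where "u j = 2 ^ j * t" for j
    have u: "0 < u j" "u (Suc j) = 2 * u j" for j using t by (auto simp: u_def)
    have u1: "u j \<le> 1" if "j \<le> J" for j
    proof -
      have "u j \<le> u (Suc J)" unfolding u_def using t that by (intro mult_right_mono power_increasing) auto
      then show ?thesis using J(2) by (simp add: u_def)
    qed
    let ?K = "\<lambda>j. K_functional (r + k) f (u j) p \<omega>"
    have bound: "K_functional r f t p \<omega> \<le> ennreal (1 + C3) * ennreal (t ^ r) *
        (\<Sum>j\<le>J. ennreal (1 / u j ^ r) * (?K j + ennreal \<epsilon>))" if "0 < \<epsilon>" for \<epsilon>
    proof -
      define \<kappa> where "\<kappa> j = ?K j + ennreal \<epsilon>" for j
      define b where "b j = ennreal (1 / u j ^ r) * \<kappa> j" for j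
      have "\<exists>g. g \<in> sobolev (r + k) p \<omega> \<and> ?n (\<lambda>x. f x - g x) \<le> \<kappa> j \<and>
          ennreal (u j ^ (r + k)) * ?n (?T g) \<le> \<kappa> j" for j
        unfolding \<kappa>_def by (rule K_functional_witness[OF f \<open>0 < \<epsilon>\<close>]) blast
      then obtain g where g: "\<And>j. g j \<in> sobolev (r + k) p \<omega>" "\<And>j. ?n (\<lambda>x. f x - g j x) \<le> \<kappa> j"
        "\<And>j. ennreal (u j ^ (r + k)) * ?n (?T (g j)) \<le> \<kappa> j"
        by metis
      have gm: "g j \<in> borel_measurable lebesgue" for j
        using lp_spaceD(2) sobolevD(1)[of "g j" m] g(1) m(1) by metis
      have gr: "g j \<in> sobolev r p \<omega>" for j
        using sobolev_subset[OF p Ap rk(1) m(2)] g(1) m(1) by metis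
      have Dm: "?D (g j) \<in> borel_measurable lebesgue" for j
      proof -
        have "?D (g j) \<in> lp_space p \<omega>" using gr[of j] by (simp add: sobolev_def)
        then show ?thesis by (rule lp_spaceD(2))
      qed
      have fm: "f \<in> borel_measurable lebesgue" by (rule lp_spaceD(2)[OF f])
      have diff: "?n (\<lambda>x. g j x - g (Suc j) x) \<le> \<kappa> j + \<kappa> (Suc j)" for j
      proof -
        have "?n (\<lambda>x. (g j x - f x) + (f x - g (Suc j) x)) \<le>
            ?n (\<lambda>x. g j x - f x) + ?n (\<lambda>x. f x - g (Suc j) x)"
          using gm fm by (intro lp_norm_triangle[OF p1 pm wm]) auto
        also have "?n (\<lambda>x. g j x - f x) \<le> ?n (\<lambda>x. f x - g j x)"
          by (intro lp_norm_mono_AE[OF p1]) (auto simp: abs_minus_commute)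
        also have "\<dots> \<le> \<kappa> j" by (rule g(2))
        also have "?n (\<lambda>x. f x - g (Suc j) x) \<le> \<kappa> (Suc j)" by (rule g(2))
        finally show ?thesis by simp
      qed
      have step: "?n (\<lambda>x. ?D (g j) x - ?D (g (Suc j)) x) \<le>
          ennreal (2 * C1) * b j + ennreal (2 * C1 * 2 ^ r) * b (Suc j)" if "j \<le> J" for j
      proof -
        have "?n (\<lambda>x. ?D (g j) x - ?D (g (Suc j)) x) \<le>
          ennreal (C1 / u j ^ r) * (?n (\<lambda>x. g j x - g (Suc j) x) +
          ennreal (u j ^ (r + k)) *
          (?n (?T (g j)) + ?n (?T (g (Suc j)))))"
          using C1 g(1) u(1) u1[OF that] by blast
        also have "\<dots> \<le> ennreal (C1 / u j ^ r) * ((\<kappa> j + \<kappa> (Suc j)) + (\<kappa> j + \<kappa> (Suc j)))"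
          unfolding distrib_left[of "ennreal (u j ^ (r + k))"]
        proof (intro mult_left_mono add_mono diff g(3))
          have "ennreal (u j ^ (r + k)) \<le> ennreal (u (Suc j) ^ (r + k))"
            using u[of j] by (intro ennreal_leI power_mono) auto
          then have "ennreal (u j ^ (r + k)) * ?n (?T (g (Suc j))) \<le>
              ennreal (u (Suc j) ^ (r + k)) * ?n (?T (g (Suc j)))"
            by (rule mult_right_mono) simp
          also have "\<dots> \<le> \<kappa> (Suc j)" by (rule g(3))
          finally show "ennreal (u j ^ (r + k)) * ?n (?T (g (Suc j))) \<le> \<kappa> (Suc j)" .
        qed simp
        also have "\<dots> = ennreal (2 * C1 / u j ^ r) * \<kappa> j + ennreal (2 * C1 / u j ^ r) * \<kappa> (Suc j)"
        proof -
          have "ennreal (2 * C1 / u j ^ r) = ennreal (C1 / u j ^ r) + ennreal (C1 / u j ^ r)"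
            using \<open>0 < C1\<close> u(1)[of j] by (subst ennreal_plus[symmetric]) auto
          then show ?thesis by (simp only: distrib_left distrib_right add_ac)
        qed
        also have "ennreal (2 * C1 / u j ^ r) * \<kappa> j = ennreal (2 * C1) * b j"
        proof -
          have "ennreal (2 * C1 / u j ^ r) = ennreal (2 * C1) * ennreal (1 / u j ^ r)"
            using \<open>0 < C1\<close> u(1)[of j] by (subst ennreal_mult[symmetric]) auto
          then show ?thesis by (simp only: b_def mult.assoc)
        qed
        also have "ennreal (2 * C1 / u j ^ r) * \<kappa> (Suc j) = ennreal (2 * C1 * 2 ^ r) * b (Suc j)"
        proof -
          have "2 * C1 / u j ^ r = 2 * C1 * 2 ^ r * (1 / u (Suc j) ^ r)"
            using u[of j] by (simp add: power_mult_distrib)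
          then have "ennreal (2 * C1 / u j ^ r) = ennreal (2 * C1 * 2 ^ r) * ennreal (1 / u (Suc j) ^ r)"
            using \<open>0 < C1\<close> u(1)[of "Suc j"] by (subst ennreal_mult[symmetric]) auto
          then show ?thesis by (simp only: b_def mult.assoc)
        qed
        finally show ?thesis .
      qed
      have last: "?n (?D (g J)) \<le> ennreal (C2 * 4 ^ k) * b J"
      proof -
        have "?n (?D (g J)) \<le> ennreal C2 * ?n (?T (g J))"
          using C2 g(1) unfolding m(1) by blast
        also have "\<dots> \<le> ennreal (C2 * 4 ^ k) * (ennreal (1 / u J ^ r) *
            (ennreal (u J ^ (r + k)) * ?n (?T (g J))))"
        proof -
          have "1 / 4 \<le> u J" using J(1) by (simp add: u_def)
          then have "(1 / 4) ^ k \<le> u J ^ k" by (intro power_mono) auto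
          then have "1 \<le> 4 ^ k * u J ^ k" by (simp add: power_divide field_simps)
          then have "C2 * 1 \<le> C2 * (4 ^ k * u J ^ k)" using \<open>0 < C2\<close> by (intro mult_left_mono) auto
          also have "\<dots> = C2 * 4 ^ k * (1 / u J ^ r * u J ^ (r + k))"
            using u(1)[of J] by (simp add: power_add)
          finally have "ennreal C2 \<le> ennreal (C2 * 4 ^ k * (1 / u J ^ r * u J ^ (r + k)))"
            by (intro ennreal_leI) simp
          also have "\<dots> = ennreal (C2 * 4 ^ k) * (ennreal (1 / u J ^ r) * ennreal (u J ^ (r + k)))"
            using \<open>0 < C2\<close> u(1)[of J] by (simp only: ennreal_mult less_imp_le zero_le_mult_iff zero_le_divide_iff zero_le_power zero_le_one zero_le_numeral simp_thms)
          finally have "ennreal C2 * ?n (?T (g J)) \<le>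
              ennreal (C2 * 4 ^ k) * (ennreal (1 / u J ^ r) * ennreal (u J ^ (r + k))) * ?n (?T (g J))"
            by (rule mult_right_mono) simp
          then show ?thesis by (simp only: mult.assoc)
        qed
        also have "\<dots> \<le> ennreal (C2 * 4 ^ k) * b J"
          unfolding b_def by (intro mult_left_mono g(3)) auto
        finally show ?thesis .
      qed
      let ?S = "\<Sum>j\<le>J. b j"
      have bS: "b j \<le> ?S" if "j \<le> J" for j using that by (intro member_le_sum) auto
      have "?n (?D (g 0)) \<le> ?n (?D (g J)) +
          (\<Sum>j<J. ?n (\<lambda>x. ?D (g j) x - ?D (g (Suc j)) x))"
        by (rule lp_norm_telescope[OF pe wm, of "\<lambda>j. ?D (g j)"]) (rule Dm)
      also have "\<dots> \<le> ennreal (C2 * 4 ^ k) * b J + (\<Sum>j<J. ennreal (2 * C1) * b j + ennreal (2 * C1 * 2 ^ r) * b (Suc j))"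
        by (intro add_mono last sum_mono step) auto
      also have "\<dots> = ennreal (C2 * 4 ^ k) * b J + (ennreal (2 * C1) * (\<Sum>j<J. b j) +
          ennreal (2 * C1 * 2 ^ r) * (\<Sum>j<J. b (Suc j)))"
        by (simp only: sum.distrib sum_distrib_left)
      also have "\<dots> \<le> ennreal (C2 * 4 ^ k) * ?S + (ennreal (2 * C1) * ?S + ennreal (2 * C1 * 2 ^ r) * ?S)"
      proof (intro add_mono mult_left_mono bS)
        show "(\<Sum>j<J. b j) \<le> ?S" by (intro sum_mono2) auto
        have "(\<Sum>j<J. b (Suc j)) = (\<Sum>j\<in>Suc ` {..<J}. b j)"
          by (subst sum.reindex) auto
        also have "\<dots> \<le> ?S" by (intro sum_mono2) auto
        finally show "(\<Sum>j<J. b (Suc j)) \<le> ?S" .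
      qed auto
      also have "\<dots> = ennreal C3 * ?S"
        using \<open>0 < C1\<close> \<open>0 < C2\<close> by (simp add: C3_def ennreal_plus distrib_right add.assoc)
      finally have top: "?n (?D (g 0)) \<le> ennreal C3 * ?S" .
      have "\<kappa> 0 = ennreal (t ^ r) * b 0"
      proof -
        have "ennreal (t ^ r) * ennreal (1 / u 0 ^ r) = 1"
          using t by (subst ennreal_mult[symmetric]) (auto simp: u_def)
        then show ?thesis by (simp only: b_def mult.assoc[symmetric] mult_1)
      qed
      then have first: "?n (\<lambda>x. f x - g 0 x) \<le> ennreal (t ^ r) * ?S"
        using g(2)[of 0] bS[of 0] by (metis le0 mult_left_mono order_trans zero_le)
      have "K_functional r f t p \<omega> \<le> ?n (\<lambda>x. f x - g 0 x) + ennreal (t ^ r) * ?n (?D (g 0))"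
        unfolding K_functional_def by (rule INF_lower) (rule gr)
      also have "\<dots> \<le> ennreal (t ^ r) * ?S + ennreal (t ^ r) * (ennreal C3 * ?S)"
        by (intro add_mono first mult_left_mono top) auto
      also have "\<dots> = ennreal (1 + C3) * ennreal (t ^ r) * ?S"
      proof -
        have "ennreal (1 + C3) = 1 + ennreal C3" using \<open>0 < C3\<close> by (simp add: ennreal_plus)
        then show ?thesis by (simp add: distrib_right distrib_left mult_ac)
      qed
      finally show ?thesis by (simp only: b_def \<kappa>_def)
    qed
    let ?S = "\<Sum>j\<le>J. ennreal (1 / u j ^ r) * ?K j"
    \<comment> \<open>The excess \<open>\<epsilon>\<close> over the functionals contributes \<open>M * \<epsilon>\<close>, which is made smaller than any \<open>e\<close>.\<close>
    define M where "M = (1 + C3) * t ^ r * (\<Sum>j\<le>J. 1 / u j ^ r)"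
    have "0 \<le> M" unfolding M_def using \<open>0 < C3\<close> t u(1)
      by (intro mult_nonneg_nonneg sum_nonneg) (auto intro: less_imp_le)
    have "K_functional r f t p \<omega> \<le> ennreal (1 + C3) * ennreal (t ^ r) * ?S + ennreal e" if "0 < e" for e
    proof -
      define \<epsilon> where "\<epsilon> = e / (M + 1)"
      have "0 < \<epsilon>" using \<open>0 < e\<close> \<open>0 \<le> M\<close> by (simp add: \<epsilon>_def)
      have "(\<Sum>j\<le>J. ennreal (1 / u j ^ r) * (?K j + ennreal \<epsilon>)) = ?S + ennreal (\<Sum>j\<le>J. 1 / u j ^ r) * ennreal \<epsilon>"
        using u(1) by (simp add: distrib_left sum.distrib sum_distrib_right[symmetric] sum_ennreal less_imp_le)
      then have "K_functional r f t p \<omega> \<le> ennreal (1 + C3) * ennreal (t ^ r) *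
          (?S + ennreal (\<Sum>j\<le>J. 1 / u j ^ r) * ennreal \<epsilon>)"
        using bound[OF \<open>0 < \<epsilon>\<close>] by simp
      also have "\<dots> = ennreal (1 + C3) * ennreal (t ^ r) * ?S + ennreal (M * \<epsilon>)"
      proof -
        have nn: "0 \<le> 1 + C3" "0 \<le> t ^ r" "0 \<le> (\<Sum>j\<le>J. 1 / u j ^ r)" "0 \<le> \<epsilon>"
          using \<open>0 < C3\<close> t u(1) \<open>0 < \<epsilon>\<close> by (auto intro!: sum_nonneg intro: less_imp_le)
        have "ennreal (M * \<epsilon>) = ennreal (1 + C3) * ennreal (t ^ r) * (ennreal (\<Sum>j\<le>J. 1 / u j ^ r) * ennreal \<epsilon>)"
          unfolding M_def using nn by (simp add: ennreal_mult mult_nonneg_nonneg mult.assoc del: ennreal_plus)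
        then show ?thesis by (simp only: distrib_left)
      qed
      also have "M * \<epsilon> \<le> e" using \<open>0 \<le> M\<close> \<open>0 < e\<close> by (simp add: \<epsilon>_def field_simps)
      finally show ?thesis by (simp add: add_left_mono ennreal_leI)
    qed
    from ennreal_le_epsilon[OF this] show ?thesis unfolding u_def .
  qed
  then show thesis using \<open>0 < C3\<close> by (intro that[of "1 + C3"]) auto
qed

theorem theorem3p7:
  fixes r k :: nat and p :: "real \<Rightarrow> real" and \<omega> :: "real \<Rightarrow> ennreal"
  assumes "1 \<le> r" and "1 \<le> k" and "p \<in> log_exponents" and "\<omega> \<in> muckenhoupt p"
  shows "\<exists>c::real. 0 < c \<and> (\<forall>f\<in>lp_space p \<omega>. \<forall>t\<in>{0<..<1/2}.
    K_functional r f t p \<omega> \<le>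
      ennreal c * ennreal (t ^ r) *
      (\<integral>\<^sup>+u\<in>{t..1}. K_functional (r + k) f u p \<omega> / ennreal (u ^ (r + 1)) \<partial>lborel))"
proof -
  obtain C where "0 < C" and C: "\<forall>f\<in>lp_space p \<omega>. \<forall>t J. 0 < t \<and> 1/4 < 2 ^ J * t \<and> 2 ^ Suc J * t \<le> 1 \<longrightarrow>
      K_functional r f t p \<omega> \<le> ennreal C * ennreal (t ^ r) *
        (\<Sum>j\<le>J. ennreal (1 / (2 ^ j * t) ^ r) * K_functional (r + k) f (2 ^ j * t) p \<omega>)"
    by (rule K_functional_dyadic_sum[OF assms(3,4,1,2)])
  have "K_functional r f t p \<omega> \<le> ennreal (C * 2 ^ (r + 1)) * ennreal (t ^ r) *
      (\<integral>\<^sup>+u\<in>{t..1}. K_functional (r + k) f u p \<omega> / ennreal (u ^ (r + 1)) \<partial>lborel)"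
    if f: "f \<in> lp_space p \<omega>" and t: "0 < t" "t < 1/2" for f t
  proof -
    let ?I = "\<integral>\<^sup>+u\<in>{t..1}. K_functional (r + k) f u p \<omega> / ennreal (u ^ (r + 1)) \<partial>lborel"
    obtain J :: nat where J: "1/4 < 2 ^ J * t" "2 ^ Suc J * t \<le> 1"
      by (rule dyadic_scale[OF t])
    have "K_functional r f t p \<omega> \<le> ennreal C * ennreal (t ^ r) *
        (\<Sum>j\<le>J. ennreal (1 / (2 ^ j * t) ^ r) * K_functional (r + k) f (2 ^ j * t) p \<omega>)"
      using C f t(1) J by blast
    also have "\<dots> \<le> ennreal C * ennreal (t ^ r) * (ennreal (2 ^ (r + 1)) * ?I)"
      using t(1) J(2) by (intro mult_left_mono dyadic_sum_le_integral K_functional_mono) auto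
    also have "\<dots> = ennreal (C * 2 ^ (r + 1)) * ennreal (t ^ r) * ?I"
    proof -
      have "ennreal (C * 2 ^ (r + 1)) = ennreal C * ennreal (2 ^ (r + 1))"
        using \<open>0 < C\<close> by (intro ennreal_mult) auto
      then show ?thesis by (simp only: mult_ac)
    qed
    finally show ?thesis .
  qed
  then show ?thesis
    using \<open>0 < C\<close> by (intro exI[of _ "C * 2 ^ (r + 1)"]) auto
qed

end
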